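(* Let $\Bbbk$ be an algebraically closed field of characteristic zero. Let $A$ be the unimodular quadratic Poisson structure on $\Bbbk[x,y,z]$ (with $\deg x=\deg y=\deg z=1$) with irreducible potential $\Omega$. Then (1) $\displaystyle h_{PH^0(A)}(t)=\frac{1}{1-t^3}$. (2) $\displaystyle h_{PH^1(A)}(t)=\frac{1}{1-t^3}$. (3) $\displaystyle h_{PH^2(A)}(t)=\frac{1}{t^3}\Big(\frac{(1+t)^3}{1-t^3}-1\Big)$. (4) $\displaystyle h_{PH^3(A)}(t)=\frac{(1+t)^3}{t^3(1-t^3)}$.
   Context: The unimodular quadratic Poisson structure with potential $\Omega$ (a homogeneous polynomial of degree $3$) is the Poisson bracket on $\Bbbk[x,y,z]$ determined by $\{x,y\}=\frac{\partial\Omega}{\partial z}$, $\{y,z\}=\frac{\partial\Omega}{\partial x}$, $\{z,x\}=\frac{\partial\Omega}{\partial y}$. Poisson cohomology: ${\mathfrak X}^q(A)$ is the space of skew-symmetric $q$-derivations of $A$ (${\mathfrak X}^0(A)=A$), graded so that $Q$ has degree $d$ if $\deg Q[F_1,\ldots,F_q]=\sum\deg F_i+d$ for homogeneous $F_i$. The differential $d_\pi^q:{\mathfrak X}^q(A)\to{\mathfrak X}^{q+1}(A)$ is $$d_\pi^q(Q)[F_0,\ldots,F_q]=\sum_{i=0}^q(-1)^i\{F_i,Q[F_0,\ldots,\widehat{F_i},\ldots,F_q]\}+\sum_{0\le i<j\le q}(-1)^{i+j}Q[\{F_i,F_j\},F_0,\ldots,\widehat{F_i},\ldots,\widehat{F_j},\ldots,F_q],$$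 and $PH^q(A)=\ker d_\pi^q/\operatorname{im} d_\pi^{q-1}$, a graded vector space. The Hilbert series of a $\mathbb{Z}$-graded vector space $M$ is $h_M(t)=\sum_{i\in\mathbb{Z}}(\dim_\Bbbk M_i)t^i$. *)

theory Defs
  imports
    "HOL-Algebra.AbelCoset"
    "Jordan_Normal_Form.VS_Connect"
    "HOL-Computational_Algebra.Formal_Laurent_Series"
begin

section \<open>The polynomial ring in three variables\<close>

text \<open>
  The ring \<open>k[x,y,z]\<close> is modelled as \<open>k[x][y][z]\<close>: the outermost polynomial variable is \<open>z\<close>,
  the innermost one is \<open>x\<close>.
\<close>

type_synonym 'k pol3 = "'k poly poly poly"

definition const3 :: "'k::zero \<Rightarrow> 'k pol3" where
  "const3 c = [:[:[:c:]:]:]"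

definition var_x :: "'k::comm_semiring_1 pol3" where "var_x = [:[:[:0, 1:]:]:]"
definition var_y :: "'k::comm_semiring_1 pol3" where "var_y = [:[:0, 1:]:]"
definition var_z :: "'k::comm_semiring_1 pol3" where "var_z = [:0, 1:]"

definition partial_x :: "'k::idom pol3 \<Rightarrow> 'k pol3" where
  "partial_x = map_poly (map_poly pderiv)"
definition partial_y :: "'k::idom pol3 \<Rightarrow> 'k pol3" where
  "partial_y = map_poly pderiv"
definition partial_z :: "'k::idom pol3 \<Rightarrow> 'k pol3" where
  "partial_z = pderiv"

text \<open>
  The degree is an integer because the degrees of multiderivations may be negative.
  The zero polynomial is homogeneous of every degree, and the only one of negative degree.
\<close>

definition homogeneous :: "int \<Rightarrow> 'k::zero pol3 \<Rightarrow> bool" where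
  "homogeneous n F \<longleftrightarrow>
     (\<forall>a b c. coeff (coeff (coeff F c) b) a \<noteq> 0 \<longrightarrow> int (a + b + c) = n)"


section \<open>Derivations and Poisson brackets\<close>

definition derivation :: "('k::comm_ring_1 pol3 \<Rightarrow> 'k pol3) \<Rightarrow> bool" where
  "derivation D \<longleftrightarrow>
     (\<forall>F G. D (F + G) = D F + D G) \<and>
     (\<forall>c F. D (const3 c * F) = const3 c * D F) \<and>
     (\<forall>F G. D (F * G) = F * D G + G * D F)"

definition poisson_bracket :: "('k::comm_ring_1 pol3 \<Rightarrow> 'k pol3 \<Rightarrow> 'k pol3) \<Rightarrow> bool" where
  "poisson_bracket br \<longleftrightarrow>
     (\<forall>F. derivation (br F)) \<and> (\<forall>F. derivation (\<lambda>G. br G F)) \<and>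
     (\<forall>F. br F F = 0) \<and> (\<forall>F G. br G F = - br F G) \<and>
     (\<forall>F G H. br F (br G H) + br G (br H F) + br H (br F G) = 0)"

definition unimodular_poisson ::
  "'k::idom pol3 \<Rightarrow> ('k pol3 \<Rightarrow> 'k pol3 \<Rightarrow> 'k pol3) \<Rightarrow> bool" where
  "unimodular_poisson \<Omega> br \<longleftrightarrow>
     poisson_bracket br \<and>
     br var_x var_y = partial_z \<Omega> \<and>
     br var_y var_z = partial_x \<Omega> \<and>
     br var_z var_x = partial_y \<Omega>"

text \<open>Every \<open>\<Omega>\<close> admits such a bracket, given by the Jacobian determinant of \<open>\<Omega>, F, G\<close>.\<close>

lemma map_poly_add_mult:
  fixes D :: "'a::comm_ring_1 \<Rightarrow> 'a"
  assumes add: "\<And>a b. D (a + b) = D a + D b"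
    and mult: "\<And>a b. D (a * b) = a * D b + b * D a"
  shows "map_poly D (p + q) = map_poly D p + map_poly D q"
    and "map_poly D (p * q) = p * map_poly D q + q * map_poly D p"
proof -
  have D0: "D 0 = 0" using add[of 0 0] by (metis add_cancel_right_right)
  have Dsum: "D (sum f A) = (\<Sum>i\<in>A. D (f i))" for f :: "nat \<Rightarrow> 'a" and A
    by (induction A rule: infinite_finite_induct) (simp_all add: D0 add)
  show "map_poly D (p + q) = map_poly D p + map_poly D q"
    by (rule poly_eqI) (simp add: coeff_map_poly D0 add)
  show "map_poly D (p * q) = p * map_poly D q + q * map_poly D p"
  proof (rule poly_eqI)
    fix n
    have "(\<Sum>i\<le>n. coeff q (n - i) * D (coeff p i)) = (\<Sum>i\<le>n. coeff q i * D (coeff p (n - i)))"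
      by (rule sum.reindex_bij_witness[of _ "\<lambda>i. n - i" "\<lambda>i. n - i"]) auto
    then show "coeff (map_poly D (p * q)) n = coeff (p * map_poly D q + q * map_poly D p) n"
      by (simp add: coeff_map_poly D0 coeff_mult Dsum mult sum.distrib)
  qed
qed

lemma pderiv_map_poly_commute:
  fixes D :: "'a::idom \<Rightarrow> 'a"
  assumes add: "\<And>a b. D (a + b) = D a + D b"
  shows "pderiv (map_poly D p) = map_poly D (pderiv p)"
proof -
  have D0: "D 0 = 0" using add[of 0 0] by (metis add_cancel_right_right)
  have Dn: "D (of_nat n * a) = of_nat n * D a" for n a
    by (induction n) (simp_all add: D0 add algebra_simps)
  show ?thesis
    by (rule poly_eqI) (simp add: coeff_pderiv coeff_map_poly D0 Dn flip: of_nat_Suc del: of_nat_Suc)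
qed

lemma map_poly_commute:
  fixes D E :: "'a::comm_ring_1 \<Rightarrow> 'a"
  assumes "D 0 = 0" "E 0 = 0" "\<And>a. D (E a) = E (D a)"
  shows "map_poly D (map_poly E p) = map_poly E (map_poly D p)"
  by (rule poly_eqI) (simp add: coeff_map_poly assms)

lemma pderiv_Leibniz: "pderiv (p * q) = p * pderiv q + q * pderiv p"
  for p q :: "'a::idom poly"
  by (simp add: pderiv_mult)

lemmas partial_defs = partial_x_def partial_y_def partial_z_def

lemma partial_add:
  fixes F G :: "'k::idom pol3"
  shows "partial_x (F + G) = partial_x F + partial_x G"
    and "partial_y (F + G) = partial_y F + partial_y G"
    and "partial_z (F + G) = partial_z F + partial_z G"
  unfolding partial_defs
  by (intro map_poly_add_mult pderiv_add pderiv_Leibniz)+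

lemma partial_mult:
  fixes F G :: "'k::idom pol3"
  shows "partial_x (F * G) = F * partial_x G + G * partial_x F"
    and "partial_y (F * G) = F * partial_y G + G * partial_y F"
    and "partial_z (F * G) = F * partial_z G + G * partial_z F"
  unfolding partial_defs
  by (intro map_poly_add_mult pderiv_add pderiv_Leibniz)+

lemma partial_const:
  fixes c :: "'k::idom"
  shows "partial_x (const3 c) = 0" "partial_y (const3 c) = 0" "partial_z (const3 c) = 0"
  unfolding partial_defs const3_def
  by (simp_all add: map_poly_pCons pderiv_pCons)

lemma partial_commute:
  fixes F :: "'k::idom pol3"
  shows "partial_y (partial_x F) = partial_x (partial_y F)"
    and "partial_z (partial_x F) = partial_x (partial_z F)"
    and "partial_z (partial_y F) = partial_y (partial_z F)"
  unfolding partial_defs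
  by (intro map_poly_commute pderiv_map_poly_commute map_poly_add_mult pderiv_add pderiv_Leibniz
        map_poly_0 pderiv_0)+

lemma partial_minus:
  fixes F G :: "'k::idom pol3"
  shows "partial_x (F - G) = partial_x F - partial_x G"
    and "partial_y (F - G) = partial_y F - partial_y G"
    and "partial_z (F - G) = partial_z F - partial_z G"
  using partial_add[of "F - G" G] by (simp_all add: algebra_simps)

lemma partial_var:
  "partial_x var_x = (1 :: 'k::idom pol3)" "partial_y var_x = (0 :: 'k pol3)" "partial_z var_x = (0 :: 'k pol3)"
  "partial_x var_y = (0 :: 'k pol3)" "partial_y var_y = (1 :: 'k pol3)" "partial_z var_y = (0 :: 'k pol3)"
  "partial_x var_z = (0 :: 'k pol3)" "partial_y var_z = (0 :: 'k pol3)" "partial_z var_z = (1 :: 'k pol3)"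
  unfolding partial_defs var_x_def var_y_def var_z_def
  by (simp_all add: map_poly_pCons pderiv_pCons one_pCons)

definition jacobian_bracket :: "'k::idom pol3 \<Rightarrow> 'k pol3 \<Rightarrow> 'k pol3 \<Rightarrow> 'k pol3" where
  "jacobian_bracket \<Omega> F G =
     partial_x \<Omega> * (partial_y F * partial_z G - partial_z F * partial_y G) +
     partial_y \<Omega> * (partial_z F * partial_x G - partial_x F * partial_z G) +
     partial_z \<Omega> * (partial_x F * partial_y G - partial_y F * partial_x G)"

lemma jacobian_bracket_skew: "jacobian_bracket \<Omega> G F = - jacobian_bracket \<Omega> F G"
  by (simp add: jacobian_bracket_def algebra_simps)

lemma derivation_jacobian_bracket: "derivation (jacobian_bracket \<Omega> F)"
  unfolding derivation_def jacobian_bracket_def partial_add partial_mult partial_const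
  by (simp add: algebra_simps)

lemma derivation_uminus:
  assumes "derivation D"
  shows "derivation (\<lambda>F. - D F)"
  using assms unfolding derivation_def
  by (intro conjI allI; metis minus_add_distrib mult_minus_right)

lemma unimodular_poisson_jacobian_bracket: "unimodular_poisson \<Omega> (jacobian_bracket \<Omega>)"
proof -
  have jacobi: "jacobian_bracket \<Omega> F (jacobian_bracket \<Omega> G H) + jacobian_bracket \<Omega> G (jacobian_bracket \<Omega> H F)
      + jacobian_bracket \<Omega> H (jacobian_bracket \<Omega> F G) = 0" for F G H
    unfolding jacobian_bracket_def partial_add partial_mult partial_minus partial_commute
    by (simp add: algebra_simps)
  have "derivation (\<lambda>G. jacobian_bracket \<Omega> G F)" for F
    unfolding jacobian_bracket_skew[of \<Omega> _ F]
    by (rule derivation_uminus[OF derivation_jacobian_bracket])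
  moreover have "jacobian_bracket \<Omega> F F = 0" for F
    by (simp add: jacobian_bracket_def algebra_simps)
  ultimately have "poisson_bracket (jacobian_bracket \<Omega>)"
    unfolding poisson_bracket_def
    using jacobi jacobian_bracket_skew derivation_jacobian_bracket by blast
  then show ?thesis
    unfolding unimodular_poisson_def by (simp add: jacobian_bracket_def partial_var)
qed


section \<open>Poisson cohomology\<close>

text \<open>
  A function of \<open>q\<close> polynomials is a function on lists. It is required to vanish on
  lists of the wrong length, so that it is determined by its values on \<open>q\<close>-tuples; for \<open>q = 0\<close>
  it amounts to the polynomial \<open>Q []\<close>.
\<close>

definition multiderivations :: "nat \<Rightarrow> ('k::comm_ring_1 pol3 list \<Rightarrow> 'k pol3) set" where
  "multiderivations q = {Q.
     (\<forall>Fs. length Fs \<noteq> q \<longrightarrow> Q Fs = 0) \<and>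
     (\<forall>Fs i. length Fs = q \<and> i < q \<longrightarrow> derivation (\<lambda>F. Q (Fs[i := F]))) \<and>
     (\<forall>Fs i j. length Fs = q \<and> i < j \<and> j < q \<longrightarrow> Q (Fs[i := Fs ! j, j := Fs ! i]) = - Q Fs)}"

definition has_degree :: "nat \<Rightarrow> int \<Rightarrow> ('k::zero pol3 list \<Rightarrow> 'k pol3) \<Rightarrow> bool" where
  "has_degree q d Q \<longleftrightarrow>
     (\<forall>ns Fs. length Fs = q \<and> list_all2 homogeneous ns Fs \<longrightarrow> homogeneous (sum_list ns + d) (Q Fs))"

text \<open>Here \<open>nths Fs (- {i, j})\<close> is the list \<open>Fs\<close> with the entries at positions \<open>i, j\<close> left out.\<close>

definition poisson_diff ::
  "('k::comm_ring_1 pol3 \<Rightarrow> 'k pol3 \<Rightarrow> 'k pol3) \<Rightarrow> nat \<Rightarrow>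
   ('k pol3 list \<Rightarrow> 'k pol3) \<Rightarrow> 'k pol3 list \<Rightarrow> 'k pol3" where
  "poisson_diff br q Q Fs =
     (if length Fs = q + 1 then
        (\<Sum>i\<le>q. (-1) ^ i * br (Fs ! i) (Q (nths Fs (- {i})))) +
        (\<Sum>j\<le>q. \<Sum>i<j. (-1) ^ (i + j) * Q (br (Fs ! i) (Fs ! j) # nths Fs (- {i, j})))
      else 0)"

definition cocycles ::
  "('k::comm_ring_1 pol3 \<Rightarrow> 'k pol3 \<Rightarrow> 'k pol3) \<Rightarrow> nat \<Rightarrow> ('k pol3 list \<Rightarrow> 'k pol3) set" where
  "cocycles br q = {Q \<in> multiderivations q. poisson_diff br q Q = (\<lambda>_. 0)}"

definition coboundaries ::
  "('k::comm_ring_1 pol3 \<Rightarrow> 'k pol3 \<Rightarrow> 'k pol3) \<Rightarrow> nat \<Rightarrow> ('k pol3 list \<Rightarrow> 'k pol3) set" where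
  "coboundaries br q =
     (case q of 0 \<Rightarrow> {\<lambda>_. 0} | Suc p \<Rightarrow> poisson_diff br p ` multiderivations p)"

definition cocycle_module ::
  "('k::comm_ring_1 pol3 \<Rightarrow> 'k pol3 \<Rightarrow> 'k pol3) \<Rightarrow> nat \<Rightarrow> ('k, 'k pol3 list \<Rightarrow> 'k pol3) module" where
  "cocycle_module br q =
     \<lparr>carrier = cocycles br q, monoid.mult = undefined, one = undefined,
      zero = (\<lambda>_. 0), add = (\<lambda>P Q Fs. P Fs + Q Fs),
      module.smult = (\<lambda>c Q Fs. const3 c * Q Fs)\<rparr>"

definition quotient_module :: "('a, 'v) module \<Rightarrow> 'v set \<Rightarrow> ('a, 'v set) module" where
  "quotient_module M N =
     \<lparr>carrier = a_rcosets\<^bsub>M\<^esub> N, monoid.mult = undefined, one = undefined,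
      zero = N, add = (<+>\<^bsub>M\<^esub>),
      module.smult = (\<lambda>c X. \<Union>v\<in>X. N +>\<^bsub>M\<^esub> (c \<odot>\<^bsub>M\<^esub> v))\<rparr>"

definition PH ::
  "('k::comm_ring_1 pol3 \<Rightarrow> 'k pol3 \<Rightarrow> 'k pol3) \<Rightarrow> nat \<Rightarrow>
   ('k, ('k pol3 list \<Rightarrow> 'k pol3) set) module" where
  "PH br q = quotient_module (cocycle_module br q) (coboundaries br q)"

text \<open>The homogeneous component of degree \<open>d\<close>: the classes of the cocycles of degree \<open>d\<close>.\<close>

definition PH_component ::
  "('k::comm_ring_1 pol3 \<Rightarrow> 'k pol3 \<Rightarrow> 'k pol3) \<Rightarrow> nat \<Rightarrow> int \<Rightarrow>
   ('k, ('k pol3 list \<Rightarrow> 'k pol3) set) module" where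
  "PH_component br q d =
     (PH br q)\<lparr>carrier :=
        {coboundaries br q +>\<^bsub>cocycle_module br q\<^esub> Q |Q. Q \<in> cocycles br q \<and> has_degree q d Q}\<rparr>"


section \<open>Hilbert series\<close>

text \<open>
  The family \<open>M\<close> of the homogeneous components of a graded vector space has the Hilbert series \<open>h\<close>.
  Finite dimensionality is part of the definition.
\<close>

definition has_hilbert_series :: "(int \<Rightarrow> ('k::field, 'v) module) \<Rightarrow> rat fls \<Rightarrow> bool" where
  "has_hilbert_series M h \<longleftrightarrow>
     (\<forall>d. vectorspace class_ring (M d) \<and> vectorspace.fin_dim class_ring (M d) \<and>
          fls_nth h d = of_nat (vectorspace.dim class_ring (M d)))"

end

theory Submission
  imports Defs "HOL-Library.Product_Plus"
begin

text \<open>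
Let \<open>f = \<nabla>\<Omega>\<close>. Skew-symmetric multiderivations of \<open>k[x,y,z]\<close> are given by polynomials and polynomial
vector fields, and the Poisson complex becomes
\<open>F \<mapsto> \<nabla>F \<times> f\<close>, \<open>V \<mapsto> (div V) f - \<nabla>(V \<cdot> f)\<close>, \<open>W \<mapsto> - f \<cdot> curl W\<close>. By rank-nullity in every degree,
all dimensions follow from two facts: the polynomials \<open>F\<close> with \<open>\<nabla>F \<times> f = 0\<close> are those in \<open>k[\<Omega>]\<close>, and
every divergence-free \<open>V\<close> with \<open>V \<cdot> f = 0\<close> is Hamiltonian, \<open>V = \<nabla>F \<times> f\<close>. By the Poincare lemma and
induction on the degree it is enough for the latter to write \<open>V = W \<times> f\<close>.

If the cubic is smooth, powers of the variables lie in the ideal generated by \<open>f\<close>; hence the Koszul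
complex of \<open>f\<close> is exact and \<open>V \<cdot> f = 0\<close> suffices. An irreducible singular cubic is nodal or cuspidal
after a linear change of coordinates. There the solutions of \<open>V \<cdot> f = 0\<close> are generated by the
\<open>W \<times> f\<close> and one further explicit field \<open>T\<close>, and \<open>div (c T)\<close>, restricted to the singular line, is the
value at \<open>c\<close> of an operator that is injective in characteristic zero.
\<close>

text \<open>The obstacle is that the gradient f of a singular cubic is no regular sequence, so V
  \<cdot> f = 0 alone does not make V a cross product with f. The fields for which this is required
  below are divergence-free, which is why \<open>tame\<close> couples the two conditions. Origin of
  the series: in each degree, divergence-free fields are curls, so the last differential has the
  image of V -> - V \<cdot> f on divergence-free fields, with the Hamiltonian fields as kernel; this
  fixes PH^3. Modulo Hamiltonian fields a 1-cocycle V is determined by V \<cdot> f in \<Omega>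
  k[\<Omega>], and Casimir multiples of the Euler field attain all these values; this fixes PH^1.
  The Euler characteristic gives PH^2: the complex has the alternating series (1 - 1/t)^3 / (1 -
  t)^3 = - 1/t^3, the source of the -1 in the series of PH^2. The numerator (1 + t)^3 = (1 - t^2)^3
  / (1 - t)^3 is the Hilbert series of k[x,y,z] modulo a regular sequence of three quadrics; in the
  singular cases it comes out of the same count.\<close>

definition c3 :: "'k::zero pol3 \<Rightarrow> nat \<Rightarrow> nat \<Rightarrow> nat \<Rightarrow> 'k" where
  "c3 F a b c = coeff (coeff (coeff F c) b) a"

lemma pol3_eqI: "(\<And>a b c. c3 F a b c = c3 G a b c) \<Longrightarrow> F = G"
  unfolding c3_def by (intro poly_eqI) auto

lemma homogeneous_c3: "homogeneous n F \<longleftrightarrow> (\<forall>a b c. c3 F a b c \<noteq> 0 \<longrightarrow> int (a + b + c) = n)"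
  by (simp add: homogeneous_def c3_def)

lemma c3_simps [simp]:
  "c3 (0 :: 'k::comm_ring_1 pol3) a b c = 0"
  "c3 (F + G :: 'k pol3) a b c = c3 F a b c + c3 G a b c"
  "c3 (F - G :: 'k pol3) a b c = c3 F a b c - c3 G a b c"
  "c3 (- F :: 'k pol3) a b c = - c3 F a b c"
  "c3 (const3 k * F :: 'k pol3) a b c = k * c3 F a b c"
  by (simp_all add: c3_def const3_def)

lemma c3_const3: "c3 (const3 k) a b c = (if a = 0 \<and> b = 0 \<and> c = 0 then k else 0)"
  by (simp add: c3_def const3_def coeff_pCons split: nat.splits)

lemma c3_var_mult:
  fixes F :: "'k::comm_ring_1 pol3"
  shows "c3 (var_x * F) a b c = (case a of 0 \<Rightarrow> 0 | Suc i \<Rightarrow> c3 F i b c)"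
    and "c3 (var_y * F) a b c = (case b of 0 \<Rightarrow> 0 | Suc i \<Rightarrow> c3 F a i c)"
    and "c3 (var_z * F) a b c = (case c of 0 \<Rightarrow> 0 | Suc i \<Rightarrow> c3 F a b i)"
  by (simp_all add: c3_def var_x_def var_y_def var_z_def coeff_pCons split: nat.splits)

lemma c3_partial:
  fixes F :: "'k::idom pol3"
  shows "c3 (partial_x F) a b c = of_nat (Suc a) * c3 F (Suc a) b c"
    and "c3 (partial_y F) a b c = of_nat (Suc b) * c3 F a (Suc b) c"
    and "c3 (partial_z F) a b c = of_nat (Suc c) * c3 F a b (Suc c)"
proof -
  have 1: "coeff (of_nat n * p) i = of_nat n * coeff p i" for n i and p :: "'a::comm_ring_1 poly"
    by (simp add: of_nat_poly)
  show "c3 (partial_x F) a b c = of_nat (Suc a) * c3 F (Suc a) b c"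
    "c3 (partial_y F) a b c = of_nat (Suc b) * c3 F a (Suc b) c"
    "c3 (partial_z F) a b c = of_nat (Suc c) * c3 F a b (Suc c)"
    by (simp_all only: c3_def partial_defs coeff_map_poly map_poly_0 pderiv_0 coeff_pderiv 1)
qed

section \<open>Constants, generators and substitution homomorphisms\<close>

lemma const3_simps [simp]:
  "const3 0 = 0" "const3 (1 :: 'k::comm_ring_1) = 1"
  "const3 (- k) = - const3 (k :: 'k)"
  by (simp_all add: const3_def one_pCons)

lemma const3_hom:
  "const3 (k + l) = const3 k + const3 (l :: 'k::comm_ring_1)"
  "const3 (k - l) = const3 k - const3 (l :: 'k)"
  "const3 (k * l) = const3 k * const3 (l :: 'k)"
  by (simp_all add: const3_def)

lemma const3_power: "const3 (k ^ n) = const3 (k :: 'k::comm_ring_1) ^ n"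
  by (induction n) (simp_all add: const3_hom)

lemma const3_eq_iff [simp]: "const3 k = const3 l \<longleftrightarrow> k = l"
  by (simp add: const3_def)

lemma const3_eq_0_iff [simp]: "const3 k = 0 \<longleftrightarrow> k = 0"
  by (simp add: const3_def)

lemma const3_of_nat: "const3 (of_nat n) = (of_nat n :: 'k::comm_ring_1 pol3)"
  by (induction n) (simp_all add: const3_hom)

lemma const3_numeral: "const3 (numeral n) = (numeral n :: 'k::comm_ring_1 pol3)"
  using const3_of_nat[of "numeral n"] by simp

text \<open>Horner's scheme in each of the three nested rings shows that constants and variables
  generate the algebra. Identities can thereby be checked on generators, without nested
  coefficients.\<close>

lemma pol3_induct [case_names const x y z add mult]:
  fixes F :: "'k::comm_ring_1 pol3"
  assumes const: "\<And>k. P (const3 k)" and x: "P var_x" and y: "P var_y" and z: "P var_z"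
    and add: "\<And>F G. P F \<Longrightarrow> P G \<Longrightarrow> P (F + G)"
    and mult: "\<And>F G. P F \<Longrightarrow> P G \<Longrightarrow> P (F * G)"
  shows "P F"
proof -
  have P0: "P 0" using const[of 0] by simp
  have 1: "P [:[:p:]:]" for p
  proof (induction p)
    case 0
    show ?case by (simp add: P0)
  next
    case (pCons a p)
    have "[:[:pCons a p:]:] = const3 a + var_x * [:[:p:]:]"
      by (simp add: const3_def var_x_def)
    then show ?case using add[OF const[of a] mult[OF x pCons.IH]] by simp
  qed
  have 2: "P [:p:]" for p
  proof (induction p)
    case 0
    show ?case by (simp add: P0)
  next
    case (pCons a p)
    have "[:pCons a p:] = [:[:a:]:] + var_y * [:p:]"
      by (simp add: var_y_def)
    then show ?case using add[OF 1[of a] mult[OF y pCons.IH]] by simp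
  qed
  show ?thesis
  proof (induction F)
    case 0
    show ?case by (simp add: P0)
  next
    case (pCons a p)
    have "pCons a p = [:a:] + var_z * p"
      by (simp add: var_z_def)
    then show ?case using add[OF 2[of a] mult[OF z pCons.IH]] by simp
  qed
qed

lemma partial_simps [simp]:
  fixes F G :: "'k::idom pol3"
  shows "partial_x (const3 k) = (0 :: 'k pol3)" "partial_y (const3 k) = (0 :: 'k pol3)"
    "partial_z (const3 k) = (0 :: 'k pol3)"
    "partial_x (0 :: 'k pol3) = 0" "partial_y (0 :: 'k pol3) = 0" "partial_z (0 :: 'k pol3) = 0"
    "partial_x (1 :: 'k pol3) = 0" "partial_y (1 :: 'k pol3) = 0" "partial_z (1 :: 'k pol3) = 0"
    "partial_x (numeral n :: 'k pol3) = 0" "partial_y (numeral n :: 'k pol3) = 0"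
    "partial_z (numeral n :: 'k pol3) = 0"
    "partial_x (- F) = - partial_x F" "partial_y (- F) = - partial_y F" "partial_z (- F) = - partial_z F"
  using partial_const[of "0::'k"] partial_const[of "1::'k"] partial_const[of "numeral n::'k"]
    partial_minus[of 0 F]
  by (simp_all add: partial_const const3_numeral)

declare partial_add [simp] partial_minus [simp] partial_var [simp]

lemma partial_power:
  fixes F :: "'k::idom pol3"
  shows "partial_x (F ^ n) = of_nat n * F ^ (n - 1) * partial_x F"
    and "partial_y (F ^ n) = of_nat n * F ^ (n - 1) * partial_y F"
    and "partial_z (F ^ n) = of_nat n * F ^ (n - 1) * partial_z F"
proof -
  have *: "D (F ^ n) = of_nat n * F ^ (n - 1) * D F"
    if D: "\<And>F G. D (F * G) = F * D G + G * D F" "D 1 = 0" for D :: "'k pol3 \<Rightarrow> 'k pol3"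
  proof (induction n)
    case (Suc n)
    then show ?case by (cases n) (simp_all add: D algebra_simps)
  qed (simp add: D)
  show "partial_x (F ^ n) = of_nat n * F ^ (n - 1) * partial_x F"
    "partial_y (F ^ n) = of_nat n * F ^ (n - 1) * partial_y F"
    "partial_z (F ^ n) = of_nat n * F ^ (n - 1) * partial_z F"
    by (rule *; simp add: partial_mult)+
qed

text \<open>Universal property of a one-variable polynomial ring. The first four conclusions have
  the form of the hypotheses, so that the lemma applies to its own result, once for each nested
  variable.\<close>

lemma map_poly_eval_hom:
  fixes h :: "'a::comm_ring_1 \<Rightarrow> 'b::comm_ring_1" and a :: 'b
  assumes h: "h 0 = 0" "h 1 = 1" "\<And>u v. h (u + v) = h u + h v" "\<And>u v. h (u * v) = h u * h v"
  defines "e \<equiv> \<lambda>p. poly (map_poly h p) a"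
  shows "e 0 = 0" "e 1 = 1" "e (p + q) = e p + e q" "e (p * q) = e p * e q"
    "e [:c:] = h c" "e [:0, 1:] = a"
proof -
  have pC: "e (pCons c p) = h c + a * e p" for c p
    by (simp add: e_def map_poly_pCons h)
  show e0: "e 0 = 0" and "e 1 = 1" and "e [:c:] = h c" and "e [:0, 1:] = a"
    by (simp_all add: e_def h map_poly_pCons one_pCons)
  have add: "e (p + q) = e p + e q" for p q
  proof -
    have "map_poly h (p + q) = map_poly h p + map_poly h q"
      by (rule poly_eqI) (simp add: coeff_map_poly h)
    then show ?thesis by (simp add: e_def)
  qed
  then show "e (p + q) = e p + e q" .
  have sm: "e (Polynomial.smult c q) = h c * e q" for c q
  proof -
    have "map_poly h (Polynomial.smult c q) = Polynomial.smult (h c) (map_poly h q)"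
      by (rule poly_eqI) (simp add: coeff_map_poly h)
    then show ?thesis by (simp add: e_def)
  qed
  show "e (p * q) = e p * e q"
    by (induction p) (simp_all add: e0 pC add sm h algebra_simps)
qed

text \<open>The value F(a, b, c); the innermost variable x goes to a, the outermost z to c. It
  serves for evaluation at points, restriction to coordinate planes and lines, and changes of
  coordinates.\<close>

definition subst3 :: "'k::comm_ring_1 pol3 \<Rightarrow> 'k pol3 \<Rightarrow> 'k pol3 \<Rightarrow> 'k pol3 \<Rightarrow> 'k pol3" where
  "subst3 a b c F =
     poly (map_poly (\<lambda>r. poly (map_poly (\<lambda>p. poly (map_poly const3 p) a) r) b) F) c"

definition alg_hom :: "('k::comm_ring_1 pol3 \<Rightarrow> 'k pol3) \<Rightarrow> bool" where
  "alg_hom h \<longleftrightarrow> (\<forall>F G. h (F + G) = h F + h G) \<and> (\<forall>F G. h (F * G) = h F * h G) \<and>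
     (\<forall>k. h (const3 k) = const3 k)"

lemma
  fixes a b c :: "'k::comm_ring_1 pol3"
  shows alg_hom_subst3: "alg_hom (subst3 a b c)"
    and subst3_var [simp]: "subst3 a b c var_x = a" "subst3 a b c var_y = b" "subst3 a b c var_z = c"
proof -
  note h0 = map_poly_eval_hom[where h = "const3 :: 'k \<Rightarrow> _" and a = a, OF const3_simps(1,2) const3_hom(1,3)]
  note h1 = map_poly_eval_hom[where h = "\<lambda>p. poly (map_poly const3 p) a" and a = b, OF h0(1-4)]
  note h2 = map_poly_eval_hom[where h = "\<lambda>r. poly (map_poly (\<lambda>p. poly (map_poly const3 p) a) r) b" and a = c, OF h1(1-4)]
  have k: "subst3 a b c (const3 k) = const3 k" for k
    unfolding const3_def subst3_def h2 h1 h0 ..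
  show "alg_hom (subst3 a b c)"
    using h2(3,4) k unfolding alg_hom_def subst3_def by blast
  show "subst3 a b c var_x = a"
    unfolding var_x_def subst3_def h2 h1 h0 ..
  show "subst3 a b c var_y = b"
    unfolding var_y_def subst3_def h2 h1 h0 ..
  show "subst3 a b c var_z = c"
    unfolding var_z_def subst3_def h2 h1 h0 ..
qed

lemma alg_hom_simps:
  fixes h :: "'k::comm_ring_1 pol3 \<Rightarrow> 'k pol3"
  assumes "alg_hom h"
  shows "h (F + G) = h F + h G" "h (F * G) = h F * h G" "h (const3 k) = const3 k"
    "h 0 = 0" "h 1 = 1" "h (- F) = - h F" "h (F - G) = h F - h G" "h (F ^ n) = h F ^ n"
    "h (numeral m) = numeral m"
proof -
  show *: "h (F + G) = h F + h G" "h (F * G) = h F * h G" "h (const3 k) = const3 k" for F G k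
    using assms by (auto simp: alg_hom_def)
  show 0: "h 0 = 0" and 1: "h 1 = 1" using *(3)[of 0] *(3)[of 1] by simp_all
  show m: "h (- F) = - h F" for F using *(1)[of F "- F"] by (simp add: 0 eq_neg_iff_add_eq_0 add.commute)
  show "h (F - G) = h F - h G" using *(1)[of F "- G"] by (simp add: m)
  show "h (F ^ n) = h F ^ n" by (induction n) (simp_all add: 1 *)
  show "h (numeral m) = numeral m" using *(3)[of "numeral m"] by (simp add: const3_numeral)
qed

lemmas subst3_simps [simp] = alg_hom_simps[OF alg_hom_subst3]

lemma alg_hom_ext:
  fixes h g :: "'k::comm_ring_1 pol3 \<Rightarrow> 'k pol3"
  assumes "alg_hom h" "alg_hom g" "h var_x = g var_x" "h var_y = g var_y" "h var_z = g var_z"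
  shows "h F = g F"
  using assms by (induction F rule: pol3_induct) (simp_all add: alg_hom_simps)

lemma alg_hom_id: "alg_hom (\<lambda>F. F)"
  by (simp add: alg_hom_def)

lemma alg_hom_comp: "alg_hom h \<Longrightarrow> alg_hom g \<Longrightarrow> alg_hom (\<lambda>F. h (g F))"
  by (simp add: alg_hom_def)

lemma subst3_subst3:
  "subst3 a b c (subst3 a' b' c' F) = subst3 (subst3 a b c a') (subst3 a b c b') (subst3 a b c c') F"
  by (rule alg_hom_ext[OF alg_hom_comp]) (simp_all add: alg_hom_subst3)

lemma subst3_id [simp]: "subst3 var_x var_y var_z F = F"
  by (rule alg_hom_ext[of _ "\<lambda>F. F"]) (simp_all add: alg_hom_subst3 alg_hom_id)

lemma chain_rule:
  fixes F :: "'k::idom pol3"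
  shows "partial_x (subst3 a b c F) = subst3 a b c (partial_x F) * partial_x a +
           subst3 a b c (partial_y F) * partial_x b + subst3 a b c (partial_z F) * partial_x c"
    and "partial_y (subst3 a b c F) = subst3 a b c (partial_x F) * partial_y a +
           subst3 a b c (partial_y F) * partial_y b + subst3 a b c (partial_z F) * partial_y c"
    and "partial_z (subst3 a b c F) = subst3 a b c (partial_x F) * partial_z a +
           subst3 a b c (partial_y F) * partial_z b + subst3 a b c (partial_z F) * partial_z c"
  by (induction F rule: pol3_induct) (simp_all add: partial_mult algebra_simps)

text \<open>Each of these substitutions h fixes the generators modulo the variable that it kills,
  and the F with F - h F divisible by that variable are closed under sums and products.\<close>

lemma subst3_decomp:
  fixes F :: "'k::comm_ring_1 pol3"
  shows "\<exists>G. F = subst3 0 var_y var_z F + var_x * G"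
    and "\<exists>G. F = subst3 var_x 0 var_z F + var_y * G"
    and "\<exists>G. F = subst3 var_x var_y 0 F + var_z * G"
proof -
  have *: "\<exists>G. F = h F + v * G"
    if "alg_hom h" "\<exists>G. var_x = h var_x + v * G" "\<exists>G. var_y = h var_y + v * G" "\<exists>G. var_z = h var_z + v * G"
    for h v
  proof (induction F rule: pol3_induct)
    case (const k)
    then show ?case by (intro exI[of _ 0]) (simp add: alg_hom_simps[OF that(1)])
  next
    case (add F G)
    then obtain F' G' where F: "F - h F = v * F'" and G: "G - h G = v * G'"
      by (metis add_diff_cancel_left')
    have "F + G - h (F + G) = (F - h F) + (G - h G)"
      unfolding alg_hom_simps[OF that(1)] by simp
    also have "\<dots> = v * (F' + G')" unfolding F G by (simp add: algebra_simps)
    finally have "F + G = h (F + G) + v * (F' + G')" by (simp add: algebra_simps)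
    then show ?case by blast
  next
    case (mult F G)
    then obtain F' G' where F: "F - h F = v * F'" and G: "G - h G = v * G'"
      by (metis add_diff_cancel_left')
    have "F * G - h (F * G) = (F - h F) * G + h F * (G - h G)"
      unfolding alg_hom_simps[OF that(1)] by (simp add: algebra_simps)
    also have "\<dots> = v * (F' * G + h F * G')" unfolding F G by (simp add: algebra_simps)
    finally have "F * G = h (F * G) + v * (F' * G + h F * G')" by (simp add: algebra_simps)
    then show ?case by blast
  qed (use that in simp_all)
  have 0: "\<exists>G. v = 0 + v * G" "\<exists>G. w = w + v * G" for v w :: "'k pol3"
    by (auto intro: exI[of _ 1] exI[of _ 0])
  show "\<exists>G. F = subst3 0 var_y var_z F + var_x * G"
    by (rule *[OF alg_hom_subst3]) (simp_all only: subst3_var 0)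
  show "\<exists>G. F = subst3 var_x 0 var_z F + var_y * G"
    by (rule *[OF alg_hom_subst3]) (simp_all only: subst3_var 0)
  show "\<exists>G. F = subst3 var_x var_y 0 F + var_z * G"
    by (rule *[OF alg_hom_subst3]) (simp_all only: subst3_var 0)
qed

text \<open>Divisibility by a variable becomes vanishing on a coordinate plane. Since substitution
  is multiplicative, over a domain this also makes the variables prime.\<close>

lemma var_dvd_iff:
  fixes F :: "'k::comm_ring_1 pol3"
  shows "var_x dvd F \<longleftrightarrow> subst3 0 var_y var_z F = 0"
    and "var_y dvd F \<longleftrightarrow> subst3 var_x 0 var_z F = 0"
    and "var_z dvd F \<longleftrightarrow> subst3 var_x var_y 0 F = 0"
proof -
  have *: "v dvd F \<longleftrightarrow> h F = 0" if "alg_hom h" "h v = 0" "\<exists>G. F = h F + v * G" for h and v :: "'k pol3"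
  proof
    assume "v dvd F"
    then show "h F = 0" by (auto simp: alg_hom_simps[OF that(1)] that(2))
  next
    assume "h F = 0"
    then show "v dvd F" using that(3) by (metis add_0 dvd_triv_left)
  qed
  show "var_x dvd F \<longleftrightarrow> subst3 0 var_y var_z F = 0"
    "var_y dvd F \<longleftrightarrow> subst3 var_x 0 var_z F = 0"
    "var_z dvd F \<longleftrightarrow> subst3 var_x var_y 0 F = 0"
    by (rule *[OF alg_hom_subst3]; simp add: subst3_decomp)+
qed

lemma var_neq_0 [simp]:
  "(var_x :: 'k::comm_ring_1 pol3) \<noteq> 0" "(var_y :: 'k pol3) \<noteq> 0" "(var_z :: 'k pol3) \<noteq> 0"
  by (simp_all add: var_x_def var_y_def var_z_def)

section \<open>Homogeneous components\<close>

definition imap_poly :: "(nat \<Rightarrow> 'a::zero \<Rightarrow> 'a) \<Rightarrow> 'a poly \<Rightarrow> 'a poly" where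
  "imap_poly g p = Abs_poly (\<lambda>n. if coeff p n = 0 then 0 else g n (coeff p n))"

text \<open>Zero coefficients are kept zero by definition, so the degree of p bounds the support
  whatever g is, and \<open>Abs_poly\<close> receives a genuine coefficient sequence.\<close>

lemma coeff_imap_poly:
  "coeff (imap_poly g p) n = (if coeff p n = 0 then 0 else g n (coeff p n))"
  unfolding imap_poly_def by (subst coeff_Abs_poly[of "degree p"]) (simp_all add: coeff_eq_0)

definition hom_comp :: "int \<Rightarrow> 'k::zero pol3 \<Rightarrow> 'k pol3" where
  "hom_comp n = imap_poly (\<lambda>c. imap_poly (\<lambda>b. imap_poly (\<lambda>a k. if int (a + b + c) = n then k else 0)))"

lemma c3_hom_comp [simp]: "c3 (hom_comp n F) a b c = (if int (a + b + c) = n then c3 F a b c else 0)"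
  by (simp add: c3_def hom_comp_def coeff_imap_poly)

lemma homogeneous_hom_comp [simp]: "homogeneous n (hom_comp n F)"
  by (simp add: homogeneous_c3)

lemma hom_comp_add: "hom_comp n (F + G :: 'k::comm_ring_1 pol3) = hom_comp n F + hom_comp n G"
  by (rule pol3_eqI) simp

lemma hom_comp_diff: "hom_comp n (F - G :: 'k::comm_ring_1 pol3) = hom_comp n F - hom_comp n G"
  by (rule pol3_eqI) simp

lemma hom_comp_0 [simp]: "hom_comp n (0 :: 'k::comm_ring_1 pol3) = 0"
  by (rule pol3_eqI) simp

lemma hom_comp_uminus: "hom_comp n (- F :: 'k::comm_ring_1 pol3) = - hom_comp n F"
  by (rule pol3_eqI) simp

lemma hom_comp_homogeneous:
  "homogeneous m F \<Longrightarrow> hom_comp n F = (if n = m then F else (0 :: 'k::comm_ring_1 pol3))"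
  by (rule pol3_eqI) (auto simp: homogeneous_c3)

lemma hom_comp_partial:
  fixes F :: "'k::idom pol3"
  shows "hom_comp n (partial_x F) = partial_x (hom_comp (n + 1) F)"
    and "hom_comp n (partial_y F) = partial_y (hom_comp (n + 1) F)"
    and "hom_comp n (partial_z F) = partial_z (hom_comp (n + 1) F)"
  by (rule pol3_eqI; simp add: c3_partial algebra_simps)+

lemma c3_mult_nonzero:
  fixes F G :: "'k::comm_ring_1 pol3"
  assumes "c3 (F * G) a b c \<noteq> 0"
  obtains a' b' c' where "a' \<le> a" "b' \<le> b" "c' \<le> c" "c3 F a' b' c' \<noteq> 0"
    "c3 G (a - a') (b - b') (c - c') \<noteq> 0"
proof -
  have "c3 (F * G) a b c =
    (\<Sum>c'\<le>c. \<Sum>b'\<le>b. \<Sum>a'\<le>a. c3 F a' b' c' * c3 G (a - a') (b - b') (c - c'))"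
    by (simp add: c3_def coeff_mult coeff_sum)
  then obtain c' b' a' where "c' \<le> c" "b' \<le> b" "a' \<le> a" "c3 F a' b' c' * c3 G (a - a') (b - b') (c - c') \<noteq> 0"
    using assms by (metis (no_types, lifting) atMost_iff sum.neutral)
  then show ?thesis by (intro that[of a' b' c']) auto
qed

lemma homogeneous_add [intro]:
  "homogeneous n F \<Longrightarrow> homogeneous n G \<Longrightarrow> homogeneous n (F + G :: 'k::comm_ring_1 pol3)"
  unfolding homogeneous_c3 by (metis add.right_neutral c3_simps(2))

lemma homogeneous_uminus [intro]: "homogeneous n F \<Longrightarrow> homogeneous n (- F :: 'k::comm_ring_1 pol3)"
  unfolding homogeneous_c3 by simp

lemma homogeneous_diff [intro]:
  "homogeneous n F \<Longrightarrow> homogeneous n G \<Longrightarrow> homogeneous n (F - G :: 'k::comm_ring_1 pol3)"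
  using homogeneous_add[of n F "- G"] homogeneous_uminus[of n G] by simp

lemma homogeneous_mult':
  fixes F G :: "'k::comm_ring_1 pol3"
  assumes "homogeneous m F" "homogeneous n G"
  shows "homogeneous (m + n) (F * G)"
  unfolding homogeneous_c3
proof (intro allI impI)
  fix a b c assume "c3 (F * G) a b c \<noteq> 0"
  then obtain a' b' c' where *: "a' \<le> a" "b' \<le> b" "c' \<le> c" "c3 F a' b' c' \<noteq> 0"
    "c3 G (a - a') (b - b') (c - c') \<noteq> 0" by (rule c3_mult_nonzero)
  then have "int (a' + b' + c') = m" "int ((a - a') + (b - b') + (c - c')) = n"
    using assms unfolding homogeneous_c3 by blast+
  then show "int (a + b + c) = m + n" using * by linarith
qed

lemma homogeneous_mult:
  fixes F G :: "'k::comm_ring_1 pol3"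
  shows "homogeneous m F \<Longrightarrow> homogeneous n G \<Longrightarrow> l = m + n \<Longrightarrow> homogeneous l (F * G)"
  using homogeneous_mult' by blast

text \<open>Multiplication by G shifts the grading by n. Projections can therefore be pushed into
  linear relations with homogeneous coefficients, which turns arbitrary solutions into homogeneous
  ones.\<close>

lemma hom_comp_mult:
  fixes F G :: "'k::comm_ring_1 pol3"
  assumes G: "homogeneous n G"
  shows "hom_comp m (F * G) = hom_comp (m - n) F * G"
proof -
  \<comment> \<open>The discarded part of F has no term of degree m - n, hence its product with G
    has none of degree m.\<close>
  have "c3 ((F - hom_comp (m - n) F) * G) a b c = 0" if "int (a + b + c) = m" for a b c
  proof (rule ccontr)
    assume "c3 ((F - hom_comp (m - n) F) * G) a b c \<noteq> 0"
    then obtain a' b' c' where *: "a' \<le> a" "b' \<le> b" "c' \<le> c"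
      "c3 (F - hom_comp (m - n) F) a' b' c' \<noteq> 0" "c3 G (a - a') (b - b') (c - c') \<noteq> 0"
      by (rule c3_mult_nonzero)
    then have "int ((a - a') + (b - b') + (c - c')) = n" "int (a' + b' + c') \<noteq> m - n"
      using G[unfolded homogeneous_c3, rule_format, OF *(5)] *(4) by (simp_all split: if_splits)
    then show False using * that by linarith
  qed
  then have "hom_comp m ((F - hom_comp (m - n) F) * G) = 0"
    by (intro pol3_eqI) simp
  moreover have "hom_comp m (hom_comp (m - n) F * G) = hom_comp (m - n) F * G"
    using homogeneous_mult'[of "m - n" "hom_comp (m - n) F" n G] G
    by (subst hom_comp_homogeneous[of m]) simp_all
  ultimately show ?thesis
    by (simp add: hom_comp_diff left_diff_distrib)
qed

lemma homogeneous_0 [simp]: "homogeneous n (0 :: 'k::comm_ring_1 pol3)"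
  by (simp add: homogeneous_c3)

lemma homogeneous_var:
  "homogeneous 1 (var_x :: 'k::comm_ring_1 pol3)" "homogeneous 1 (var_y :: 'k pol3)"
  "homogeneous 1 (var_z :: 'k pol3)"
  by (auto simp: homogeneous_def var_x_def var_y_def var_z_def coeff_pCons split: nat.splits)

lemma homogeneous_const3: "homogeneous 0 (const3 k :: 'k::comm_ring_1 pol3)"
  by (simp add: homogeneous_c3 c3_const3)

lemma homogeneous_const_mult [intro]:
  "homogeneous n F \<Longrightarrow> homogeneous n (const3 k * F :: 'k::comm_ring_1 pol3)"
  using homogeneous_mult[OF homogeneous_const3, of n F n k] by simp

lemma homogeneous_power: "homogeneous n F \<Longrightarrow> homogeneous (int m * n) (F ^ m :: 'k::comm_ring_1 pol3)"
  by (induction m) (auto simp: homogeneous_const3[of 1, simplified] algebra_simps intro: homogeneous_mult)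

lemma homogeneous_partial:
  fixes F :: "'k::idom pol3"
  assumes "homogeneous n F"
  shows "homogeneous (n - 1) (partial_x F)" "homogeneous (n - 1) (partial_y F)"
    "homogeneous (n - 1) (partial_z F)"
  using assms unfolding homogeneous_c3 c3_partial by fastforce+

lemma homogeneous_neg: "homogeneous n F \<Longrightarrow> n < 0 \<Longrightarrow> F = (0 :: 'k::comm_ring_1 pol3)"
  by (rule pol3_eqI) (fastforce simp: homogeneous_c3)

lemma homogeneous_zero_iff: "homogeneous 0 F \<longleftrightarrow> (\<exists>k. F = (const3 k :: 'k::comm_ring_1 pol3))"
proof
  assume "homogeneous 0 F"
  then have "c3 F a b c = 0" if "a + b + c > 0" for a b c
    using that unfolding homogeneous_c3 by fastforce
  then have "F = const3 (c3 F 0 0 0)"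
    by (intro pol3_eqI) (auto simp: c3_const3)
  then show "\<exists>k. F = const3 k" ..
qed (auto simp: homogeneous_const3)

lemma euler:
  fixes F :: "'k::idom pol3"
  assumes "homogeneous n F"
  shows "var_x * partial_x F + var_y * partial_y F + var_z * partial_z F = of_int n * F"
proof (rule pol3_eqI)
  fix a b c
  have F: "of_int n * F = const3 (of_int n) * F"
  proof (cases n)
    case (nonneg m)
    then show ?thesis using const3_of_nat[of m, where 'k='k] by simp
  next
    case (neg m)
    then show ?thesis using homogeneous_neg[OF assms] by simp
  qed
  have "c3 F a b c \<noteq> 0 \<Longrightarrow> of_int n = (of_nat a + of_nat b + of_nat c :: 'k)"
    using assms unfolding homogeneous_c3
    by (metis of_int_of_nat_eq of_nat_add)
  then have "of_int n * c3 F a b c = (of_nat a + of_nat b + of_nat c) * c3 F a b c"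
    by (cases "c3 F a b c = 0") simp_all
  moreover have "c3 (var_x * partial_x F) a b c = of_nat a * c3 F a b c"
    by (cases a) (simp_all add: c3_var_mult c3_partial)
  moreover have "c3 (var_y * partial_y F) a b c = of_nat b * c3 F a b c"
    by (cases b) (simp_all add: c3_var_mult c3_partial)
  moreover have "c3 (var_z * partial_z F) a b c = of_nat c * c3 F a b c"
    by (cases c) (simp_all add: c3_var_mult c3_partial)
  ultimately show "c3 (var_x * partial_x F + var_y * partial_y F + var_z * partial_z F) a b c =
      c3 (of_int n * F) a b c"
    unfolding F by (simp add: distrib_right)
qed

section \<open>Derivations\<close>

lemma derivationD:
  assumes "derivation D"
  shows "D (F + G) = D F + D G" "D (const3 k * F) = const3 k * D F" "D (F * G) = F * D G + G * D F"
  using assms[unfolded derivation_def, THEN conjunct1, rule_format]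
    assms[unfolded derivation_def, THEN conjunct2, THEN conjunct1, rule_format]
    assms[unfolded derivation_def, THEN conjunct2, THEN conjunct2, rule_format] .

lemma derivation_formula:
  fixes D :: "'k::idom pol3 \<Rightarrow> 'k pol3"
  assumes "derivation D"
  shows "D F = D var_x * partial_x F + D var_y * partial_y F + D var_z * partial_z F"
proof -
  note a = derivationD(1)[OF assms] and c = derivationD(2)[OF assms] and m = derivationD(3)[OF assms]
  show ?thesis
  proof (induction F rule: pol3_induct)
    case (const k)
    have "D 1 = 0" using m[of 1 1] by (metis add_cancel_right_right mult_1)
    then have "D (const3 k) = 0" using c[of k 1] by simp
    then show ?case by simp
  next
    case (add F G)
    then show ?case unfolding a by (simp add: algebra_simps)
  next
    case (mult F G)
    then show ?case unfolding m[of F G] partial_mult by (simp only: algebra_simps)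
  qed simp_all
qed

section \<open>Nodal and cuspidal cubics\<close>

text \<open>
  What is needed of the potential. For a singular cubic the Koszul complex of the gradient is not
  exact, but it remains so on divergence-free fields.
\<close>

definition tame :: "'k::idom pol3 \<Rightarrow> bool" where
  "tame \<Omega> \<longleftrightarrow>
     (\<forall>F. \<Omega> dvd F * partial_x \<Omega> \<and> \<Omega> dvd F * partial_y \<Omega> \<and> \<Omega> dvd F * partial_z \<Omega> \<longrightarrow> \<Omega> dvd F) \<and>
     (\<forall>V1 V2 V3. V1 * partial_x \<Omega> + V2 * partial_y \<Omega> + V3 * partial_z \<Omega> = 0 \<and>
        partial_x V1 + partial_y V2 + partial_z V3 = 0 \<longrightarrow>
        (\<exists>W1 W2 W3. V1 = W2 * partial_z \<Omega> - W3 * partial_y \<Omega> \<and>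
           V2 = W3 * partial_x \<Omega> - W1 * partial_z \<Omega> \<and> V3 = W1 * partial_y \<Omega> - W2 * partial_x \<Omega>))"

lemma subst3_decomp_xy:
  fixes F :: "'k::comm_ring_1 pol3"
  shows "\<exists>G H. F = subst3 0 0 var_z F + var_x * G + var_y * H"
proof -
  obtain G where G: "F = subst3 0 var_y var_z F + var_x * G" using subst3_decomp(1) by blast
  obtain H where H: "subst3 0 var_y var_z F = subst3 var_x 0 var_z (subst3 0 var_y var_z F) + var_y * H"
    using subst3_decomp(2) by blast
  have "F = subst3 0 0 var_z F + var_x * G + var_y * H"
    using G H by (simp add: subst3_subst3 add.commute add.left_commute)
  then show ?thesis by blast
qed

text \<open>The product rule for the divergence of a cross product, with the curl of the gradient
  equal to zero. It places the divergence of such a field in the ideal of the partial derivatives,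
  which vanishes along the singular line.\<close>

lemma div_cross_gradient:
  fixes \<Omega> :: "'k::idom pol3"
  shows "partial_x (W2 * partial_z \<Omega> - W3 * partial_y \<Omega>) + partial_y (W3 * partial_x \<Omega> - W1 * partial_z \<Omega>)
      + partial_z (W1 * partial_y \<Omega> - W2 * partial_x \<Omega>) =
    (partial_y W3 - partial_z W2) * partial_x \<Omega> + (partial_z W1 - partial_x W3) * partial_y \<Omega>
      + (partial_x W2 - partial_y W1) * partial_z \<Omega>"
  by (simp add: partial_mult partial_commute algebra_simps)

text \<open>The operator multiplies the monomial with z-exponent c by m c + n + 1, which is nonzero
  in characteristic zero.\<close>

lemma weighted_euler_eq_0:
  fixes F :: "'k::field_char_0 pol3"
  assumes "of_nat m * (var_z * partial_z F) + of_nat (Suc n) * F = 0"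
  shows "F = 0"
proof (rule pol3_eqI)
  fix a b c
  have "c3 (var_z * partial_z F) a b c = of_nat c * c3 F a b c"
    by (cases c) (simp_all add: c3_var_mult c3_partial)
  then have "c3 (const3 (of_nat m) * (var_z * partial_z F) + const3 (of_nat (Suc n)) * F) a b c
      = of_nat (m * c + Suc n) * c3 F a b c"
    by (simp add: distrib_right mult.assoc)
  then have "of_nat (m * c + Suc n) * c3 F a b c = 0"
    using assms by (simp add: const3_of_nat del: of_nat_Suc)
  moreover have "of_nat (m * c + Suc n) \<noteq> (0::'k)"
    by (metis add_Suc_right nat.distinct(1) of_nat_eq_0_iff)
  ultimately show "c3 F a b c = c3 0 a b c"
    by simp
qed

text \<open>V is reduced modulo cross products with the gradient by restricting the relation to x =
  0 and then to y = 0. What survives is a multiple c0(z) of T = (x z, - \<alpha> x^2, - z^2 +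
  \<alpha> \<beta> x y), and the divergence condition forces c0 = 0.\<close>

lemma tame_node:
  fixes a b :: "'k::field_char_0"
  assumes ab: "a \<noteq> 0" "b \<noteq> 0"
  shows "tame (var_x * var_y * var_z + const3 a * var_x ^ 3 + const3 b * var_y ^ 3)"
    (is "tame ?\<Omega>")
proof -
  define \<alpha> \<beta> where "\<alpha> = 3 * const3 a" and "\<beta> = 3 * const3 b"
  define f1 f2 f3 where "f1 = var_y * var_z + \<alpha> * var_x ^ 2" and "f2 = var_x * var_z + \<beta> * var_y ^ 2"
    and "f3 = (var_x * var_y :: 'k pol3)"
  note f_def = f1_def f2_def f3_def
  have nz: "\<alpha> \<noteq> 0" "\<beta> \<noteq> 0" using ab by (simp_all add: \<alpha>_def \<beta>_def)
  define bi where "bi = const3 (inverse (3 * b))"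
  have bi: "\<beta> * bi = 1"
    using ab by (simp add: bi_def \<beta>_def flip: const3_numeral const3_hom)
  have [simp]: "subst3 p q r \<alpha> = \<alpha>" "subst3 p q r \<beta> = \<beta>" for p q r
    by (simp_all add: \<alpha>_def \<beta>_def)
  have [simp]: "partial_x \<alpha> = 0" "partial_y \<alpha> = 0" "partial_z \<alpha> = 0"
    "partial_x \<beta> = 0" "partial_y \<beta> = 0" "partial_z \<beta> = 0"
    by (simp_all add: \<alpha>_def \<beta>_def partial_mult)
  have f: "partial_x ?\<Omega> = f1" "partial_y ?\<Omega> = f2" "partial_z ?\<Omega> = f3"
    by (simp_all add: f_def \<alpha>_def \<beta>_def partial_mult partial_power numeral_3_eq_3 power2_eq_square algebra_simps)
  have ndvd: "\<not> var_x dvd ?\<Omega>" "\<not> var_y dvd ?\<Omega>"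
    using ab by (simp_all add: var_dvd_iff)
  have cancel: "?\<Omega> dvd F" if d: "?\<Omega> dvd F * v" and nd: "\<not> v dvd ?\<Omega>" and v: "v = var_x \<or> v = var_y" for F v
  proof -
    obtain G where G: "F * v = ?\<Omega> * G" using d by blast
    have "v dvd ?\<Omega> * G" by (metis G dvd_triv_right)
    then have "v dvd G" using nd v by (auto simp: var_dvd_iff)
    then obtain H where H: "G = v * H" by blast
    have "v \<noteq> 0" using v by auto
    then have "F = ?\<Omega> * H" using G unfolding H by (simp add: mult.left_commute mult.commute[of F])
    then show ?thesis by simp
  qed
  \<comment> \<open>The z-derivative is x y, a product of two primes that do not divide the
    cubic.\<close>
  have 1: "?\<Omega> dvd F" if "?\<Omega> dvd F * f3" for F
  proof -
    have "?\<Omega> dvd F * var_x * var_y" using that unfolding f3_def mult.assoc .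
    then have "?\<Omega> dvd F * var_x" by (rule cancel[OF _ ndvd(2)]) simp
    then show ?thesis by (rule cancel[OF _ ndvd(1)]) simp
  qed
  have 2: "\<exists>W1 W2 W3. V1 = W2 * f3 - W3 * f2 \<and> V2 = W3 * f1 - W1 * f3 \<and> V3 = W1 * f2 - W2 * f1"
    if E: "V1 * f1 + V2 * f2 + V3 * f3 = 0" and D: "partial_x V1 + partial_y V2 + partial_z V3 = 0"
    for V1 V2 V3
  proof -
    obtain U1 where U1: "V1 = subst3 0 var_y var_z V1 + var_x * U1" using subst3_decomp(1) by blast
    obtain U2 where U2: "V2 = subst3 0 var_y var_z V2 + var_x * U2" using subst3_decomp(1) by blast
    define P1 P2 where "P1 = subst3 0 var_y var_z V1" and "P2 = subst3 0 var_y var_z V2"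
    \<comment> \<open>On x = 0 the gradient is (y z, \<beta> y^2, 0), so (P1, P2) is a multiple of
      (\<beta> y, - z).\<close>
    have "subst3 0 var_y var_z (V1 * f1 + V2 * f2 + V3 * f3) = 0" by (simp add: E)
    then have "var_y * (P1 * var_z + \<beta> * (P2 * var_y)) = 0"
      by (simp add: f_def P1_def P2_def power2_eq_square algebra_simps)
    then have e1: "P1 * var_z + \<beta> * (P2 * var_y) = 0" by simp
    have "subst3 var_x 0 var_z (P1 * var_z + \<beta> * (P2 * var_y)) = 0" by (simp only: e1 subst3_simps)
    then have "subst3 var_x 0 var_z P1 = 0" by simp
    then obtain g where g: "P1 = var_y * g" by (metis var_dvd_iff(2) dvdE)
    define h where "h = bi * g"
    have gh: "g = \<beta> * h" using bi by (simp add: h_def flip: mult.assoc)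
    have P1: "P1 = \<beta> * (var_y * h)" by (simp add: g gh mult.left_commute)
    have "(\<beta> * var_y) * (P2 + var_z * h) = 0"
      using e1 unfolding P1 by (simp add: algebra_simps)
    then have P2: "P2 = - (var_z * h)" using nz by (simp add: eq_neg_iff_add_eq_0)
    have V1: "V1 = \<beta> * (var_y * h) + var_x * U1" using U1 P1 unfolding P1_def by simp
    have V2: "V2 = - (var_z * h) + var_x * U2" using U2 P2 unfolding P2_def by simp
    \<comment> \<open>On y = 0 and after division by x, the only term free of x is z^2 h. Hence h
      vanishes on the line x = y = 0 and lies in the ideal (x, y).\<close>
    have "subst3 var_x 0 var_z (V1 * f1 + V2 * f2 + V3 * f3) = 0" by (simp add: E)
    then have "var_x * (\<alpha> * (var_x ^ 2 * subst3 var_x 0 var_z U1) - var_z ^ 2 * subst3 var_x 0 var_z h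
        + var_x * (var_z * subst3 var_x 0 var_z U2)) = 0"
      unfolding V1 V2 f_def by (simp add: power2_eq_square algebra_simps)
    then have "subst3 0 var_y var_z (\<alpha> * (var_x ^ 2 * subst3 var_x 0 var_z U1) - var_z ^ 2 * subst3 var_x 0 var_z h
        + var_x * (var_z * subst3 var_x 0 var_z U2)) = 0"
      by simp
    then have "subst3 0 0 var_z h = 0"
      by (simp add: subst3_subst3)
    then obtain h1 h2 where h: "h = var_x * h1 + var_y * h2"
      using subst3_decomp_xy[of h] by auto
    \<comment> \<open>With h = x h1 + y h2, the field (h2 f2, - h2 f1, 0) is split off; it is a
      cross product with the gradient, and the first two components of the rest are divisible by
      x.\<close>
    define R1 where "R1 = \<beta> * (var_y * h1) + U1 - var_z * h2"
    define R2 where "R2 = U2 - var_z * h1 + \<alpha> * (var_x * h2)"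
    have V1: "V1 = h2 * f2 + var_x * R1" and V2: "V2 = - (h2 * f1) + var_x * R2"
      unfolding V1 V2 h R1_def R2_def f_def by (simp_all add: power2_eq_square algebra_simps)
    have "var_x * (R1 * f1 + R2 * f2 + V3 * var_y) = 0"
      using E unfolding V1 V2 by (simp add: f3_def algebra_simps)
    then have e2: "R1 * f1 + R2 * f2 + V3 * var_y = 0" by simp
    \<comment> \<open>The same elimination on y = 0, where f1 and f2 become \<alpha> x^2 and x
      z.\<close>
    have "subst3 var_x 0 var_z (R1 * f1 + R2 * f2 + V3 * var_y) = 0" by (simp only: e2 subst3_simps)
    then have "var_x * (\<alpha> * (var_x * subst3 var_x 0 var_z R1) + var_z * subst3 var_x 0 var_z R2) = 0"
      by (simp add: f_def power2_eq_square algebra_simps)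
    then have e3: "\<alpha> * (var_x * subst3 var_x 0 var_z R1) + var_z * subst3 var_x 0 var_z R2 = 0" by simp
    have "subst3 var_x var_y 0 (\<alpha> * (var_x * subst3 var_x 0 var_z R1) + var_z * subst3 var_x 0 var_z R2) = 0"
      by (simp only: e3 subst3_simps)
    then have "var_z dvd subst3 var_x 0 var_z R1" using nz by (simp add: var_dvd_iff)
    then obtain c where c: "subst3 var_x 0 var_z R1 = var_z * c" by blast
    have "var_z * (subst3 var_x 0 var_z R2 + \<alpha> * (var_x * c)) = 0"
      using e3 unfolding c by (simp add: algebra_simps)
    then have c': "subst3 var_x 0 var_z R2 = - (\<alpha> * (var_x * c))" by (simp add: eq_neg_iff_add_eq_0)
    obtain d where d: "R1 = var_z * c + var_y * d" using subst3_decomp(2)[of R1] unfolding c by blast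
    obtain e where e: "R2 = - (\<alpha> * (var_x * c)) + var_y * e" using subst3_decomp(2)[of R2] unfolding c' by blast
    \<comment> \<open>The third component of T. Apart from cross products with the gradient, V is c
      T.\<close>
    define t where "t = - (var_z ^ 2) + \<alpha> * (\<beta> * (var_x * var_y))"
    have "var_y * (V3 - c * t + d * f1 + e * f2) = 0"
      using e2 unfolding d e t_def f_def by (simp add: power2_eq_square algebra_simps)
    then have "V3 - c * t + d * f1 + e * f2 = 0" by (metis mult_eq_0_iff var_neq_0(2))
    then have V3: "V3 = c * t - d * f1 - e * f2" by (simp add: algebra_simps)
    \<comment> \<open>Both x T and y T are cross products with the gradient; the terms with c1 and
      c2 in the witnesses below absorb them, and only the restriction c0 of c to the line x = y = 0
      is left.\<close>
    obtain c1 c2 where cc: "c = subst3 0 0 var_z c + var_x * c1 + var_y * c2" using subst3_decomp_xy by blast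
    define c0 where "c0 = subst3 0 0 var_z c"
    define W1 W2 W3 where "W1 = - e - c1 * var_z + \<alpha> * (var_x * c2)"
      and "W2 = d - \<beta> * (var_y * c1) + c2 * var_z" and "W3 = - h2 - c1 * var_x"
    have V1: "V1 = c0 * (var_x * var_z) + (W2 * f3 - W3 * f2)"
      unfolding V1 d W2_def W3_def f_def cc[folded c0_def] by (simp add: power2_eq_square algebra_simps)
    have V2: "V2 = - (\<alpha> * (var_x ^ 2 * c0)) + (W3 * f1 - W1 * f3)"
      unfolding V2 e W1_def W3_def f_def cc[folded c0_def] by (simp add: power2_eq_square algebra_simps)
    have V3: "V3 = c0 * t + (W1 * f2 - W2 * f1)"
      unfolding V3 t_def W1_def W2_def f_def cc[folded c0_def] by (simp add: power2_eq_square algebra_simps)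
    have pc0: "partial_x c0 = 0" "partial_y c0 = 0"
      by (simp_all add: c0_def chain_rule)
    have "0 = partial_x V1 + partial_y V2 + partial_z V3" by (simp add: D)
    also have "\<dots> = partial_z c0 * t - c0 * var_z
        + (partial_x (W2 * f3 - W3 * f2) + partial_y (W3 * f1 - W1 * f3) + partial_z (W1 * f2 - W2 * f1))"
      unfolding V1 V2 V3 t_def by (simp add: partial_mult pc0 power2_eq_square algebra_simps)
    also have "\<dots> = partial_z c0 * t - c0 * var_z + ((partial_y W3 - partial_z W2) * f1
        + (partial_z W1 - partial_x W3) * f2 + (partial_x W2 - partial_y W1) * f3)"
      unfolding f[symmetric] by (subst div_cross_gradient) (rule refl)
    \<comment> \<open>The gradient vanishes on x = y = 0, so there the divergence of the cross
      product drops out and - z (z c0' + c0) = 0 remains.\<close>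
    finally have "0 = subst3 0 0 var_z (partial_z c0 * t - c0 * var_z + ((partial_y W3 - partial_z W2) * f1
        + (partial_z W1 - partial_x W3) * f2 + (partial_x W2 - partial_y W1) * f3))"
      by (metis subst3_simps(4))
    moreover have "subst3 0 0 var_z c0 = c0" "subst3 0 0 var_z (partial_z c0) = partial_z c0"
      by (simp_all add: c0_def chain_rule subst3_subst3)
    ultimately have "var_z * (of_nat 1 * (var_z * partial_z c0) + of_nat (Suc 0) * c0) = 0"
      by (simp add: f_def t_def power2_eq_square algebra_simps)
    then have "of_nat 1 * (var_z * partial_z c0) + of_nat (Suc 0) * c0 = 0" by simp
    then have "c0 = 0" by (rule weighted_euler_eq_0)
    then show ?thesis unfolding V1 V2 V3 by (intro exI[of _ W1] exI[of _ W2] exI[of _ W3]) simp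
  qed
  show ?thesis unfolding tame_def f using 1 2 by blast
qed

text \<open>Here T = (x, 0, - 2 z). Since x T and y^2 T are cross products with the gradient, the
  surviving multiples are (s(z) + y t(z)) T, and the divergence has to be read to first order in y
  along x = y = 0.\<close>

lemma tame_cusp:
  fixes b :: "'k::field_char_0"
  assumes b: "b \<noteq> 0"
  shows "tame (var_x ^ 2 * var_z + const3 b * var_y ^ 3)" (is "tame ?\<Omega>")
proof -
  define \<beta> where "\<beta> = 3 * const3 b"
  define f1 f2 f3 where "f1 = 2 * (var_x * var_z :: 'k pol3)" and "f2 = \<beta> * var_y ^ 2"
    and "f3 = (var_x ^ 2 :: 'k pol3)"
  note f_def = f1_def f2_def f3_def
  have nz: "\<beta> \<noteq> 0" using b by (simp add: \<beta>_def)
  define bi where "bi = const3 (inverse (3 * b))"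
  have bi: "\<beta> * bi = 1"
    using b by (simp add: bi_def \<beta>_def flip: const3_numeral const3_hom)
  have [simp]: "subst3 p q r \<beta> = \<beta>" "subst3 p q r bi = bi" for p q r
    by (simp_all add: \<beta>_def bi_def)
  have [simp]: "partial_x \<beta> = 0" "partial_y \<beta> = 0" "partial_z \<beta> = 0"
    by (simp_all add: \<beta>_def partial_mult)
  have f: "partial_x ?\<Omega> = f1" "partial_y ?\<Omega> = f2" "partial_z ?\<Omega> = f3"
    by (simp_all add: f_def \<beta>_def partial_mult partial_power numeral_3_eq_3 power2_eq_square algebra_simps)
  have ndvd: "\<not> var_x dvd ?\<Omega>"
    using b by (simp add: var_dvd_iff)
  have cancel: "?\<Omega> dvd F" if d: "?\<Omega> dvd F * var_x" for F
  proof -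
    obtain G where G: "F * var_x = ?\<Omega> * G" using d by blast
    have "var_x dvd ?\<Omega> * G" by (metis G dvd_triv_right)
    then have "var_x dvd G" using ndvd by (auto simp: var_dvd_iff)
    then obtain H where H: "G = var_x * H" by blast
    have "F = ?\<Omega> * H" using G unfolding H by (simp add: mult.left_commute mult.commute[of F])
    then show ?thesis by simp
  qed
  have 1: "?\<Omega> dvd F" if "?\<Omega> dvd F * f3" for F
  proof -
    have "?\<Omega> dvd F * var_x * var_x" using that unfolding f3_def power2_eq_square mult.assoc .
    then show ?thesis by (rule cancel[OF cancel])
  qed
  have 2: "\<exists>W1 W2 W3. V1 = W2 * f3 - W3 * f2 \<and> V2 = W3 * f1 - W1 * f3 \<and> V3 = W1 * f2 - W2 * f1"
    if E: "V1 * f1 + V2 * f2 + V3 * f3 = 0" and D: "partial_x V1 + partial_y V2 + partial_z V3 = 0"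
    for V1 V2 V3
  proof -
    have "subst3 0 var_y var_z (V1 * f1 + V2 * f2 + V3 * f3) = 0" by (simp add: E)
    then have "subst3 0 var_y var_z V2 = 0" using nz by (simp add: f_def)
    then obtain U2 where V2: "V2 = var_x * U2" by (metis var_dvd_iff(1) dvdE)
    have "var_x * (2 * (var_z * V1) + \<beta> * (var_y ^ 2 * U2) + var_x * V3) = 0"
      using E unfolding V2 f_def by (simp add: power2_eq_square algebra_simps)
    then have e1: "2 * (var_z * V1) + \<beta> * (var_y ^ 2 * U2) + var_x * V3 = 0" by simp
    obtain R1 where R1: "V1 = subst3 0 var_y var_z V1 + var_x * R1" using subst3_decomp(1) by blast
    obtain R2 where R2: "U2 = subst3 0 var_y var_z U2 + var_x * R2" using subst3_decomp(1) by blast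
    define P1 P2 where "P1 = subst3 0 var_y var_z V1" and "P2 = subst3 0 var_y var_z U2"
    have "subst3 0 var_y var_z (2 * (var_z * V1) + \<beta> * (var_y ^ 2 * U2) + var_x * V3) = 0"
      by (simp only: e1 subst3_simps)
    then have e2: "2 * (var_z * P1) + \<beta> * (var_y ^ 2 * P2) = 0" by (simp add: P1_def P2_def)
    \<comment> \<open>As 2 z P1 = - \<beta> y^2 P2 and y is prime to z, y^2 divides P1; the two
      factors are removed one at a time.\<close>
    have "subst3 var_x 0 var_z (2 * (var_z * P1) + \<beta> * (var_y ^ 2 * P2)) = 0" by (simp only: e2 subst3_simps)
    then have "var_y dvd P1" by (simp add: var_dvd_iff)
    then obtain g1 where g1: "P1 = var_y * g1" by blast
    have "var_y * (2 * (var_z * g1) + \<beta> * (var_y * P2)) = 0"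
      using e2 unfolding g1 by (simp add: power2_eq_square algebra_simps)
    then have e3: "2 * (var_z * g1) + \<beta> * (var_y * P2) = 0" by simp
    have "subst3 var_x 0 var_z (2 * (var_z * g1) + \<beta> * (var_y * P2)) = 0" by (simp only: e3 subst3_simps)
    then have "var_y dvd g1" by (simp add: var_dvd_iff)
    then obtain g where g: "g1 = var_y * g" by blast
    define h where "h = bi * g"
    have gh: "g = \<beta> * h" using bi by (simp add: h_def flip: mult.assoc)
    have "(\<beta> * var_y) * (P2 + 2 * (var_z * h)) = 0"
      using e3 unfolding g gh by (simp add: algebra_simps)
    then have P2: "P2 = - (2 * (var_z * h))" using nz by (simp add: eq_neg_iff_add_eq_0)
    have V1: "V1 = h * f2 + var_x * R1" using R1 unfolding P1_def[symmetric] g1 g gh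
      by (simp add: f_def power2_eq_square algebra_simps)
    have U2: "U2 = - (2 * (var_z * h)) + var_x * R2" using R2 unfolding P2_def[symmetric] P2 .
    have V2: "V2 = - (h * f1) + R2 * f3"
      unfolding V2 U2 by (simp add: f_def power2_eq_square algebra_simps)
    have "var_x * (V3 + 2 * (var_z * R1) + R2 * f2) = 0"
      using e1 unfolding V1 U2 by (simp add: f_def power2_eq_square algebra_simps)
    then have "V3 + 2 * (var_z * R1) + R2 * f2 = 0" by (metis mult_eq_0_iff var_neq_0(1))
    then have V3: "V3 = - (2 * (var_z * R1)) - R2 * f2" by (simp add: algebra_simps eq_neg_iff_add_eq_0)
    \<comment> \<open>R1 is expanded modulo the ideal (x, y^2), with remainder s + y t.\<close>
    obtain p1 p2 where p: "R1 = subst3 0 0 var_z R1 + var_x * p1 + var_y * p2" using subst3_decomp_xy by blast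
    obtain q1 q2 where q: "p2 = subst3 0 0 var_z p2 + var_x * q1 + var_y * q2" using subst3_decomp_xy by blast
    define s t where "s = subst3 0 0 var_z R1" and "t = subst3 0 0 var_z p2"
    define p' where "p' = p1 + var_y * q1"
    have "R1 = s + var_x * p1 + var_y * (t + var_x * q1 + var_y * q2)"
      using p unfolding q[folded t_def, symmetric] s_def .
    then have R1: "R1 = s + var_y * t + var_x * p' + var_y ^ 2 * q2"
      by (simp add: p'_def power2_eq_square algebra_simps)
    \<comment> \<open>The terms with p' and q2 absorb p' x T and q2 y^2 T; \<open>bi\<close> inverts
      the coefficient of y^2 in f2.\<close>
    define W1 W2 W3 where "W1 = - R2 - 2 * (var_z * (bi * q2))" and "W2 = p'" and "W3 = - h - var_x * (bi * q2)"
    have bi': "\<beta> * (bi * u) = u" for u using bi by (simp flip: mult.assoc)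
    have bi'': "\<beta> * (u * (bi * v)) = u * v" "\<beta> * (u * (u' * (bi * v))) = u * (u' * v)"
      "\<beta> * (u * (u' * (u'' * (bi * v)))) = u * (u' * (u'' * v))" for u u' u'' v
      using bi'[of "u * v"] bi'[of "u * (u' * v)"] bi'[of "u * (u' * (u'' * v))"]
      by (simp_all add: mult.left_commute)
    have V1: "V1 = var_x * (s + var_y * t) + (W2 * f3 - W3 * f2)"
      unfolding V1 R1 W2_def W3_def f_def by (simp add: power2_eq_square algebra_simps bi' bi'')
    have V2: "V2 = W3 * f1 - W1 * f3"
      unfolding V2 W1_def W3_def W2_def f_def by (simp add: power2_eq_square algebra_simps)
    have V3: "V3 = - (2 * (var_z * (s + var_y * t))) + (W1 * f2 - W2 * f1)"
      unfolding V3 R1 W1_def W2_def f_def by (simp add: power2_eq_square algebra_simps bi' bi'')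
    have st: "partial_x s = 0" "partial_y s = 0" "partial_x t = 0" "partial_y t = 0"
      by (simp_all add: s_def t_def chain_rule)
    have "0 = partial_x V1 + partial_y V2 + partial_z V3" by (simp add: D)
    also have "\<dots> = - (s + 2 * (var_z * partial_z s)) - var_y * (t + 2 * (var_z * partial_z t))
        + (partial_x (W2 * f3 - W3 * f2) + partial_y (W3 * f1 - W1 * f3) + partial_z (W1 * f2 - W2 * f1))"
      unfolding V1 V2 V3 by (simp add: partial_mult st algebra_simps)
    also have "\<dots> = - (s + 2 * (var_z * partial_z s)) - var_y * (t + 2 * (var_z * partial_z t))
       + ((partial_y W3 - partial_z W2) * f1
        + (partial_z W1 - partial_x W3) * f2 + (partial_x W2 - partial_y W1) * f3)"
      unfolding f[symmetric] by (subst div_cross_gradient) (rule refl)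
    finally have e4: "- (s + 2 * (var_z * partial_z s)) - var_y * (t + 2 * (var_z * partial_z t))
       + ((partial_y W3 - partial_z W2) * f1
        + (partial_z W1 - partial_x W3) * f2 + (partial_x W2 - partial_y W1) * f3) = 0" ..
    have inv: "subst3 0 0 var_z s = s" "subst3 0 0 var_z (partial_z s) = partial_z s"
      "subst3 0 0 var_z t = t" "subst3 0 0 var_z (partial_z t) = partial_z t"
      by (simp_all add: s_def t_def chain_rule subst3_subst3)
    have "subst3 0 0 var_z (- (s + 2 * (var_z * partial_z s)) - var_y * (t + 2 * (var_z * partial_z t))
       + ((partial_y W3 - partial_z W2) * f1
        + (partial_z W1 - partial_x W3) * f2 + (partial_x W2 - partial_y W1) * f3)) = - (s + 2 * (var_z * partial_z s))"
      by (simp add: f_def inv)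
    then have "s + 2 * (var_z * partial_z s) = 0"
      unfolding e4 by (metis neg_equal_0_iff_equal subst3_simps(4))
    then have "of_nat 2 * (var_z * partial_z s) + of_nat (Suc 0) * s = 0"
      by (simp add: add.commute)
    then have s: "s = 0" by (rule weighted_euler_eq_0)
    \<comment> \<open>The gradient lies in the ideal (x, y^2), so even the y-derivative of the cross
      product part vanishes on the line, and the coefficient of y can be compared.\<close>
    have "subst3 0 0 var_z (partial_y (- (s + 2 * (var_z * partial_z s)) - var_y * (t + 2 * (var_z * partial_z t))
       + ((partial_y W3 - partial_z W2) * f1
        + (partial_z W1 - partial_x W3) * f2 + (partial_x W2 - partial_y W1) * f3))) = - (t + 2 * (var_z * partial_z t))"
      by (simp add: s f_def inv partial_mult partial_power st flip: partial_commute)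
    then have "t + 2 * (var_z * partial_z t) = 0"
      unfolding e4 by (metis neg_equal_0_iff_equal subst3_simps(4) partial_simps(5))
    then have "of_nat 2 * (var_z * partial_z t) + of_nat (Suc 0) * t = 0"
      by (simp add: add.commute)
    then have "t = 0" by (rule weighted_euler_eq_0)
    then show ?thesis unfolding V1 V2 V3 s by (intro exI[of _ W1] exI[of _ W2] exI[of _ W3]) simp
  qed
  show ?thesis unfolding tame_def f using 1 2 by blast
qed

section \<open>Linear changes of coordinates\<close>

text \<open>Euler's identity divided by the degree. It is the induction step for statements about
  homogeneous polynomials.\<close>

lemma homogeneous_Suc_decomp:
  fixes F :: "'k::field_char_0 pol3"
  assumes "homogeneous (int (Suc n)) F"
  shows "\<exists>A B C. homogeneous (int n) A \<and> homogeneous (int n) B \<and> homogeneous (int n) C \<and>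
    F = var_x * A + var_y * B + var_z * C"
proof -
  define r :: "'k pol3" where "r = const3 (inverse (of_nat (Suc n)))"
  have e: "const3 (of_nat (Suc n)) * F = var_x * partial_x F + var_y * partial_y F + var_z * partial_z F"
    using euler[OF assms] by (simp add: const3_of_nat del: of_nat_Suc)
  have "F = r * (const3 (of_nat (Suc n)) * F)"
    by (simp add: r_def flip: mult.assoc const3_hom del: of_nat_Suc)
  also have "\<dots> = var_x * (r * partial_x F) + var_y * (r * partial_y F) + var_z * (r * partial_z F)"
    unfolding e by (simp add: algebra_simps)
  finally show ?thesis
    using homogeneous_partial[OF assms]
    by (intro exI[of _ "r * partial_x F"] exI[of _ "r * partial_y F"] exI[of _ "r * partial_z F"])
      (auto simp: r_def)
qed

lemma homogeneous_subst3:
  fixes F :: "'k::field_char_0 pol3"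
  assumes "homogeneous (int n) F" "homogeneous 1 a" "homogeneous 1 b" "homogeneous 1 c"
  shows "homogeneous (int n) (subst3 a b c F)"
  using assms(1)
proof (induction n arbitrary: F)
  case 0
  then show ?case by (auto simp: homogeneous_zero_iff)
next
  case (Suc n)
  obtain A B C where *: "homogeneous (int n) A" "homogeneous (int n) B" "homogeneous (int n) C"
    "F = var_x * A + var_y * B + var_z * C" using homogeneous_Suc_decomp[OF Suc.prems] by blast
  then show ?case using assms(2-4) Suc.IH[OF *(1)] Suc.IH[OF *(2)] Suc.IH[OF *(3)]
    by (auto intro!: homogeneous_add intro: homogeneous_mult)
qed

lemma linear_form:
  fixes F :: "'k::field_char_0 pol3"
  assumes "homogeneous 1 F"
  shows "\<exists>a b c. F = const3 a * var_x + const3 b * var_y + const3 c * var_z"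
proof -
  obtain A B C where "homogeneous 0 A" "homogeneous 0 B" "homogeneous 0 C"
    "F = var_x * A + var_y * B + var_z * C" using homogeneous_Suc_decomp[of 0 F] assms by auto
  then show ?thesis unfolding homogeneous_zero_iff by (metis mult.commute)
qed

lemma quadratic_form:
  fixes F :: "'k::field_char_0 pol3"
  assumes "homogeneous 2 F"
  shows "\<exists>a b c d e f. F = const3 a * var_x ^ 2 + const3 b * var_y ^ 2 + const3 c * var_z ^ 2 +
    const3 d * (var_x * var_y) + const3 e * (var_x * var_z) + const3 f * (var_y * var_z)"
proof -
  obtain A B C where *: "homogeneous 1 A" "homogeneous 1 B" "homogeneous 1 C"
    "F = var_x * A + var_y * B + var_z * C" using homogeneous_Suc_decomp[of 1 F] assms by auto
  obtain a1 a2 a3 b1 b2 b3 c1 c2 c3 where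
    "A = const3 a1 * var_x + const3 a2 * var_y + const3 a3 * var_z"
    "B = const3 b1 * var_x + const3 b2 * var_y + const3 b3 * var_z"
    "C = const3 c1 * var_x + const3 c2 * var_y + const3 c3 * var_z"
    using *(1-3)[THEN linear_form] by blast
  then have "F = const3 a1 * var_x ^ 2 + const3 b2 * var_y ^ 2 + const3 c3 * var_z ^ 2 +
    const3 (a2 + b1) * (var_x * var_y) + const3 (a3 + c1) * (var_x * var_z) + const3 (b3 + c2) * (var_y * var_z)"
    using * by (simp add: const3_hom power2_eq_square algebra_simps)
  then show ?thesis by blast
qed

lemma cubic_form:
  fixes F :: "'k::field_char_0 pol3"
  assumes "homogeneous 3 F"
  shows "\<exists>a b c d e f g h i j. F = const3 a * var_x ^ 3 + const3 b * (var_x ^ 2 * var_y)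
    + const3 c * (var_x * var_y ^ 2) + const3 d * var_y ^ 3
    + const3 e * (var_x ^ 2 * var_z) + const3 f * (var_x * var_y * var_z) + const3 g * (var_y ^ 2 * var_z)
    + const3 h * (var_x * var_z ^ 2) + const3 i * (var_y * var_z ^ 2) + const3 j * var_z ^ 3"
proof -
  obtain A B C where *: "homogeneous 2 A" "homogeneous 2 B" "homogeneous 2 C"
    "F = var_x * A + var_y * B + var_z * C" using homogeneous_Suc_decomp[of 2 F] assms by auto
  obtain a1 a2 a3 a4 a5 a6 where
    A: "A = const3 a1 * var_x ^ 2 + const3 a2 * var_y ^ 2 + const3 a3 * var_z ^ 2 +
    const3 a4 * (var_x * var_y) + const3 a5 * (var_x * var_z) + const3 a6 * (var_y * var_z)"
    using quadratic_form[OF *(1)] by blast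
  obtain b1 b2 b3 b4 b5 b6 where
    B: "B = const3 b1 * var_x ^ 2 + const3 b2 * var_y ^ 2 + const3 b3 * var_z ^ 2 +
    const3 b4 * (var_x * var_y) + const3 b5 * (var_x * var_z) + const3 b6 * (var_y * var_z)"
    using quadratic_form[OF *(2)] by blast
  obtain c1 c2 c3 c4 c5 c6 where
    C: "C = const3 c1 * var_x ^ 2 + const3 c2 * var_y ^ 2 + const3 c3 * var_z ^ 2 +
    const3 c4 * (var_x * var_y) + const3 c5 * (var_x * var_z) + const3 c6 * (var_y * var_z)"
    using quadratic_form[OF *(3)] by blast
  have "F = const3 a1 * var_x ^ 3 + const3 (a4 + b1) * (var_x ^ 2 * var_y)
    + const3 (a2 + b4) * (var_x * var_y ^ 2) + const3 b2 * var_y ^ 3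
    + const3 (a5 + c1) * (var_x ^ 2 * var_z) + const3 (a6 + b5 + c4) * (var_x * var_y * var_z)
    + const3 (b6 + c2) * (var_y ^ 2 * var_z)
    + const3 (a3 + c5) * (var_x * var_z ^ 2) + const3 (b3 + c6) * (var_y * var_z ^ 2) + const3 c3 * var_z ^ 3"
    unfolding *(4) A B C by (simp add: const3_hom power2_eq_square power3_eq_cube algebra_simps)
  then show ?thesis by blast
qed

lemma homogeneous_not_unit:
  fixes F :: "'k::comm_ring_1 pol3"
  assumes "homogeneous n F" "n > 0"
  shows "\<not> F dvd 1"
proof
  assume "F dvd 1"
  then obtain G where G: "1 = G * F" by (metis dvdE mult.commute)
  have "hom_comp 0 (1 :: 'k pol3) = 1"
    using hom_comp_homogeneous[OF homogeneous_const3[of 1], of 0] by simp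
  moreover have "hom_comp 0 (G * F) = 0"
    using hom_comp_mult[OF assms(1), of 0 G] homogeneous_neg[of "- n" "hom_comp (- n) G"] assms(2) by simp
  ultimately show False using G by simp
qed

lemma irreducible_no_linear_factor:
  fixes L :: "'k::idom pol3"
  assumes "Factorial_Ring.irreducible (L * G)" "homogeneous 1 L" "homogeneous 2 G"
  shows False
  using assms homogeneous_not_unit[of 1 L] homogeneous_not_unit[of 2 G]
  by (auto simp: Factorial_Ring.irreducible_def)

text \<open>\<open>jacobian_bracket a b c\<close> is the determinant of the three linear forms. The
  inverse substitution is recorded on both sides because irreducibility has to be transported
  through it.\<close>

definition linear_change :: "'k::idom pol3 \<Rightarrow> 'k pol3 \<Rightarrow> 'k pol3 \<Rightarrow> bool" where
  "linear_change a b c \<longleftrightarrow>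
     homogeneous 1 a \<and> homogeneous 1 b \<and> homogeneous 1 c \<and> jacobian_bracket a b c \<noteq> 0 \<and>
     (\<exists>a' b' c'. subst3 a' b' c' a = var_x \<and> subst3 a' b' c' b = var_y \<and> subst3 a' b' c' c = var_z \<and>
        subst3 a b c a' = var_x \<and> subst3 a b c b' = var_y \<and> subst3 a b c c' = var_z)"

text \<open>Gradients transform by the matrix M of partial derivatives of the new coordinates. If
  fields are transformed by its cofactor matrix N, both the product with the gradient and the
  divergence are multiplied by the constant d = det M, so both conditions on V survive.\<close>

lemma tame_linear_change:
  fixes \<Omega> :: "'k::field_char_0 pol3"
  assumes L: "linear_change a b c" and g: "tame (subst3 a b c \<Omega>)"
  shows "tame \<Omega>"
proof -
  let ?\<phi> = "subst3 a b c"
  have hom: "homogeneous 1 a" "homogeneous 1 b" "homogeneous 1 c" and det: "jacobian_bracket a b c \<noteq> 0"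
    using L by (auto simp: linear_change_def)
  obtain a' b' c' where "subst3 a' b' c' a = var_x" "subst3 a' b' c' b = var_y" "subst3 a' b' c' c = var_z"
    using L by (auto simp: linear_change_def)
  then obtain h where h: "alg_hom h" and h\<phi>: "\<And>F. h (?\<phi> F) = F"
    by (intro that[OF alg_hom_subst3[of a' b' c']]) (simp add: subst3_subst3)
  note hs = alg_hom_simps[OF h]
  have c: "\<exists>k. partial_x F = const3 k" "\<exists>k. partial_y F = const3 k" "\<exists>k. partial_z F = const3 k"
    if "homogeneous 1 F" for F :: "'k pol3"
    using homogeneous_partial[OF that] by (simp_all add: homogeneous_zero_iff)
  define m11 m12 m13 m21 m22 m23 m31 m32 m33 where m_def:
    "m11 = partial_x a" "m12 = partial_x b" "m13 = partial_x c"
    "m21 = partial_y a" "m22 = partial_y b" "m23 = partial_y c"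
    "m31 = partial_z a" "m32 = partial_z b" "m33 = partial_z c"
  have m: "\<exists>k. m11 = const3 k" "\<exists>k. m12 = const3 k" "\<exists>k. m13 = const3 k"
    "\<exists>k. m21 = const3 k" "\<exists>k. m22 = const3 k" "\<exists>k. m23 = const3 k"
    "\<exists>k. m31 = const3 k" "\<exists>k. m32 = const3 k" "\<exists>k. m33 = const3 k"
    unfolding m_def using c hom by blast+
  then have pm [simp]: "partial_x m11 = 0" "partial_x m12 = 0" "partial_x m13 = 0"
    "partial_x m21 = 0" "partial_x m22 = 0" "partial_x m23 = 0"
    "partial_x m31 = 0" "partial_x m32 = 0" "partial_x m33 = 0"
    "partial_y m11 = 0" "partial_y m12 = 0" "partial_y m13 = 0"
    "partial_y m21 = 0" "partial_y m22 = 0" "partial_y m23 = 0"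
    "partial_y m31 = 0" "partial_y m32 = 0" "partial_y m33 = 0"
    "partial_z m11 = 0" "partial_z m12 = 0" "partial_z m13 = 0"
    "partial_z m21 = 0" "partial_z m22 = 0" "partial_z m23 = 0"
    "partial_z m31 = 0" "partial_z m32 = 0" "partial_z m33 = 0"
    by (metis partial_const)+
  \<comment> \<open>The cofactors of the matrix m.\<close>
  define n11 n12 n13 n21 n22 n23 n31 n32 n33 where n_def:
    "n11 = m22 * m33 - m23 * m32" "n12 = m23 * m31 - m21 * m33" "n13 = m21 * m32 - m22 * m31"
    "n21 = m13 * m32 - m12 * m33" "n22 = m11 * m33 - m13 * m31" "n23 = m12 * m31 - m11 * m32"
    "n31 = m12 * m23 - m13 * m22" "n32 = m13 * m21 - m11 * m23" "n33 = m11 * m22 - m12 * m21"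
  have pn: "partial_x n11 = 0" "partial_x n12 = 0" "partial_x n13 = 0"
    "partial_y n21 = 0" "partial_y n22 = 0" "partial_y n23 = 0"
    "partial_z n31 = 0" "partial_z n32 = 0" "partial_z n33 = 0"
    by (simp_all add: n_def partial_mult)
  define d where "d = m11 * n11 + m12 * n12 + m13 * n13"
  have "d = jacobian_bracket a b c"
    by (simp add: d_def n_def m_def jacobian_bracket_def algebra_simps)
  moreover have "homogeneous 0 d"
    using m unfolding d_def n_def
    by (auto intro!: homogeneous_add homogeneous_diff homogeneous_mult[where l = 0] homogeneous_const3)
  ultimately obtain k where k: "d = const3 k" "k \<noteq> 0"
    using det by (auto simp: homogeneous_zero_iff)
  define di where "di = const3 (inverse k)"
  have di: "di * d = 1" using k by (simp add: di_def flip: const3_hom)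
  define g1 g2 g3 where "g1 = ?\<phi> (partial_x \<Omega>)" and "g2 = ?\<phi> (partial_y \<Omega>)" and "g3 = ?\<phi> (partial_z \<Omega>)"
  note g_def = g1_def g2_def g3_def
  have p\<Omega>: "partial_x (?\<phi> \<Omega>) = g1 * m11 + g2 * m12 + g3 * m13"
    "partial_y (?\<phi> \<Omega>) = g1 * m21 + g2 * m22 + g3 * m23"
    "partial_z (?\<phi> \<Omega>) = g1 * m31 + g2 * m32 + g3 * m33"
    by (simp_all add: chain_rule g_def m_def)
  have 1: "\<Omega> dvd F"
    if "\<Omega> dvd F * partial_x \<Omega>" "\<Omega> dvd F * partial_y \<Omega>" "\<Omega> dvd F * partial_z \<Omega>" for F
  proof -
    have dv: "?\<phi> \<Omega> dvd ?\<phi> G" if "\<Omega> dvd G" for G using that by auto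
    have "?\<phi> \<Omega> dvd ?\<phi> F * g1" "?\<phi> \<Omega> dvd ?\<phi> F * g2" "?\<phi> \<Omega> dvd ?\<phi> F * g3"
      using that[THEN dv] by (simp_all add: g_def)
    then have "?\<phi> \<Omega> dvd ?\<phi> F * partial_x (?\<phi> \<Omega>)" "?\<phi> \<Omega> dvd ?\<phi> F * partial_y (?\<phi> \<Omega>)"
      "?\<phi> \<Omega> dvd ?\<phi> F * partial_z (?\<phi> \<Omega>)"
      unfolding p\<Omega> distrib_left mult.assoc[symmetric] by (simp_all add: dvd_add dvd_mult2)
    then have "?\<phi> \<Omega> dvd ?\<phi> F" using g unfolding tame_def by blast
    then have "h (?\<phi> \<Omega>) dvd h (?\<phi> F)" by (auto simp only: dvd_def hs)
    then show ?thesis by (simp only: h\<phi>)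
  qed
  have 2: "\<exists>W1 W2 W3. V1 = W2 * partial_z \<Omega> - W3 * partial_y \<Omega> \<and>
           V2 = W3 * partial_x \<Omega> - W1 * partial_z \<Omega> \<and> V3 = W1 * partial_y \<Omega> - W2 * partial_x \<Omega>"
    if E: "V1 * partial_x \<Omega> + V2 * partial_y \<Omega> + V3 * partial_z \<Omega> = 0"
      and D: "partial_x V1 + partial_y V2 + partial_z V3 = 0" for V1 V2 V3
  proof -
    define v1 v2 v3 where "v1 = ?\<phi> V1" and "v2 = ?\<phi> V2" and "v3 = ?\<phi> V3"
    have E': "v1 * g1 + v2 * g2 + v3 * g3 = 0"
      using arg_cong[OF E, of ?\<phi>] by (simp add: g_def v1_def v2_def v3_def)
    have D': "?\<phi> (partial_x V1) + ?\<phi> (partial_y V2) + ?\<phi> (partial_z V3) = 0"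
      using arg_cong[OF D, of ?\<phi>] by simp
    define u1 u2 u3 where u_def: "u1 = n11 * v1 + n12 * v2 + n13 * v3"
      "u2 = n21 * v1 + n22 * v2 + n23 * v3" "u3 = n31 * v1 + n32 * v2 + n33 * v3"
    have "u1 * (g1 * m11 + g2 * m12 + g3 * m13) + u2 * (g1 * m21 + g2 * m22 + g3 * m23)
       + u3 * (g1 * m31 + g2 * m32 + g3 * m33) = d * (v1 * g1 + v2 * g2 + v3 * g3)"
      by (simp add: u_def n_def d_def algebra_simps)
    then have e1: "u1 * partial_x (?\<phi> \<Omega>) + u2 * partial_y (?\<phi> \<Omega>) + u3 * partial_z (?\<phi> \<Omega>) = 0"
      unfolding p\<Omega> E' by simp
    have "partial_x u1 + partial_y u2 + partial_z u3 =
        d * (?\<phi> (partial_x V1) + ?\<phi> (partial_y V2) + ?\<phi> (partial_z V3))"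
      unfolding u_def v1_def v2_def v3_def partial_add partial_mult pn chain_rule m_def[symmetric]
      by (simp add: n_def d_def algebra_simps)
    then have e2: "partial_x u1 + partial_y u2 + partial_z u3 = 0" unfolding D' by simp
    from g e1 e2 obtain W1 W2 W3 where
      W: "u1 = W2 * (g1 * m31 + g2 * m32 + g3 * m33) - W3 * (g1 * m21 + g2 * m22 + g3 * m23)"
      "u2 = W3 * (g1 * m11 + g2 * m12 + g3 * m13) - W1 * (g1 * m31 + g2 * m32 + g3 * m33)"
      "u3 = W1 * (g1 * m21 + g2 * m22 + g3 * m23) - W2 * (g1 * m11 + g2 * m12 + g3 * m13)"
      unfolding tame_def p\<Omega> by metis
    \<comment> \<open>N^T W, chosen because M^T sends the cross product of W and M g to the cross
      product of N^T W and g.\<close>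
    define w1 w2 w3 where w_def: "w1 = n11 * W1 + n21 * W2 + n31 * W3"
      "w2 = n12 * W1 + n22 * W2 + n32 * W3" "w3 = n13 * W1 + n23 * W2 + n33 * W3"
    have "d * v1 = m11 * u1 + m21 * u2 + m31 * u3" "d * v2 = m12 * u1 + m22 * u2 + m32 * u3"
      "d * v3 = m13 * u1 + m23 * u2 + m33 * u3"
      by (simp_all add: u_def n_def d_def algebra_simps)
    moreover have "m11 * u1 + m21 * u2 + m31 * u3 = w2 * g3 - w3 * g2"
      "m12 * u1 + m22 * u2 + m32 * u3 = w3 * g1 - w1 * g3"
      "m13 * u1 + m23 * u2 + m33 * u3 = w1 * g2 - w2 * g1"
      unfolding W w_def n_def by (simp_all add: algebra_simps)
    ultimately have "di * d * v1 = di * (w2 * g3 - w3 * g2)" "di * d * v2 = di * (w3 * g1 - w1 * g3)"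
      "di * d * v3 = di * (w1 * g2 - w2 * g1)"
      by (simp_all add: mult.assoc)
    then have "v1 = di * (w2 * g3 - w3 * g2)" "v2 = di * (w3 * g1 - w1 * g3)" "v3 = di * (w1 * g2 - w2 * g1)"
      unfolding di by simp_all
    then have "h v1 = h (di * (w2 * g3 - w3 * g2))" "h v2 = h (di * (w3 * g1 - w1 * g3))"
      "h v3 = h (di * (w1 * g2 - w2 * g1))" by simp_all
    then have "V1 = h (di * w2) * partial_z \<Omega> - h (di * w3) * partial_y \<Omega>"
      "V2 = h (di * w3) * partial_x \<Omega> - h (di * w1) * partial_z \<Omega>"
      "V3 = h (di * w1) * partial_y \<Omega> - h (di * w2) * partial_x \<Omega>"
      unfolding hs v1_def v2_def v3_def g_def h\<phi> by (simp_all add: algebra_simps)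
    then show ?thesis by blast
  qed
  show ?thesis unfolding tame_def using 1 2 by blast
qed

lemma irreducible_linear_change:
  fixes \<Omega> :: "'k::idom pol3"
  assumes L: "linear_change a b c" and irr: "Factorial_Ring.irreducible \<Omega>"
  shows "Factorial_Ring.irreducible (subst3 a b c \<Omega>)"
proof -
  obtain h where h: "alg_hom h" and hs: "\<And>F. h (subst3 a b c F) = F" and sh: "\<And>F. subst3 a b c (h F) = F"
  proof -
    obtain a' b' c' where "subst3 a' b' c' a = var_x" "subst3 a' b' c' b = var_y" "subst3 a' b' c' c = var_z"
      "subst3 a b c a' = var_x" "subst3 a b c b' = var_y" "subst3 a b c c' = var_z"
      using L by (auto simp: linear_change_def)
    then show ?thesis
      by (intro that[OF alg_hom_subst3[of a' b' c']]) (simp_all add: subst3_subst3)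
  qed
  have unit: "subst3 a b c F dvd 1" if "F dvd 1" for F
    using that by (metis dvdE dvdI subst3_simps(2,5))
  have unit': "h F dvd 1" if "F dvd 1" for F
    using that by (metis dvdE dvdI alg_hom_simps(2,5)[OF h])
  show ?thesis
    unfolding Factorial_Ring.irreducible_def
  proof (intro conjI allI impI)
    show "subst3 a b c \<Omega> \<noteq> 0" using irr hs[of \<Omega>] by (auto simp: alg_hom_simps[OF h])
    show "\<not> subst3 a b c \<Omega> dvd 1" 
      using irr unit'[of "subst3 a b c \<Omega>"] unfolding hs Factorial_Ring.irreducible_def by blast
    fix F G assume "subst3 a b c \<Omega> = F * G"
    then have "\<Omega> = h F * h G" using hs[of \<Omega>] by (simp add: alg_hom_simps[OF h])
    then have "h F dvd 1 \<or> h G dvd 1" using irr by (auto simp: Factorial_Ring.irreducible_def)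
    then show "F dvd 1 \<or> G dvd 1" using unit[of "h F"] unit[of "h G"] by (auto simp: sh)
  qed
qed

text \<open>Swaps, a shear carrying (0 : 0 : 1) to (p : q : 1), two shears between x and y, and a
  change of z by which z Q absorbs the terms of K divisible by Q.\<close>

lemma linear_changes:
  fixes p q r :: "'k::field_char_0"
  shows "linear_change var_y var_x (var_z :: 'k pol3)"
    and "linear_change var_z var_y (var_x :: 'k pol3)"
    and "linear_change var_x var_z (var_y :: 'k pol3)"
    and "linear_change (var_x + const3 p * var_z) (var_y + const3 q * var_z) var_z"
    and "linear_change (var_x + const3 p * var_y) var_y var_z"
    and "linear_change var_x (var_y + const3 p * var_x) var_z"
    and "r \<noteq> 0 \<Longrightarrow> linear_change var_x var_y (const3 r * var_z + const3 p * var_x + const3 q * var_y)"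
proof -
  note hom = homogeneous_var homogeneous_add homogeneous_const_mult
  show "linear_change var_y var_x (var_z :: 'k pol3)"
    unfolding linear_change_def
    by (intro conjI hom exI[of _ var_y] exI[of _ var_x] exI[of _ var_z]) (simp_all add: jacobian_bracket_def)
  show "linear_change var_z var_y (var_x :: 'k pol3)"
    unfolding linear_change_def
    by (intro conjI hom exI[of _ var_z] exI[of _ var_y] exI[of _ var_x]) (simp_all add: jacobian_bracket_def)
  show "linear_change var_x var_z (var_y :: 'k pol3)"
    unfolding linear_change_def
    by (intro conjI hom exI[of _ var_x] exI[of _ var_z] exI[of _ var_y]) (simp_all add: jacobian_bracket_def)
  show "linear_change (var_x + const3 p * var_z) (var_y + const3 q * var_z) var_z"
    unfolding linear_change_def
    by (intro conjI hom exI[of _ "var_x - const3 p * var_z"] exI[of _ "var_y - const3 q * var_z"] exI[of _ var_z])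
      (simp_all add: jacobian_bracket_def partial_mult)
  show "linear_change (var_x + const3 p * var_y) var_y var_z"
    unfolding linear_change_def
    by (intro conjI hom exI[of _ "var_x - const3 p * var_y"] exI[of _ "var_y"] exI[of _ var_z])
      (simp_all add: jacobian_bracket_def partial_mult)
  show "linear_change var_x (var_y + const3 p * var_x) var_z"
    unfolding linear_change_def
    by (intro conjI hom exI[of _ "var_y - const3 p * var_x"] exI[of _ "var_x"] exI[of _ var_z])
      (simp_all add: jacobian_bracket_def partial_mult)
  assume r: "r \<noteq> 0"
  then have ri: "const3 r * (const3 (inverse r) * F) = F" "const3 (inverse r) * (const3 r * F) = F" for F
    by (simp_all flip: mult.assoc const3_hom)
  show "linear_change var_x var_y (const3 r * var_z + const3 p * var_x + const3 q * var_y)"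
    unfolding linear_change_def using r
    by (intro conjI hom exI[of _ var_x] exI[of _ var_y]
          exI[of _ "const3 (inverse r) * (var_z - const3 p * var_x - const3 q * var_y)"])
      (simp_all add: jacobian_bracket_def partial_mult ri)
qed

section \<open>Singular cubics\<close>

text \<open>With its singular point at \<open>(0 : 0 : 1)\<close>, a cubic has the form \<open>z Q(x, y) + K(x, y)\<close>.\<close>

definition binary_cubic :: "'k::comm_ring_1 \<Rightarrow> 'k \<Rightarrow> 'k \<Rightarrow> 'k \<Rightarrow> 'k pol3" where
  "binary_cubic a b c d = const3 a * var_x ^ 3 + const3 b * (var_x ^ 2 * var_y)
    + const3 c * (var_x * var_y ^ 2) + const3 d * var_y ^ 3"

definition binary_quadric :: "'k::comm_ring_1 \<Rightarrow> 'k \<Rightarrow> 'k \<Rightarrow> 'k pol3" where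
  "binary_quadric a b c = const3 a * var_x ^ 2 + const3 b * (var_x * var_y) + const3 c * var_y ^ 2"

lemmas binary_defs = binary_cubic_def binary_quadric_def

lemma homogeneous_mult_11:
  "homogeneous 1 F \<Longrightarrow> homogeneous 1 G \<Longrightarrow> homogeneous 2 (F * G :: 'k::comm_ring_1 pol3)"
  using homogeneous_mult'[of 1 F 1 G] by (simp only: one_add_one)

lemmas hom_intros = homogeneous_var homogeneous_add homogeneous_const_mult homogeneous_mult_11

lemma homogeneous_binary_quadric: "homogeneous 2 (binary_quadric a b c :: 'k::comm_ring_1 pol3)"
  unfolding binary_quadric_def power2_eq_square by (intro hom_intros)

lemma cubic_root:
  fixes a b c d :: "'k::alg_closed_field"
  assumes "a \<noteq> 0"
  shows "\<exists>t. a * t ^ 3 + b * t ^ 2 + c * t + d = 0"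
proof -
  have "\<exists>t. poly [:d, c, b, a:] t = 0"
    using assms by (intro alg_closed_imp_poly_has_root) simp
  then show ?thesis by (simp add: algebra_simps power2_eq_square power3_eq_cube)
qed

lemma quadratic_root:
  fixes a b c :: "'k::alg_closed_field"
  assumes "a \<noteq> 0"
  shows "\<exists>t. a * t ^ 2 + b * t + c = 0"
proof -
  have "\<exists>t. poly [:c, b, a:] t = 0"
    using assms by (intro alg_closed_imp_poly_has_root) simp
  then show ?thesis by (simp add: algebra_simps power2_eq_square)
qed

text \<open>A binary form over an algebraically closed field has a linear factor: y if a = 0,
  otherwise one given by a root. This excludes Q = 0 in the normal form z Q + K.\<close>

lemma binary_cubic_reducible:
  fixes a b c d :: "'k::{alg_closed_field, field_char_0}"
  shows "\<not> Factorial_Ring.irreducible (binary_cubic a b c d)"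
proof
  assume irr: "Factorial_Ring.irreducible (binary_cubic a b c d)"
  show False
  proof (cases "a = 0")
    case True
    then have "binary_cubic a b c d = var_y * binary_quadric b c d"
      by (simp add: binary_defs power2_eq_square power3_eq_cube algebra_simps)
    then show False
      using irr irreducible_no_linear_factor homogeneous_var(2) homogeneous_binary_quadric by metis
  next
    case False
    then obtain t where t: "a * t ^ 3 + b * t ^ 2 + c * t + d = 0" using cubic_root by blast
    \<comment> \<open>Division with remainder by x - t y; the remainder is the value at t times
      y^3.\<close>
    have "binary_cubic a b c d = (var_x + const3 (- t) * var_y) *
        binary_quadric a (b + a * t) (c + b * t + a * t ^ 2)
        + const3 (a * t ^ 3 + b * t ^ 2 + c * t + d) * var_y ^ 3"
      by (simp add: binary_defs const3_hom const3_power power2_eq_square power3_eq_cube algebra_simps)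
    then have "binary_cubic a b c d = (var_x + const3 (- t) * var_y) *
        binary_quadric a (b + a * t) (c + b * t + a * t ^ 2)" by (simp add: t)
    moreover have "homogeneous 1 (var_x + const3 (- t) * var_y)" by (intro hom_intros)
    ultimately show False
      using irr irreducible_no_linear_factor homogeneous_binary_quadric by metis
  qed
qed

lemma tame_change:
  fixes \<Omega> :: "'k::field_char_0 pol3"
  assumes "linear_change a b c" "subst3 a b c \<Omega> = \<Omega>'" "Factorial_Ring.irreducible \<Omega>"
    and "Factorial_Ring.irreducible \<Omega>' \<Longrightarrow> tame \<Omega>'"
  shows "tame \<Omega>"
  using assms tame_linear_change irreducible_linear_change by blast

text \<open>The tangent cone consists of two lines, the node. Replacing z by (z - b x - c y) / e
  removes x^2 y and x y^2; irreducibility keeps both remaining cubes.\<close>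

lemma tame_singular_xy:
  fixes a b c d e :: "'k::{alg_closed_field, field_char_0}"
  assumes e: "e \<noteq> 0" and irr: "Factorial_Ring.irreducible (var_z * binary_quadric 0 e 0 + binary_cubic a b c d)"
  shows "tame (var_z * binary_quadric 0 e 0 + binary_cubic a b c d)"
proof (rule tame_change[OF linear_changes(7) _ irr])
  define r where "r = inverse e"
  have er: "e * r = 1" using e by (simp add: r_def)
  show "r \<noteq> 0" using e by (simp add: r_def)
  let ?\<Omega> = "var_x * var_y * var_z + const3 a * var_x ^ 3 + const3 d * var_y ^ 3 :: 'k pol3"
  have "subst3 var_x var_y (const3 r * var_z + const3 (- b * r) * var_x + const3 (- c * r) * var_y)
      (var_z * binary_quadric 0 e 0 + binary_cubic a b c d) =
    const3 (e * r) * (var_x * var_y * var_z - const3 b * (var_x ^ 2 * var_y) - const3 c * (var_x * var_y ^ 2))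
      + binary_cubic a b c d"
    by (simp add: binary_defs const3_hom power2_eq_square power3_eq_cube algebra_simps)
  also have "\<dots> = ?\<Omega>" by (simp add: er binary_defs)
  finally show "subst3 var_x var_y (const3 r * var_z + const3 (- b * r) * var_x + const3 (- c * r) * var_y)
      (var_z * binary_quadric 0 e 0 + binary_cubic a b c d) = ?\<Omega>" .
  assume irr': "Factorial_Ring.irreducible ?\<Omega>"
  have "a \<noteq> 0"
  proof
    assume "a = 0"
    then have "?\<Omega> = var_y * (var_x * var_z + const3 d * (var_y * var_y))"
      by (simp add: power3_eq_cube algebra_simps)
    moreover have "homogeneous 2 (var_x * var_z + const3 d * (var_y * var_y))"
      by (intro hom_intros)
    ultimately show False using irr' irreducible_no_linear_factor homogeneous_var(2) by metis
  qed
  moreover have "d \<noteq> 0"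
  proof
    assume "d = 0"
    then have "?\<Omega> = var_x * (var_y * var_z + const3 a * (var_x * var_x))"
      by (simp add: power3_eq_cube algebra_simps)
    moreover have "homogeneous 2 (var_y * var_z + const3 a * (var_x * var_x))"
      by (intro hom_intros)
    ultimately show False using irr' irreducible_no_linear_factor homogeneous_var(1) by metis
  qed
  ultimately show "tame ?\<Omega>" by (rule tame_node)
qed

text \<open>The tangent cone is a double line, the cusp. Irreducibility gives d \<noteq> 0, so a
  shear of y removes x y^2, and a change of z absorbs the multiples of x^2.\<close>

lemma tame_singular_xx:
  fixes a b c d e :: "'k::{alg_closed_field, field_char_0}"
  assumes e: "e \<noteq> 0" and irr: "Factorial_Ring.irreducible (var_z * binary_quadric e 0 0 + binary_cubic a b c d)"
  shows "tame (var_z * binary_quadric e 0 0 + binary_cubic a b c d)"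
proof -
  have d: "d \<noteq> 0"
  proof
    assume "d = 0"
    then have "var_z * binary_quadric e 0 0 + binary_cubic a b c d =
        var_x * (const3 e * (var_x * var_z) + binary_quadric a b c)"
      by (simp add: binary_defs power2_eq_square power3_eq_cube algebra_simps)
    moreover have "homogeneous 2 (const3 e * (var_x * var_z) + binary_quadric a b c)"
      by (intro hom_intros homogeneous_binary_quadric)
    ultimately show False using irr irreducible_no_linear_factor homogeneous_var(1) by metis
  qed
  \<comment> \<open>Completing the cube in y.\<close>
  define t where "t = - c / (3 * d)"
  have t: "3 * d * t + c = 0" using d by (simp add: t_def)
  define a' b' where "a' = a + b * t + c * t ^ 2 + d * t ^ 3" and "b' = b + 2 * c * t + 3 * d * t ^ 2"
  define r where "r = inverse e"
  have er: "e * r = 1" using e by (simp add: r_def)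
  show ?thesis
  proof (rule tame_change[OF linear_changes(6) _ irr])
    have "subst3 var_x (var_y + const3 t * var_x) var_z (var_z * binary_quadric e 0 0 + binary_cubic a b c d)
        = var_z * binary_quadric e 0 0 + binary_cubic a' b' (3 * d * t + c) d"
      by (simp add: binary_defs a'_def b'_def const3_hom const3_power const3_numeral power2_eq_square
          power3_eq_cube algebra_simps)
    then show "subst3 var_x (var_y + const3 t * var_x) var_z (var_z * binary_quadric e 0 0 + binary_cubic a b c d)
        = var_z * binary_quadric e 0 0 + binary_cubic a' b' 0 d" by (simp add: t)
    assume irr': "Factorial_Ring.irreducible (var_z * binary_quadric e 0 0 + binary_cubic a' b' 0 d)"
    show "tame (var_z * binary_quadric e 0 0 + binary_cubic a' b' 0 d)"
    proof (rule tame_change[OF linear_changes(7) _ irr'])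
      show "r \<noteq> 0" using e by (simp add: r_def)
      have "subst3 var_x var_y (const3 r * var_z + const3 (- a' * r) * var_x + const3 (- b' * r) * var_y)
          (var_z * binary_quadric e 0 0 + binary_cubic a' b' 0 d) =
        const3 (e * r) * (var_x ^ 2 * var_z - const3 a' * var_x ^ 3 - const3 b' * (var_x ^ 2 * var_y))
          + binary_cubic a' b' 0 d"
        by (simp add: binary_defs const3_hom power2_eq_square power3_eq_cube algebra_simps)
      also have "\<dots> = var_x ^ 2 * var_z + const3 d * var_y ^ 3" by (simp add: er binary_defs)
      finally show "subst3 var_x var_y (const3 r * var_z + const3 (- a' * r) * var_x + const3 (- b' * r) * var_y)
          (var_z * binary_quadric e 0 0 + binary_cubic a' b' 0 d) =
          var_x ^ 2 * var_z + const3 d * var_y ^ 3" .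
      show "tame (var_x ^ 2 * var_z + const3 d * var_y ^ 3)" by (rule tame_cusp[OF d])
    qed
  qed
qed

text \<open>Case distinction on the tangent cone Q. A root of Q or a swap of x and y makes Q
  divisible by x; if the other factor is independent of x, it is moved to y.\<close>

lemma tame_singular:
  fixes a b c d e f g :: "'k::{alg_closed_field, field_char_0}"
  assumes irr: "Factorial_Ring.irreducible (var_z * binary_quadric e f g + binary_cubic a b c d)"
  shows "tame (var_z * binary_quadric e f g + binary_cubic a b c d)"
proof -
  have *: "tame (var_z * binary_quadric e f 0 + binary_cubic a b c d)"
    if irr: "Factorial_Ring.irreducible (var_z * binary_quadric e f 0 + binary_cubic a b c d)" for a b c d e f :: 'k
  proof (cases "f = 0")
    case True
    have "e \<noteq> 0" using irr binary_cubic_reducible[of a b c d] True by (auto simp: binary_quadric_def)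
    then show ?thesis using tame_singular_xx irr True by blast
  next
    case False
    define t where "t = - e / f"
    have t: "e + f * t = 0" using False by (simp add: t_def)
    show ?thesis
    proof (rule tame_change[OF linear_changes(6) _ irr])
      define a' b' c' where "a' = a + b * t + c * t ^ 2 + d * t ^ 3"
        and "b' = b + 2 * c * t + 3 * d * t ^ 2" and "c' = 3 * d * t + c"
      have "subst3 var_x (var_y + const3 t * var_x) var_z (var_z * binary_quadric e f 0 + binary_cubic a b c d)
          = var_z * binary_quadric (e + f * t) f 0 + binary_cubic a' b' c' d"
        by (simp add: binary_defs a'_def b'_def c'_def const3_hom const3_power const3_numeral power2_eq_square
            power3_eq_cube algebra_simps)
      then show "subst3 var_x (var_y + const3 t * var_x) var_z (var_z * binary_quadric e f 0 + binary_cubic a b c d)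
          = var_z * binary_quadric 0 f 0 + binary_cubic a' b' c' d" by (simp add: t)
      show "tame (var_z * binary_quadric 0 f 0 + binary_cubic a' b' c' d)"
        if "Factorial_Ring.irreducible (var_z * binary_quadric 0 f 0 + binary_cubic a' b' c' d)"
        using tame_singular_xy False that by blast
    qed
  qed
  consider "g = 0" | "g \<noteq> 0" "e = 0" | "e \<noteq> 0" by blast
  then show ?thesis
  proof cases
    case 1
    then show ?thesis using * irr by blast
  next
    case 2
    show ?thesis
    proof (rule tame_change[OF linear_changes(1) _ irr *])
      show "subst3 var_y var_x var_z (var_z * binary_quadric e f g + binary_cubic a b c d) =
          var_z * binary_quadric g f 0 + binary_cubic d c b a"
        using 2 by (simp add: binary_defs algebra_simps)
    qed
  next
    case 3
    then obtain t where t: "e * t ^ 2 + f * t + g = 0" using quadratic_root by blast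
    show ?thesis
    proof (rule tame_change[OF linear_changes(5) _ irr *])
      define b' c' d' where "b' = b + 3 * a * t"
        and "c' = c + 2 * b * t + 3 * a * t ^ 2" and "d' = d + c * t + b * t ^ 2 + a * t ^ 3"
      have "subst3 (var_x + const3 t * var_y) var_y var_z (var_z * binary_quadric e f g + binary_cubic a b c d)
          = var_z * binary_quadric e (f + 2 * e * t) (e * t ^ 2 + f * t + g) + binary_cubic a b' c' d'"
        by (simp add: binary_defs b'_def c'_def d'_def const3_hom const3_power const3_numeral power2_eq_square
            power3_eq_cube algebra_simps)
      then show "subst3 (var_x + const3 t * var_y) var_y var_z (var_z * binary_quadric e f g + binary_cubic a b c d)
          = var_z * binary_quadric e (f + 2 * e * t) 0 + binary_cubic a b' c' d'" by (simp add: t)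
    qed
  qed
qed

definition critical_point :: "'k::idom pol3 \<Rightarrow> 'k \<Rightarrow> 'k \<Rightarrow> 'k \<Rightarrow> bool" where
  "critical_point \<Omega> p q r \<longleftrightarrow>
     subst3 (const3 p) (const3 q) (const3 r) (partial_x \<Omega>) = 0 \<and>
     subst3 (const3 p) (const3 q) (const3 r) (partial_y \<Omega>) = 0 \<and>
     subst3 (const3 p) (const3 q) (const3 r) (partial_z \<Omega>) = 0"

lemma tame_critical_z:
  fixes \<Omega> :: "'k::{alg_closed_field, field_char_0} pol3"
  assumes hom: "homogeneous 3 \<Omega>" and irr: "Factorial_Ring.irreducible \<Omega>" and cr: "critical_point \<Omega> 0 0 1"
  shows "tame \<Omega>"
proof -
  obtain a b c d e f g h i j where \<Omega>: "\<Omega> = const3 a * var_x ^ 3 + const3 b * (var_x ^ 2 * var_y)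
    + const3 c * (var_x * var_y ^ 2) + const3 d * var_y ^ 3
    + const3 e * (var_x ^ 2 * var_z) + const3 f * (var_x * var_y * var_z) + const3 g * (var_y ^ 2 * var_z)
    + const3 h * (var_x * var_z ^ 2) + const3 i * (var_y * var_z ^ 2) + const3 j * var_z ^ 3"
    using cubic_form[OF hom] by blast
  \<comment> \<open>The partial derivatives at (0, 0, 1) are h, i and 3 j.\<close>
  have "h = 0" "i = 0" "j = 0"
    using cr unfolding critical_point_def \<Omega> by (simp_all add: partial_mult partial_power)
  then have "\<Omega> = var_z * binary_quadric e f g + binary_cubic a b c d"
    unfolding \<Omega> by (simp add: binary_defs algebra_simps)
  then show ?thesis using tame_singular irr by simp
qed

lemma tame_critical_1:
  fixes \<Omega> :: "'k::{alg_closed_field, field_char_0} pol3"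
  assumes hom: "homogeneous 3 \<Omega>" and irr: "Factorial_Ring.irreducible \<Omega>" and cr: "critical_point \<Omega> p q 1"
  shows "tame \<Omega>"
proof (rule tame_change[OF linear_changes(4) refl irr])
  let ?\<Omega> = "subst3 (var_x + const3 p * var_z) (var_y + const3 q * var_z) var_z \<Omega>"
  assume "Factorial_Ring.irreducible ?\<Omega>"
  moreover have "homogeneous 3 ?\<Omega>"
    using homogeneous_subst3[of 3 \<Omega>] hom by (simp add: hom_intros)
  moreover have "critical_point ?\<Omega> 0 0 1"
    using cr unfolding critical_point_def by (simp add: chain_rule subst3_subst3 partial_mult)
  ultimately show "tame ?\<Omega>" by (intro tame_critical_z)
qed

text \<open>The partial derivatives are quadratic forms, so scaling a point multiplies their values
  by s^2. This normalises a nonzero coordinate to 1.\<close>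

lemma critical_point_scale:
  fixes \<Omega> :: "'k::field_char_0 pol3"
  assumes hom: "homogeneous 3 \<Omega>" and cr: "critical_point \<Omega> p q r"
  shows "critical_point \<Omega> (s * p) (s * q) (s * r)"
proof -
  have "subst3 (const3 (s * p)) (const3 (s * q)) (const3 (s * r)) F =
      const3 (s ^ 2) * subst3 (const3 p) (const3 q) (const3 r) F" if F: "homogeneous 2 F" for F
  proof -
    obtain a b c d e f where F: "F = const3 a * var_x ^ 2 + const3 b * var_y ^ 2 + const3 c * var_z ^ 2 +
      const3 d * (var_x * var_y) + const3 e * (var_x * var_z) + const3 f * (var_y * var_z)"
      using quadratic_form[OF F] by blast
    show ?thesis unfolding F by (simp add: const3_hom const3_power power2_eq_square algebra_simps)
  qed
  then show ?thesis
    using cr homogeneous_partial[OF hom] by (simp add: critical_point_def)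
qed

lemma tame_critical:
  fixes \<Omega> :: "'k::{alg_closed_field, field_char_0} pol3"
  assumes hom: "homogeneous 3 \<Omega>" and irr: "Factorial_Ring.irreducible \<Omega>"
    and cr: "critical_point \<Omega> p q r" and nz: "p \<noteq> 0 \<or> q \<noteq> 0 \<or> r \<noteq> 0"
  shows "tame \<Omega>"
proof -
  have *: "tame \<Omega>" if "homogeneous 3 \<Omega>" "Factorial_Ring.irreducible \<Omega>" "critical_point \<Omega> p q r" "r \<noteq> 0"
    for \<Omega> :: "'k pol3" and p q r
    using critical_point_scale[OF that(1,3), of "inverse r"] that tame_critical_1 by simp
  consider "r \<noteq> 0" | "q \<noteq> 0" | "p \<noteq> 0" using nz by blast
  then show ?thesis
  proof cases
    case 1
    then show ?thesis using * hom irr cr by blast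
  next
    case 2
    show ?thesis
    proof (rule tame_change[OF linear_changes(3) refl irr])
      show "tame (subst3 var_x var_z var_y \<Omega>)" if "Factorial_Ring.irreducible (subst3 var_x var_z var_y \<Omega>)"
      proof (rule *[OF _ that _ 2])
        show "homogeneous 3 (subst3 var_x var_z var_y \<Omega>)"
          using homogeneous_subst3[of 3 \<Omega>] hom by (simp add: hom_intros)
        show "critical_point (subst3 var_x var_z var_y \<Omega>) p r q"
          using cr unfolding critical_point_def by (simp add: chain_rule subst3_subst3)
      qed
    qed
  next
    case 3
    show ?thesis
    proof (rule tame_change[OF linear_changes(2) refl irr])
      show "tame (subst3 var_z var_y var_x \<Omega>)" if "Factorial_Ring.irreducible (subst3 var_z var_y var_x \<Omega>)"
      proof (rule *[OF _ that _ 3])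
        show "homogeneous 3 (subst3 var_z var_y var_x \<Omega>)"
          using homogeneous_subst3[of 3 \<Omega>] hom by (simp add: hom_intros)
        show "critical_point (subst3 var_z var_y var_x \<Omega>) r q p"
          using cr unfolding critical_point_def by (simp add: chain_rule subst3_subst3)
      qed
    qed
  qed
qed

section \<open>A Nullstellensatz for three quadrics\<close>

definition ideal3 :: "'a::comm_ring_1 \<Rightarrow> 'a \<Rightarrow> 'a \<Rightarrow> 'a set" where
  "ideal3 f g h = {A * f + B * g + C * h |A B C. True}"

lemma ideal3_gens: "f \<in> ideal3 f g h" "g \<in> ideal3 f g h" "h \<in> ideal3 f g h"
proof -
  have "f = 1 * f + 0 * g + 0 * h" "g = 0 * f + 1 * g + 0 * h" "h = 0 * f + 0 * g + 1 * h" by simp_all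
  then show "f \<in> ideal3 f g h" "g \<in> ideal3 f g h" "h \<in> ideal3 f g h"
    unfolding ideal3_def by blast+
qed

lemma ideal3_add: "u \<in> ideal3 f g h \<Longrightarrow> v \<in> ideal3 f g h \<Longrightarrow> u + v \<in> ideal3 f g h"
proof -
  assume "u \<in> ideal3 f g h" "v \<in> ideal3 f g h"
  then obtain A B C A' B' C' where "u = A * f + B * g + C * h" "v = A' * f + B' * g + C' * h"
    unfolding ideal3_def by blast
  then have "u + v = (A + A') * f + (B + B') * g + (C + C') * h" by (simp add: algebra_simps)
  then show ?thesis unfolding ideal3_def by blast
qed

lemma ideal3_mult: "u \<in> ideal3 f g h \<Longrightarrow> w * u \<in> ideal3 f g h"
proof -
  assume "u \<in> ideal3 f g h"
  then obtain A B C where "u = A * f + B * g + C * h" unfolding ideal3_def by blast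
  then have "w * u = (w * A) * f + (w * B) * g + (w * C) * h" by (simp add: algebra_simps)
  then show ?thesis unfolding ideal3_def by blast
qed

lemma ideal3_zero: "0 \<in> ideal3 f g h"
  using ideal3_mult[OF ideal3_gens(1), of 0] by simp

lemma ideal3_diff: "u \<in> ideal3 f g h \<Longrightarrow> v \<in> ideal3 f g h \<Longrightarrow> u - v \<in> ideal3 f g h"
  using ideal3_add[of u f g h "- 1 * v"] ideal3_mult[of v f g h "- 1"] by simp

lemma ideal3_sum: "(\<And>i. i \<in> S \<Longrightarrow> u i \<in> ideal3 f g h) \<Longrightarrow> sum u S \<in> ideal3 f g h"
  by (induction S rule: infinite_finite_induct) (auto intro: ideal3_add ideal3_zero)

lemma ideal3_hom_comp:
  fixes f g h :: "'k::comm_ring_1 pol3"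
  assumes "homogeneous n f" "homogeneous n g" "homogeneous n h" "u \<in> ideal3 f g h"
  shows "hom_comp i u \<in> ideal3 f g h"
proof -
  obtain A B C where "u = A * f + B * g + C * h" using assms(4) unfolding ideal3_def by blast
  then have "hom_comp i u = hom_comp (i - n) A * f + hom_comp (i - n) B * g + hom_comp (i - n) C * h"
    using assms(1-3) by (simp add: hom_comp_add hom_comp_mult)
  then show ?thesis unfolding ideal3_def by blast
qed

text \<open>Nullstellensatz in one variable: closure under constants and under the shift makes I an
  ideal, an element of least degree divides all others, and one of its roots is a common
  root.\<close>

lemma poly_ideal_root:
  fixes I :: "'k::alg_closed_field poly set"
  assumes zero: "0 \<in> I" and add: "\<And>p q. p \<in> I \<Longrightarrow> q \<in> I \<Longrightarrow> p + q \<in> I"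
    and smult: "\<And>c p. p \<in> I \<Longrightarrow> Polynomial.smult c p \<in> I" and shift: "\<And>p. p \<in> I \<Longrightarrow> pCons 0 p \<in> I"
    and one: "1 \<notin> I"
  shows "\<exists>\<beta>. \<forall>p\<in>I. poly p \<beta> = 0"
proof (cases "I = {0}")
  case False
  have mult: "q * p \<in> I" if "p \<in> I" for p q
  proof (induction q)
    case (pCons a q)
    then show ?case using add[OF smult[OF that] shift] by simp
  qed (simp add: zero)
  obtain p where p: "p \<in> I" "p \<noteq> 0" and min: "\<And>q. q \<in> I \<Longrightarrow> q \<noteq> 0 \<Longrightarrow> degree p \<le> degree q"
    using False zero ex_has_least_nat[of "\<lambda>p. p \<in> I \<and> p \<noteq> 0" _ degree] by blast
  have "degree p > 0"
  proof (rule ccontr)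
    assume "\<not> degree p > 0"
    then obtain c where c: "p = [:c:]" by (metis degree_eq_zeroE not_gr_zero)
    then have "Polynomial.smult (inverse c) p = 1" using p(2) by (simp add: one_pCons)
    then show False using smult[OF p(1)] one by metis
  qed
  then obtain \<beta> where \<beta>: "poly p \<beta> = 0" using alg_closed_imp_poly_has_root by blast
  have "poly q \<beta> = 0" if "q \<in> I" for q
  proof -
    have "q mod p = q + (- (q div p)) * p" by (simp add: minus_div_mult_eq_mod)
    then have "q mod p \<in> I" using add[OF that mult[OF p(1)]] by metis
    then have "q mod p = 0" using min degree_mod_less'[of p q] p(2) by (metis linorder_not_le)
    then have "q = q div p * p" by (metis add.right_neutral div_mult_mod_eq)
    then have "poly q \<beta> = poly (q div p) \<beta> * poly p \<beta>" by (metis poly_mult)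
    then show ?thesis using \<beta> by simp
  qed
  then show ?thesis by blast
qed simp

section \<open>Elimination of z\<close>

definition z_free :: "'k::zero pol3 \<Rightarrow> bool" where
  "z_free F \<longleftrightarrow> F = [:coeff F 0:]"

lemma z_free_c3: "z_free F \<longleftrightarrow> (\<forall>a b c. c > 0 \<longrightarrow> c3 F a b c = 0)"
proof
  assume "z_free F"
  then show "\<forall>a b c. c > 0 \<longrightarrow> c3 F a b c = 0"
    by (metis c3_def coeff_0 coeff_pCons_Suc gr0_implies_Suc z_free_def)
next
  assume *: "\<forall>a b c. c > 0 \<longrightarrow> c3 F a b c = 0"
  have "coeff F c = 0" if "c > 0" for c
    using * that by (intro poly_eqI) (simp add: c3_def)
  then show "z_free F"
    unfolding z_free_def by (intro poly_eqI) (simp add: coeff_pCons split: nat.splits)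
qed

lemma z_free_pCons [simp]: "z_free [:p:]"
  by (simp add: z_free_def)

lemma z_free_intros:
  fixes F G :: "'k::comm_ring_1 pol3"
  shows "z_free F \<Longrightarrow> z_free G \<Longrightarrow> z_free (F + G)" "z_free F \<Longrightarrow> z_free G \<Longrightarrow> z_free (F - G)"
    "z_free F \<Longrightarrow> z_free G \<Longrightarrow> z_free (F * G)" "z_free (const3 k :: 'k pol3)"
    "z_free (var_x :: 'k pol3)" "z_free (var_y :: 'k pol3)" "z_free (0 :: 'k pol3)" "z_free (1 :: 'k pol3)"
proof -
  have e: "z_free F \<longleftrightarrow> (\<exists>p. F = [:p:])" for F :: "'k pol3"
    unfolding z_free_def by (metis coeff_pCons_0)
  show "z_free F \<Longrightarrow> z_free G \<Longrightarrow> z_free (F + G)" "z_free F \<Longrightarrow> z_free G \<Longrightarrow> z_free (F - G)"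
    "z_free F \<Longrightarrow> z_free G \<Longrightarrow> z_free (F * G)" "z_free (const3 k :: 'k pol3)"
    "z_free (var_x :: 'k pol3)" "z_free (var_y :: 'k pol3)" "z_free (0 :: 'k pol3)" "z_free (1 :: 'k pol3)"
    by (auto simp: e const3_def var_x_def var_y_def one_pCons intro: exI[of _ 0])
qed

text \<open>Restriction to the affine line x = \<beta>, y = 1, with z as the coordinate: the fibre
  of the projection over (\<beta> : 1).\<close>

definition eval_xy :: "'k::comm_ring_1 \<Rightarrow> 'k pol3 \<Rightarrow> 'k poly" where
  "eval_xy \<beta> F = poly (map_poly (\<lambda>r. [:poly (poly r 1) \<beta>:]) F) [:0, 1:]"

lemma eval_xy_simps [simp]:
  fixes \<beta> :: "'k::comm_ring_1"
  shows "eval_xy \<beta> 0 = 0" "eval_xy \<beta> 1 = 1" "eval_xy \<beta> (F + G) = eval_xy \<beta> F + eval_xy \<beta> G"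
    "eval_xy \<beta> (F * G) = eval_xy \<beta> F * eval_xy \<beta> G" "eval_xy \<beta> [:p:] = [:poly (poly p 1) \<beta>:]"
    "eval_xy \<beta> var_z = [:0, 1:]"
proof -
  note * = map_poly_eval_hom[of "\<lambda>r::'k poly poly. [:poly (poly r 1) \<beta>:]"]
  show "eval_xy \<beta> 0 = 0" unfolding eval_xy_def by (rule *(1)) (simp_all add: one_pCons)
  show "eval_xy \<beta> 1 = 1" unfolding eval_xy_def by (rule *(2)) (simp_all add: one_pCons)
  show "eval_xy \<beta> (F + G) = eval_xy \<beta> F + eval_xy \<beta> G"
    unfolding eval_xy_def by (rule *(3)) (simp_all add: one_pCons)
  show "eval_xy \<beta> (F * G) = eval_xy \<beta> F * eval_xy \<beta> G"
    unfolding eval_xy_def by (rule *(4)) (simp_all add: one_pCons)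
  show "eval_xy \<beta> [:p:] = [:poly (poly p 1) \<beta>:]"
    unfolding eval_xy_def by (rule *(5)) (simp_all add: one_pCons)
  show "eval_xy \<beta> var_z = [:0, 1:]"
    unfolding eval_xy_def var_z_def by (rule *(6)) (simp_all add: one_pCons)
qed

lemma eval_xy_const3 [simp]: "eval_xy \<beta> (const3 k) = [:k:]"
  and eval_xy_var_x [simp]: "eval_xy \<beta> var_x = [:\<beta>:]"
  and eval_xy_var_y [simp]: "eval_xy \<beta> var_y = 1"
  unfolding const3_def var_x_def var_y_def eval_xy_simps by (simp_all add: one_pCons)

lemma subst3_eval_xy:
  "subst3 (const3 \<beta>) 1 (const3 \<gamma>) F = const3 (poly (eval_xy \<beta> F) \<gamma>)"
proof (induction F rule: pol3_induct)
  case (add F G)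
  then show ?case by (simp only: subst3_simps eval_xy_simps poly_add const3_hom)
next
  case (mult F G)
  then show ?case by (simp only: subst3_simps eval_xy_simps poly_mult const3_hom)
qed simp_all

lemma monic_quadratic_division:
  fixes s t F :: "'k::comm_ring_1 pol3"
  assumes "z_free s" "z_free t"
  shows "\<exists>q u v. z_free u \<and> z_free v \<and> F = (var_z ^ 2 + s * var_z + t) * q + u * var_z + v"
    (is "\<exists>q u v. ?P F q u v")
proof (induction F rule: pol3_induct)
  case (const k)
  have "?P (const3 k) 0 0 (const3 k)" by (simp add: z_free_intros)
  then show ?case by blast
next
  case x
  have "?P var_x 0 0 var_x" by (simp add: z_free_intros)
  then show ?case by blast
next
  case y
  have "?P var_y 0 0 var_y" by (simp add: z_free_intros)
  then show ?case by blast
next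
  case z
  have "?P var_z 0 1 0" by (simp add: z_free_intros)
  then show ?case by blast
next
  case (add F G)
  then obtain q u v q' u' v' where "?P F q u v" "?P G q' u' v'" by blast
  then have "?P (F + G) (q + q') (u + u') (v + v')"
    by (auto intro: z_free_intros simp: algebra_simps)
  then show ?case by blast
next
  case (mult F G)
  let ?m = "var_z ^ 2 + s * var_z + t"
  obtain q u v q' u' v' where F: "?P F q u v" and G: "?P G q' u' v'" using mult by blast
  have "F * G = ?m * (q * G + (u * var_z + v) * q') + (u * var_z + v) * (u' * var_z + v')"
    using F G by (simp add: algebra_simps)
  also have "(u * var_z + v) * (u' * var_z + v') =
      ?m * (u * u') + (u * v' + v * u' - u * u' * s) * var_z + (v * v' - u * u' * t)"
    by (simp add: algebra_simps power2_eq_square)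
  finally have "F * G = ?m * (q * G + (u * var_z + v) * q' + u * u') +
      (u * v' + v * u' - u * u' * s) * var_z + (v * v' - u * u' * t)"
    by (simp add: algebra_simps)
  moreover have "z_free (u * v' + v * u' - u * u' * s)" "z_free (v * v' - u * u' * t)"
    using F G assms by (intro z_free_intros; simp)+
  ultimately show ?case by blast
qed

lemma degree_bound:
  fixes F :: "'k::comm_ring_1 pol3"
  shows "\<exists>N. \<forall>a b c. c3 F a b c \<noteq> 0 \<longrightarrow> a + b + c \<le> N"
proof (induction F rule: pol3_induct)
  case (const k)
  then show ?case by (auto simp: c3_const3 intro!: exI[of _ 0])
next
  case x
  then show ?case using homogeneous_var(1)[where 'k='k] unfolding homogeneous_c3
    by (intro exI[of _ 1]) (metis of_nat_1 of_nat_eq_iff order_refl)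
next
  case y
  then show ?case using homogeneous_var(2)[where 'k='k] unfolding homogeneous_c3
    by (intro exI[of _ 1]) (metis of_nat_1 of_nat_eq_iff order_refl)
next
  case z
  then show ?case using homogeneous_var(3)[where 'k='k] unfolding homogeneous_c3
    by (intro exI[of _ 1]) (metis of_nat_1 of_nat_eq_iff order_refl)
next
  case (add F G)
  then obtain M N where "\<forall>a b c. c3 F a b c \<noteq> 0 \<longrightarrow> a + b + c \<le> M" "\<forall>a b c. c3 G a b c \<noteq> 0 \<longrightarrow> a + b + c \<le> N"
    by blast
  then have "\<forall>a b c. c3 (F + G) a b c \<noteq> 0 \<longrightarrow> a + b + c \<le> M + N"
    by (metis add.right_neutral c3_simps(2) trans_le_add1 trans_le_add2)
  then show ?case by blast
next
  case (mult F G)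
  then obtain M N where M: "\<forall>a b c. c3 F a b c \<noteq> 0 \<longrightarrow> a + b + c \<le> M"
    and N: "\<forall>a b c. c3 G a b c \<noteq> 0 \<longrightarrow> a + b + c \<le> N" by blast
  have "a + b + c \<le> M + N" if FG: "c3 (F * G) a b c \<noteq> 0" for a b c
  proof -
    obtain a' b' c' where *: "a' \<le> a" "b' \<le> b" "c' \<le> c" "c3 F a' b' c' \<noteq> 0"
      "c3 G (a - a') (b - b') (c - c') \<noteq> 0" using FG by (rule c3_mult_nonzero)
    then have "a' + b' + c' \<le> M" "(a - a') + (b - b') + (c - c') \<le> N" using M N by blast+
    then show ?thesis using *(1-3) by linarith
  qed
  then show ?case by blast
qed

lemma hom_comp_sum:
  fixes F :: "'k::comm_ring_1 pol3"
  shows "\<exists>N. F = (\<Sum>i\<le>N. hom_comp (int i) F)"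
proof -
  obtain N where N: "\<forall>a b c. c3 F a b c \<noteq> 0 \<longrightarrow> a + b + c \<le> N" using degree_bound by blast
  have s: "c3 (sum f S) a b c = (\<Sum>i\<in>S. c3 (f i) a b c)" for f :: "nat \<Rightarrow> 'k pol3" and S a b c
    by (induction S rule: infinite_finite_induct) simp_all
  have "c3 F a b c = c3 (\<Sum>i\<le>N. hom_comp (int i) F) a b c" for a b c
  proof -
    have "c3 (\<Sum>i\<le>N. hom_comp (int i) F) a b c = (\<Sum>i\<le>N. if i = a + b + c then c3 F a b c else 0)"
      unfolding s by (intro sum.cong) auto
    also have "\<dots> = (if a + b + c \<le> N then c3 F a b c else 0)" by simp
    also have "\<dots> = c3 F a b c" using N by auto
    finally show ?thesis ..
  qed
  then show ?thesis using pol3_eqI by blast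
qed

text \<open>Setting y = 1 is injective on binary forms of one degree, since the exponent of x then
  determines that of y.\<close>

lemma z_free_homogeneous_eq_0:
  fixes T :: "'k::comm_ring_1 pol3"
  assumes "homogeneous n T" "z_free T" "poly (coeff T 0) 1 = 0"
  shows "T = 0"
proof (rule pol3_eqI)
  fix a b c
  show "c3 T a b c = c3 0 a b c"
  proof (rule ccontr)
    assume "c3 T a b c \<noteq> c3 0 a b c"
    then have nz: "c3 T a b c \<noteq> 0" by simp
    then have c: "c = 0" using assms(2) unfolding z_free_c3 by (metis not_gr_zero)
    have n: "int (a + b) = n" using assms(1) nz unfolding homogeneous_c3 c by fastforce
    have "0 = coeff (poly (coeff T 0) 1) a" by (simp add: assms(3))
    also have "\<dots> = (\<Sum>i\<le>degree (coeff T 0). c3 T a i 0)"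
      by (simp add: poly_altdef coeff_sum c3_def)
    also have "\<dots> = (\<Sum>i\<le>degree (coeff T 0). if i = b then c3 T a b 0 else 0)"
    proof (intro sum.cong refl)
      fix i
      show "c3 T a i 0 = (if i = b then c3 T a b 0 else 0)"
        using assms(1) n unfolding homogeneous_c3 by fastforce
    qed
    also have "\<dots> = c3 T a b 0"
      using nz c by (auto simp: c3_def) (metis coeff_0 coeff_eq_0 not_le)
    finally show False using nz c by simp
  qed
qed

text \<open>
  Projection from the point \<open>(0 : 0 : 1)\<close>. The norm \<open>v\<^sup>2 - s u v + t u\<^sup>2\<close> of \<open>u z + v\<close> modulo the
  monic quadric \<open>z\<^sup>2 + s z + t\<close> eliminates \<open>z\<close>.
\<close>

lemma nullstellensatz_y:
  fixes f g h :: "'k::{alg_closed_field, field_char_0} pol3"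
  assumes hom: "homogeneous 2 f" "homogeneous 2 g" "homogeneous 2 h"
    and nz: "\<And>p q r. subst3 (const3 p) (const3 q) (const3 r) f = 0 \<Longrightarrow>
      subst3 (const3 p) (const3 q) (const3 r) g = 0 \<Longrightarrow> subst3 (const3 p) (const3 q) (const3 r) h = 0 \<Longrightarrow>
      p = 0 \<and> q = 0 \<and> r = 0"
  shows "\<exists>N. var_y ^ N \<in> ideal3 f g h"
proof -
  let ?J = "ideal3 f g h"
  note gens = ideal3_gens[where f = f and g = g and h = h]
  \<comment> \<open>The centre (0 : 0 : 1) of the projection is no common zero, so some generator
    contains z^2 and can be made monic in z.\<close>
  have "subst3 0 0 1 f \<noteq> 0 \<or> subst3 0 0 1 g \<noteq> 0 \<or> subst3 0 0 1 h \<noteq> 0"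
    using nz[of 0 0 1] by auto
  then obtain G0 where G0: "G0 \<in> ?J" "homogeneous 2 G0" "subst3 0 0 1 G0 \<noteq> 0"
    using hom gens by blast
  obtain a b c d e e' where G0': "G0 = const3 a * var_x ^ 2 + const3 b * var_y ^ 2 + const3 c * var_z ^ 2 +
    const3 d * (var_x * var_y) + const3 e * (var_x * var_z) + const3 e' * (var_y * var_z)"
    using quadratic_form[OF G0(2)] by blast
  have c: "c \<noteq> 0" using G0(3) unfolding G0' by simp
  define i where "i = const3 (inverse c)"
  have ic: "i * const3 c = 1" using c by (simp add: i_def flip: const3_hom)
  define s t where "s = i * (const3 e * var_x + const3 e' * var_y)"
    and "t = i * (const3 a * var_x * var_x + const3 b * var_y * var_y + const3 d * (var_x * var_y))"
  have "z_free i" by (simp add: i_def z_free_intros)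
  then have zf: "z_free s" "z_free t" unfolding s_def t_def by (intro z_free_intros; simp)+
  define G where "G = var_z ^ 2 + s * var_z + t"
  have "i * G0 = i * const3 c * var_z ^ 2 + s * var_z + t"
    by (simp add: G0' s_def t_def algebra_simps power2_eq_square)
  then have GJ: "G \<in> ?J" using ideal3_mult[OF G0(1), of i] by (simp add: G_def ic)
  \<comment> \<open>The elimination ideal of the polynomials free of z, restricted to y = 1. If it
    is proper, it has a root \<beta>, and the fibre over \<beta> leads to a contradiction.\<close>
  define L where "L = {poly (coeff F 0) 1 |F. F \<in> ?J \<and> z_free F}"
  have "1 \<in> L"
  proof (rule ccontr)
    assume "1 \<notin> L"
    have "\<exists>\<beta>. \<forall>p\<in>L. poly p \<beta> = 0"
    proof (rule poly_ideal_root)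
      show "0 \<in> L" unfolding L_def using ideal3_zero z_free_intros(7) by force
      show "p + q \<in> L" if "p \<in> L" "q \<in> L" for p q
      proof -
        obtain F F' where "F \<in> ?J" "z_free F" "p = poly (coeff F 0) 1"
          and "F' \<in> ?J" "z_free F'" "q = poly (coeff F' 0) 1"
          using \<open>p \<in> L\<close> \<open>q \<in> L\<close> unfolding L_def by blast
        then have "F + F' \<in> ?J" "z_free (F + F')" "p + q = poly (coeff (F + F') 0) 1"
          by (simp_all add: ideal3_add z_free_intros)
        then show ?thesis unfolding L_def by blast
      qed
      show "Polynomial.smult k p \<in> L" if "p \<in> L" for p k
      proof -
        obtain F where F: "F \<in> ?J" "z_free F" "p = poly (coeff F 0) 1" using \<open>p \<in> L\<close> unfolding L_def by blast
        have "Polynomial.smult k p = poly (coeff (const3 k * F) 0) 1"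
          using F by (simp add: const3_def)
        then show ?thesis unfolding L_def using F ideal3_mult z_free_intros(3,4) by blast
      qed
      show "pCons 0 p \<in> L" if "p \<in> L" for p
      proof -
        obtain F where F: "F \<in> ?J" "z_free F" "p = poly (coeff F 0) 1" using \<open>p \<in> L\<close> unfolding L_def by blast
        have "pCons 0 p = poly (coeff (var_x * F) 0) 1"
          using F by (simp add: var_x_def)
        then show ?thesis unfolding L_def using F ideal3_mult z_free_intros(3,5) by blast
      qed
    qed fact
    then obtain \<beta> where \<beta>: "\<And>p. p \<in> L \<Longrightarrow> poly p \<beta> = 0" by blast
    have zev: "eval_xy \<beta> F = [:poly (poly (coeff F 0) 1) \<beta>:]" if "z_free F" for F
      using that unfolding z_free_def by (metis eval_xy_simps(5))
    \<comment> \<open>The ideal cut out on the fibre. A common root \<gamma> would make (\<beta>, 1,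
      \<gamma>) a nontrivial common zero, so it contains 1.\<close>
    define M where "M = eval_xy \<beta> ` ?J"
    have "1 \<in> M"
    proof (rule ccontr)
      assume "1 \<notin> M"
      have "\<exists>\<gamma>. \<forall>p\<in>M. poly p \<gamma> = 0"
      proof (rule poly_ideal_root)
        show "0 \<in> M" unfolding M_def using ideal3_zero by force
        show "p + q \<in> M" if "p \<in> M" "q \<in> M" for p q
        proof -
          obtain F F' where "F \<in> ?J" "p = eval_xy \<beta> F" "F' \<in> ?J" "q = eval_xy \<beta> F'"
            using \<open>p \<in> M\<close> \<open>q \<in> M\<close> unfolding M_def by blast
          then have "F + F' \<in> ?J" "p + q = eval_xy \<beta> (F + F')" by (simp_all add: ideal3_add)
          then show ?thesis unfolding M_def by blast
        qed
        show "Polynomial.smult k p \<in> M" if "p \<in> M" for p k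
        proof -
          obtain F where F: "F \<in> ?J" "p = eval_xy \<beta> F" using \<open>p \<in> M\<close> unfolding M_def by blast
          have "Polynomial.smult k p = eval_xy \<beta> (const3 k * F)" using F by simp
          then show ?thesis unfolding M_def using F ideal3_mult by blast
        qed
        show "pCons 0 p \<in> M" if "p \<in> M" for p
        proof -
          obtain F where F: "F \<in> ?J" "p = eval_xy \<beta> F" using \<open>p \<in> M\<close> unfolding M_def by blast
          have "pCons 0 p = eval_xy \<beta> (var_z * F)" using F by simp
          then show ?thesis unfolding M_def using F ideal3_mult by blast
        qed
      qed fact
      then obtain \<gamma> where \<gamma>: "\<And>F. F \<in> ?J \<Longrightarrow> poly (eval_xy \<beta> F) \<gamma> = 0" unfolding M_def by blast
      then have "subst3 (const3 \<beta>) (const3 1) (const3 \<gamma>) F = 0" if "F \<in> ?J" for F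
        using that by (simp add: subst3_eval_xy)
      then show False using nz[of \<beta> 1 \<gamma>] gens by auto
    qed
    then obtain F where F: "F \<in> ?J" "eval_xy \<beta> F = 1" unfolding M_def by auto
    obtain q u v where quv: "z_free u" "z_free v" "F = G * q + u * var_z + v"
      using monic_quadratic_division[OF zf] unfolding G_def by blast
    define u0 v0 s0 t0 where "u0 = poly (poly (coeff u 0) 1) \<beta>" and "v0 = poly (poly (coeff v 0) 1) \<beta>"
      and "s0 = poly (poly (coeff s 0) 1) \<beta>" and "t0 = poly (poly (coeff t 0) 1) \<beta>"
    have "1 = eval_xy \<beta> G * eval_xy \<beta> q + eval_xy \<beta> u * [:0, 1:] + eval_xy \<beta> v"
      unfolding F(2)[symmetric] quv(3) by simp
    then have "1 = [:t0, s0, 1:] * eval_xy \<beta> q + [:0, u0:] + [:v0:]"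
      using zev[OF quv(1)] zev[OF quv(2)] zev[OF zf(1)] zev[OF zf(2)]
      by (simp add: G_def power2_eq_square u0_def v0_def s0_def t0_def)
    then have e: "1 = [:t0, s0, 1:] * eval_xy \<beta> q + [:v0, u0:]"
      by (simp add: add.assoc)
    \<comment> \<open>A nonzero multiple of a monic quadratic has degree at least 2, but this one
      equals 1 minus a linear polynomial. Hence the remainder u z + v restricts to 1 on the
      fibre.\<close>
    have "eval_xy \<beta> q = 0"
    proof (rule ccontr)
      assume q: "eval_xy \<beta> q \<noteq> 0"
      have "degree ([:t0, s0, 1:] * eval_xy \<beta> q) = 2 + degree (eval_xy \<beta> q)"
        using q by (subst degree_mult_eq) auto
      moreover have "[:t0, s0, 1:] * eval_xy \<beta> q = [:1 - v0, - u0:]"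
      proof -
        have "[:t0, s0, 1:] * eval_xy \<beta> q = 1 - [:v0, u0:]" using e by (metis add_diff_cancel_right')
        then show ?thesis by (simp only: one_pCons diff_pCons) simp
      qed
      moreover have "degree [:1 - v0, - u0:] \<le> 1" by simp
      ultimately show False by simp
    qed
    then have uv: "u0 = 0" "v0 = 1" using e by (simp_all add: one_pCons)
    have w: "u * var_z + v \<in> ?J"
      using ideal3_diff[OF F(1) ideal3_mult[OF GJ, of q]] quv(3) by (simp add: mult.commute)
    \<comment> \<open>The norm lies in the ideal and is free of z, so it vanishes at \<beta>; but
      with u = 0 and v = 1 there its value is 1.\<close>
    define R where "R = v * v - s * (u * v) + t * (u * u)"
    have "R = (v - u * s - u * var_z) * (u * var_z + v) + (u * u) * G"
      by (simp add: R_def G_def power2_eq_square algebra_simps)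
    then have "R \<in> ?J" using ideal3_add[OF ideal3_mult[OF w] ideal3_mult[OF GJ]] by simp
    moreover have "z_free R" unfolding R_def using quv zf by (intro z_free_intros)
    ultimately have "poly (poly (coeff R 0) 1) \<beta> = 0" using \<beta> unfolding L_def by blast
    then have "eval_xy \<beta> R = 0" using zev[OF \<open>z_free R\<close>] by simp
    moreover have "eval_xy \<beta> (R + s * (u * v)) = eval_xy \<beta> (v * v + t * (u * u))" by (simp add: R_def)
    ultimately show False
      using zev[OF quv(1)] zev[OF quv(2)] uv by (simp add: u0_def v0_def)
  qed
  then obtain r where r: "r \<in> ?J" "z_free r" "poly (coeff r 0) 1 = 1" unfolding L_def by auto
  obtain N where N: "r = (\<Sum>i\<le>N. hom_comp (int i) r)" using hom_comp_sum by blast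
  \<comment> \<open>r becomes 1 at y = 1. Homogenising it with powers of y stays in the ideal,
    because the ideal is homogeneous, and produces y^N.\<close>
  define S where "S = (\<Sum>i\<le>N. var_y ^ (N - i) * hom_comp (int i) r)"
  have SJ: "S \<in> ?J"
    unfolding S_def using hom r(1) by (intro ideal3_sum ideal3_mult ideal3_hom_comp)
  have z_sum: "z_free (sum u A)" if "\<And>i. i \<in> A \<Longrightarrow> z_free (u i)" for u :: "nat \<Rightarrow> 'k pol3" and A
    using that by (induction A rule: infinite_finite_induct) (auto intro: z_free_intros)
  have z_pow: "z_free (var_y ^ n :: 'k pol3)" for n
    by (induction n) (auto intro: z_free_intros)
  have hz: "z_free (hom_comp n r)" for n using r(2) by (simp add: z_free_c3)
  have "z_free (S - var_y ^ N)"
    unfolding S_def by (intro z_free_intros z_sum z_pow hz)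
  moreover have "homogeneous (int N) (S - var_y ^ N)"
  proof -
    have h_sum: "homogeneous n (sum u A)" if "\<And>i. i \<in> A \<Longrightarrow> homogeneous n (u i)"
      for u :: "nat \<Rightarrow> 'k pol3" and A n
      using that by (induction A rule: infinite_finite_induct) (auto intro: homogeneous_add)
    have p: "homogeneous (int n) (var_y ^ n :: 'k pol3)" for n
      using homogeneous_power[OF homogeneous_var(2), of n] by simp
    show ?thesis unfolding S_def
      by (intro homogeneous_diff h_sum p homogeneous_mult[OF p homogeneous_hom_comp]) auto
  qed
  moreover have "poly (coeff (S - var_y ^ N) 0) 1 = 0"
  proof -
    have pw: "poly (coeff (var_y ^ n) 0) 1 = (1 :: 'k poly)" for n
      by (induction n) (simp_all add: var_y_def coeff_mult)
    have "poly (coeff S 0) 1 = (\<Sum>i\<le>N. poly (coeff (hom_comp (int i) r) 0) 1)"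
      unfolding S_def by (simp add: coeff_sum poly_sum coeff_mult pw)
    also have "\<dots> = poly (coeff r 0) 1"
      by (subst (2) N) (simp add: coeff_sum poly_sum)
    finally show ?thesis using r(3) pw[of N] by simp
  qed
  ultimately have "S - var_y ^ N = 0" by (intro z_free_homogeneous_eq_0)
  then show ?thesis using SJ by auto
qed

section \<open>Smooth cubics\<close>

text \<open>The other two variables reduce to y by swaps; these are involutions, so applying the
  swap again carries ideal membership back.\<close>

lemma nullstellensatz:
  fixes f g h :: "'k::{alg_closed_field, field_char_0} pol3"
  assumes hom: "homogeneous 2 f" "homogeneous 2 g" "homogeneous 2 h"
    and nz: "\<And>p q r. subst3 (const3 p) (const3 q) (const3 r) f = 0 \<Longrightarrow>
      subst3 (const3 p) (const3 q) (const3 r) g = 0 \<Longrightarrow> subst3 (const3 p) (const3 q) (const3 r) h = 0 \<Longrightarrow>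
      p = 0 \<and> q = 0 \<and> r = 0"
  shows "\<exists>N. var_x ^ N \<in> ideal3 f g h" "\<exists>N. var_y ^ N \<in> ideal3 f g h" "\<exists>N. var_z ^ N \<in> ideal3 f g h"
proof -
  show "\<exists>N. var_y ^ N \<in> ideal3 f g h" using nullstellensatz_y[OF hom] nz by blast
  have image: "subst3 a b c u \<in> ideal3 f g h"
    if "u \<in> ideal3 (subst3 a b c f) (subst3 a b c g) (subst3 a b c h)"
      and "\<And>F. subst3 a b c (subst3 a b c F) = F" for a b c u :: "'k pol3"
  proof -
    obtain A B C where "u = A * subst3 a b c f + B * subst3 a b c g + C * subst3 a b c h"
      using \<open>u \<in> _\<close> unfolding ideal3_def by blast
    then have "subst3 a b c u = subst3 a b c A * f + subst3 a b c B * g + subst3 a b c C * h"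
      by (simp add: that(2))
    then show ?thesis unfolding ideal3_def by blast
  qed
  show "\<exists>N. var_x ^ N \<in> ideal3 f g h"
  proof -
    let ?s = "subst3 var_y var_x (var_z :: 'k pol3)"
    have "\<exists>N. var_y ^ N \<in> ideal3 (?s f) (?s g) (?s h)"
    proof (rule nullstellensatz_y)
      show "homogeneous 2 (?s f)" "homogeneous 2 (?s g)" "homogeneous 2 (?s h)"
        using homogeneous_subst3[of 2] hom homogeneous_var by fastforce+
    next
      fix p q r
      assume "subst3 (const3 p) (const3 q) (const3 r) (?s f) = 0"
        "subst3 (const3 p) (const3 q) (const3 r) (?s g) = 0" "subst3 (const3 p) (const3 q) (const3 r) (?s h) = 0"
      then show "p = 0 \<and> q = 0 \<and> r = 0" using nz[of q p r] by (simp add: subst3_subst3)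
    qed
    then obtain N where "var_y ^ N \<in> ideal3 (?s f) (?s g) (?s h)" by blast
    then have "?s (var_y ^ N) \<in> ideal3 f g h" by (rule image) (simp add: subst3_subst3)
    then show ?thesis by auto
  qed
  show "\<exists>N. var_z ^ N \<in> ideal3 f g h"
  proof -
    let ?s = "subst3 var_x var_z (var_y :: 'k pol3)"
    have "\<exists>N. var_y ^ N \<in> ideal3 (?s f) (?s g) (?s h)"
    proof (rule nullstellensatz_y)
      show "homogeneous 2 (?s f)" "homogeneous 2 (?s g)" "homogeneous 2 (?s h)"
        using homogeneous_subst3[of 2] hom homogeneous_var by fastforce+
    next
      fix p q r
      assume "subst3 (const3 p) (const3 q) (const3 r) (?s f) = 0"
        "subst3 (const3 p) (const3 q) (const3 r) (?s g) = 0" "subst3 (const3 p) (const3 q) (const3 r) (?s h) = 0"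
      then show "p = 0 \<and> q = 0 \<and> r = 0" using nz[of p r q] by (simp add: subst3_subst3)
    qed
    then obtain N where "var_y ^ N \<in> ideal3 (?s f) (?s g) (?s h)" by blast
    then have "?s (var_y ^ N) \<in> ideal3 f g h" by (rule image) (simp add: subst3_subst3)
    then show ?thesis by auto
  qed
qed

section \<open>Powers of the variables as a regular sequence\<close>

lemma var_power_cancel:
  fixes F :: "'k::idom pol3"
  assumes "var_x ^ a dvd var_y ^ b * F"
  shows "var_x ^ a dvd F"
  using assms
proof (induction a)
  case (Suc a)
  have "var_x ^ a dvd var_y ^ b * F" using Suc.prems by (auto elim!: dvdE simp: mult.left_commute)
  then obtain G where G: "F = var_x ^ a * G" using Suc.IH by blast
  obtain H where "var_y ^ b * F = var_x ^ Suc a * H" using Suc.prems by blast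
  then have "var_x ^ a * (var_y ^ b * G) = var_x ^ a * (var_x * H)"
    unfolding G by (simp add: algebra_simps)
  then have "var_y ^ b * G = var_x * H" by (metis mult_cancel_left power_not_zero var_neq_0(1))
  then have "var_x dvd var_y ^ b * G" by simp
  then have "var_x dvd G" by (simp add: var_dvd_iff)
  then obtain K where "G = var_x * K" by blast
  then have "F = var_x ^ Suc a * K" unfolding G by (simp add: algebra_simps)
  then show ?case by simp
qed simp

text \<open>z is no zero divisor modulo x^a and y^b: the parts of r and s free of z combine to zero,
  as restriction to z = 0 shows, and the rest is divisible by z.\<close>

lemma var_power_cancel2:
  fixes F :: "'k::idom pol3"
  assumes "var_z ^ c * F = var_x ^ a * r + var_y ^ b * s"
  shows "\<exists>r s. F = var_x ^ a * r + var_y ^ b * s"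
  using assms
proof (induction c arbitrary: r s)
  case (Suc c)
  obtain r' where r: "r = subst3 var_x var_y 0 r + var_z * r'" using subst3_decomp(3) by blast
  obtain s' where s: "s = subst3 var_x var_y 0 s + var_z * s'" using subst3_decomp(3) by blast
  have 0: "0 = var_x ^ a * subst3 var_x var_y 0 r + var_y ^ b * subst3 var_x var_y 0 s"
    using arg_cong[OF Suc.prems, of "subst3 var_x var_y 0"] by simp
  have "var_z ^ Suc c * F = var_x ^ a * (subst3 var_x var_y 0 r + var_z * r')
      + var_y ^ b * (subst3 var_x var_y 0 s + var_z * s')"
    using Suc.prems r s by simp
  also have "\<dots> = (var_x ^ a * subst3 var_x var_y 0 r + var_y ^ b * subst3 var_x var_y 0 s)
      + var_z * (var_x ^ a * r' + var_y ^ b * s')"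
    by (simp add: algebra_simps)
  finally have "var_z * (var_z ^ c * F) = var_z * (var_x ^ a * r' + var_y ^ b * s')"
    unfolding 0[symmetric] by (simp add: mult.assoc)
  then have "var_z ^ c * F = var_x ^ a * r' + var_y ^ b * s'" by (metis mult_cancel_left var_neq_0(3))
  then show ?case by (rule Suc.IH)
qed auto

text \<open>The cofactors satisfy y^b s = x^a t, so the coprimality of the two powers makes x^a
  divide s.\<close>

lemma dvd_var_powers:
  fixes D F :: "'k::idom pol3"
  assumes "D dvd var_x ^ a * F" "D dvd var_y ^ b * F"
  shows "D dvd F"
proof (cases "D = 0")
  case True
  then show ?thesis using assms(1) by simp
next
  case False
  obtain s t where s: "var_x ^ a * F = D * s" and t: "var_y ^ b * F = D * t" using assms by blast
  have "D * (var_y ^ b * s) = var_y ^ b * (var_x ^ a * F)" unfolding s by (simp add: mult.left_commute)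
  also have "\<dots> = D * (var_x ^ a * t)" by (metis mult.left_commute t)
  finally have "var_y ^ b * s = var_x ^ a * t" using False by simp
  then have "var_x ^ a dvd s" by (metis dvd_triv_left var_power_cancel)
  then obtain s' where "s = var_x ^ a * s'" by blast
  then have "var_x ^ a * F = var_x ^ a * (D * s')" unfolding s by (simp add: mult.left_commute)
  then have "F = D * s'" by (metis mult_cancel_left power_not_zero var_neq_0(1))
  then show ?thesis by simp
qed

text \<open>Exactness of the Koszul complex of x^a, y^b, z^c: the third component is reduced modulo
  the first two powers, which leaves a relation between x^a and y^b only.\<close>

lemma var_powers_koszul:
  fixes g1 g2 g3 :: "'k::idom pol3"
  assumes "var_x ^ a * g1 + var_y ^ b * g2 + var_z ^ c * g3 = 0"
  shows "\<exists>p q r. g1 = var_z ^ c * q - var_y ^ b * r \<and> g2 = var_x ^ a * r - var_z ^ c * p \<and>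
    g3 = var_y ^ b * p - var_x ^ a * q"
proof -
  have "var_z ^ c * g3 = var_x ^ a * (- g1) + var_y ^ b * (- g2)"
    using assms by (simp add: eq_neg_iff_add_eq_0 algebra_simps)
  then obtain u p where g3: "g3 = var_x ^ a * u + var_y ^ b * p" using var_power_cancel2 by blast
  have e: "var_x ^ a * (g1 + var_z ^ c * u) + var_y ^ b * (g2 + var_z ^ c * p) = 0"
    using assms unfolding g3 by (simp add: algebra_simps)
  then have e': "var_y ^ b * (g2 + var_z ^ c * p) = var_x ^ a * - (g1 + var_z ^ c * u)"
    by (metis add.commute add_eq_0_iff minus_mult_right)
  then have "var_x ^ a dvd g2 + var_z ^ c * p" by (metis dvd_triv_left var_power_cancel)
  then obtain r where r: "g2 + var_z ^ c * p = var_x ^ a * r" by blast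
  have "var_x ^ a * (g1 + var_z ^ c * u + var_y ^ b * r) = 0"
    using e unfolding r by (simp add: algebra_simps)
  then have "g1 + var_z ^ c * u + var_y ^ b * r = 0" by (metis mult_eq_0_iff power_not_zero var_neq_0(1))
  then have "g1 = var_z ^ c * (- u) - var_y ^ b * r"
    by (simp add: eq_neg_iff_add_eq_0 algebra_simps)
  moreover have "g2 = var_x ^ a * r - var_z ^ c * p" using r by (simp add: algebra_simps)
  moreover have "g3 = var_y ^ b * p - var_x ^ a * (- u)" unfolding g3 by simp
  ultimately show ?thesis by blast
qed

text \<open>Since f2 U1 = f1 U2 and f3 U1 = f1 U3, f1 divides the product of U1 with every element
  of the ideal. That ideal contains powers of x and of y, so f1 divides U1; likewise for the other
  components.\<close>

lemma parallel_multiple: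
  fixes f1 f2 f3 :: "'k::idom pol3"
  assumes J: "var_x ^ a \<in> ideal3 f1 f2 f3" "var_y ^ b \<in> ideal3 f1 f2 f3"
    and par: "U2 * f3 = U3 * f2" "U3 * f1 = U1 * f3" "U1 * f2 = U2 * f1"
  shows "\<exists>g. U1 = g * f1 \<and> U2 = g * f2 \<and> U3 = g * f3"
proof -
  have dvd_J: "D dvd u * F" if "D dvd f1 * F" "D dvd f2 * F" "D dvd f3 * F" "u \<in> ideal3 f1 f2 f3" for D F u
  proof -
    obtain A B C where u: "u = A * f1 + B * f2 + C * f3" using \<open>u \<in> _\<close> unfolding ideal3_def by blast
    show ?thesis unfolding u distrib_right mult.assoc using that(1-3) by (simp add: dvd_add dvd_mult)
  qed
  have dvd: "D dvd F" if "D dvd f1 * F" "D dvd f2 * F" "D dvd f3 * F" for D F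
    using dvd_var_powers dvd_J[OF that J(1)] dvd_J[OF that J(2)] by blast
  have par': "f3 * U2 = f2 * U3" "f1 * U3 = f3 * U1" "f2 * U1 = f1 * U2"
    using par by (simp_all add: mult.commute)
  have "f1 dvd U1" by (rule dvd) (simp_all add: par' flip: par'(2))
  then obtain g1 where g1: "U1 = f1 * g1" by blast
  have "f2 dvd U2" by (rule dvd) (simp_all add: par' flip: par'(3))
  then obtain g2 where g2: "U2 = f2 * g2" by blast
  have "f3 dvd U3" by (rule dvd) (simp_all add: par' flip: par'(1))
  then obtain g3 where g3: "U3 = f3 * g3" by blast
  have "\<not> (f1 = 0 \<and> f2 = 0 \<and> f3 = 0)"
    using J(1) by (auto simp: ideal3_def)
  then consider "f1 \<noteq> 0" | "f2 \<noteq> 0" | "f3 \<noteq> 0" by blast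
  then show ?thesis
  proof cases
    case 1
    have "f1 * U2 = f1 * (g1 * f2)" unfolding par'(3)[symmetric] g1 by (simp only: ac_simps)
    moreover have "f1 * U3 = f1 * (g1 * f3)" unfolding par'(2) g1 by (simp only: ac_simps)
    ultimately have "U2 = g1 * f2" "U3 = g1 * f3" using 1 by (metis mult_cancel_left)+
    then show ?thesis using g1 by (metis mult.commute)
  next
    case 2
    have "f2 * U1 = f2 * (g2 * f1)" unfolding par'(3) g2 by (simp only: ac_simps)
    moreover have "f2 * U3 = f2 * (g2 * f3)" unfolding par'(1)[symmetric] g2 by (simp only: ac_simps)
    ultimately have "U1 = g2 * f1" "U3 = g2 * f3" using 2 by (metis mult_cancel_left)+
    then show ?thesis using g2 by (metis mult.commute)
  next
    case 3
    have "f3 * U1 = f3 * (g3 * f1)" unfolding par'(2)[symmetric] g3 by (simp only: ac_simps)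
    moreover have "f3 * U2 = f3 * (g3 * f2)" unfolding par'(1) g3 by (simp only: ac_simps)
    ultimately have "U1 = g3 * f1" "U2 = g3 * f2" using 3 by (metis mult_cancel_left)+
    then show ?thesis using g3 by (metis mult.commute)
  qed
qed

text \<open>
  The Koszul complex of \<open>f\<close> is exact in the middle because powers of the variables lie in the ideal of
  \<open>f\<close>: an element \<open>x\<^sup>a = A \<cdot> f\<close> of the ideal turns \<open>V \<cdot> f = 0\<close> into \<open>x\<^sup>a V = (A \<times> V) \<times> f\<close>, and the
  resulting three vectors are corrected by multiples of \<open>f\<close> until they are divisible by those powers.
\<close>

lemma koszul_exact:
  fixes f1 f2 f3 :: "'k::idom pol3"
  assumes J: "var_x ^ a \<in> ideal3 f1 f2 f3" "var_y ^ b \<in> ideal3 f1 f2 f3" "var_z ^ c \<in> ideal3 f1 f2 f3"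
    and V: "V1 * f1 + V2 * f2 + V3 * f3 = 0"
  shows "\<exists>W1 W2 W3. V1 = W2 * f3 - W3 * f2 \<and> V2 = W3 * f1 - W1 * f3 \<and> V3 = W1 * f2 - W2 * f1"
proof -
  let ?X = "var_x ^ a :: 'k pol3" and ?Y = "var_y ^ b :: 'k pol3" and ?Z = "var_z ^ c :: 'k pol3"
  have mul: "\<exists>W1 W2 W3. u * V1 = W2 * f3 - W3 * f2 \<and> u * V2 = W3 * f1 - W1 * f3 \<and> u * V3 = W1 * f2 - W2 * f1"
    if "u \<in> ideal3 f1 f2 f3" for u
  proof -
    obtain A B C where u: "u = A * f1 + B * f2 + C * f3" using \<open>u \<in> _\<close> unfolding ideal3_def by blast
    have s: "V1 * f1 = - (V2 * f2 + V3 * f3)" "V2 * f2 = - (V1 * f1 + V3 * f3)" "V3 * f3 = - (V1 * f1 + V2 * f2)"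
      using V by (simp_all add: eq_neg_iff_add_eq_0 algebra_simps)
    have "u * V1 = (C * V1 - A * V3) * f3 - (A * V2 - B * V1) * f2 + A * (V1 * f1 + V2 * f2 + V3 * f3)"
      "u * V2 = (A * V2 - B * V1) * f1 - (B * V3 - C * V2) * f3 + B * (V1 * f1 + V2 * f2 + V3 * f3)"
      "u * V3 = (B * V3 - C * V2) * f2 - (C * V1 - A * V3) * f1 + C * (V1 * f1 + V2 * f2 + V3 * f3)"
      unfolding u by (simp_all add: algebra_simps)
    then show ?thesis unfolding V by (metis add.right_neutral mult_zero_right)
  qed
  obtain P1 P2 P3 where P: "?X * V1 = P2 * f3 - P3 * f2" "?X * V2 = P3 * f1 - P1 * f3" "?X * V3 = P1 * f2 - P2 * f1"
    using mul[OF J(1)] by blast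
  obtain Q1 Q2 Q3 where Q: "?Y * V1 = Q2 * f3 - Q3 * f2" "?Y * V2 = Q3 * f1 - Q1 * f3" "?Y * V3 = Q1 * f2 - Q2 * f1"
    using mul[OF J(2)] by blast
  obtain R1 R2 R3 where R: "?Z * V1 = R2 * f3 - R3 * f2" "?Z * V2 = R3 * f1 - R1 * f3" "?Z * V3 = R1 * f2 - R2 * f1"
    using mul[OF J(3)] by blast
  \<comment> \<open>Two representations of multiples of V, brought to the common multiple s t V,
    differ by a vector whose cross product with f is zero.\<close>
  have par: "\<exists>g. s * N1 - t * M1 = g * f1 \<and> s * N2 - t * M2 = g * f2 \<and> s * N3 - t * M3 = g * f3"
    if M: "s * V1 = M2 * f3 - M3 * f2" "s * V2 = M3 * f1 - M1 * f3" "s * V3 = M1 * f2 - M2 * f1"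
      and N: "t * V1 = N2 * f3 - N3 * f2" "t * V2 = N3 * f1 - N1 * f3" "t * V3 = N1 * f2 - N2 * f1"
    for s t M1 M2 M3 N1 N2 N3
  proof (rule parallel_multiple[OF J(1,2)])
    have "s * (N2 * f3 - N3 * f2) = t * (M2 * f3 - M3 * f2)"
      "s * (N3 * f1 - N1 * f3) = t * (M3 * f1 - M1 * f3)"
      "s * (N1 * f2 - N2 * f1) = t * (M1 * f2 - M2 * f1)"
      unfolding M[symmetric] N[symmetric] by (simp_all add: mult.left_commute)
    then show "(s * N2 - t * M2) * f3 = (s * N3 - t * M3) * f2"
      "(s * N3 - t * M3) * f1 = (s * N1 - t * M1) * f3"
      "(s * N1 - t * M1) * f2 = (s * N2 - t * M2) * f1"
      by (simp_all add: algebra_simps)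
  qed
  obtain g3 where g3: "?X * Q1 - ?Y * P1 = g3 * f1" "?X * Q2 - ?Y * P2 = g3 * f2" "?X * Q3 - ?Y * P3 = g3 * f3"
    using par[OF P Q] by blast
  obtain g1 where g1: "?Y * R1 - ?Z * Q1 = g1 * f1" "?Y * R2 - ?Z * Q2 = g1 * f2" "?Y * R3 - ?Z * Q3 = g1 * f3"
    using par[OF Q R] by blast
  obtain g2 where g2: "?Z * P1 - ?X * R1 = g2 * f1" "?Z * P2 - ?X * R2 = g2 * f2" "?Z * P3 - ?X * R3 = g2 * f3"
    using par[OF R P] by blast
  \<comment> \<open>Cocycle condition for gluing the fractional solutions P / X, Q / Y, R / Z: their
    pairwise differences cancel cyclically, so g f = 0.\<close>
  define g where "g = ?X * g1 + ?Y * g2 + ?Z * g3"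
  have "g * f1 = ?X * (g1 * f1) + ?Y * (g2 * f1) + ?Z * (g3 * f1)"
    "g * f2 = ?X * (g1 * f2) + ?Y * (g2 * f2) + ?Z * (g3 * f2)"
    "g * f3 = ?X * (g1 * f3) + ?Y * (g2 * f3) + ?Z * (g3 * f3)"
    by (simp_all add: g_def algebra_simps)
  then have "g * f1 = 0" "g * f2 = 0" "g * f3 = 0"
    unfolding g1[symmetric] g2[symmetric] g3[symmetric] by (simp_all add: algebra_simps)
  moreover have "\<not> (f1 = 0 \<and> f2 = 0 \<and> f3 = 0)"
    using J(1) by (auto simp: ideal3_def)
  ultimately have "g = 0" by auto
  then obtain p q r where pqr: "g1 = ?Z * q - ?Y * r" "g2 = ?X * r - ?Z * p" "g3 = ?Y * p - ?X * q"
    using var_powers_koszul[of a g1 b g2 c g3] unfolding g_def by blast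
  \<comment> \<open>Now Y (P + p f) = X (Q + q f), so the corrected P is divisible by X.\<close>
  have "\<exists>T. P + p * f = ?X * T" if "?X * Q - ?Y * P = g3 * f" for P Q f
  proof -
    have "?Y * (P + p * f) = ?X * (Q + q * f)"
      using that unfolding pqr by (simp add: algebra_simps)
    then have "?X dvd P + p * f" by (metis dvd_triv_left var_power_cancel)
    then show ?thesis by blast
  qed
  then obtain T1 T2 T3 where T: "P1 + p * f1 = ?X * T1" "P2 + p * f2 = ?X * T2" "P3 + p * f3 = ?X * T3"
    using g3 by meson
  have "?X * V1 = (P2 + p * f2) * f3 - (P3 + p * f3) * f2"
    "?X * V2 = (P3 + p * f3) * f1 - (P1 + p * f1) * f3"
    "?X * V3 = (P1 + p * f1) * f2 - (P2 + p * f2) * f1"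
    unfolding P by (simp_all add: algebra_simps)
  then have "?X * V1 = ?X * (T2 * f3 - T3 * f2)" "?X * V2 = ?X * (T3 * f1 - T1 * f3)"
    "?X * V3 = ?X * (T1 * f2 - T2 * f1)"
    unfolding T by (simp_all add: algebra_simps)
  then have "V1 = T2 * f3 - T3 * f2" "V2 = T3 * f1 - T1 * f3" "V3 = T1 * f2 - T2 * f1"
    by (metis mult_cancel_left power_not_zero var_neq_0(1))+
  then show ?thesis by blast
qed

lemma tame_irreducible_cubic:
  fixes \<Omega> :: "'k::{alg_closed_field, field_char_0} pol3"
  assumes hom: "homogeneous 3 \<Omega>" and irr: "Factorial_Ring.irreducible \<Omega>"
  shows "tame \<Omega>"
proof (cases "\<exists>p q r. critical_point \<Omega> p q r \<and> (p \<noteq> 0 \<or> q \<noteq> 0 \<or> r \<noteq> 0)")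
  case True
  then show ?thesis using tame_critical[OF hom irr] by blast
next
  case False
  let ?J = "ideal3 (partial_x \<Omega>) (partial_y \<Omega>) (partial_z \<Omega>)"
  have hom2: "homogeneous 2 (partial_x \<Omega>)" "homogeneous 2 (partial_y \<Omega>)" "homogeneous 2 (partial_z \<Omega>)"
    using homogeneous_partial[OF hom] by simp_all
  obtain a b c where J: "var_x ^ a \<in> ?J" "var_y ^ b \<in> ?J" "var_z ^ c \<in> ?J"
    using nullstellensatz[OF hom2] False unfolding critical_point_def by blast
  \<comment> \<open>With u a power of x or of y, \<Omega> divides x^a F and y^b F, hence F.\<close>
  have "\<Omega> dvd u * F" if "\<Omega> dvd F * partial_x \<Omega>" "\<Omega> dvd F * partial_y \<Omega>" "\<Omega> dvd F * partial_z \<Omega>"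
    "u \<in> ?J" for F u
  proof -
    obtain A B C where u: "u = A * partial_x \<Omega> + B * partial_y \<Omega> + C * partial_z \<Omega>"
      using \<open>u \<in> _\<close> unfolding ideal3_def by blast
    have "u * F = A * (F * partial_x \<Omega>) + B * (F * partial_y \<Omega>) + C * (F * partial_z \<Omega>)"
      unfolding u by (simp add: algebra_simps)
    then show ?thesis using that(1-3) by (simp add: dvd_add dvd_mult)
  qed
  then have "\<Omega> dvd F" if "\<Omega> dvd F * partial_x \<Omega>" "\<Omega> dvd F * partial_y \<Omega>" "\<Omega> dvd F * partial_z \<Omega>" for F
    using dvd_var_powers that J by metis
  then show ?thesis
    unfolding tame_def using koszul_exact[OF J] by blast
qed

section \<open>Dimensions of vector spaces\<close>

text \<open>Subspaces of type-based vector spaces. Together with \<open>vmod\<close> they connect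
  polynomials with the record-based modules in which cohomology and its dimension are
  stated.\<close>

definition vsub :: "('k::field \<Rightarrow> 'v::ab_group_add \<Rightarrow> 'v) \<Rightarrow> 'v set \<Rightarrow> bool" where
  "vsub s S \<longleftrightarrow> vector_space s \<and> 0 \<in> S \<and> (\<forall>u\<in>S. \<forall>v\<in>S. u + v \<in> S) \<and> (\<forall>c. \<forall>u\<in>S. s c u \<in> S)"

definition vmod :: "('k::field \<Rightarrow> 'v::ab_group_add \<Rightarrow> 'v) \<Rightarrow> 'v set \<Rightarrow> ('k, 'v) module" where
  "vmod s S = \<lparr>carrier = S, monoid.mult = undefined, one = undefined, zero = 0, add = (+), module.smult = s\<rparr>"

definition findim :: "('k::field \<Rightarrow> 'v::ab_group_add \<Rightarrow> 'v) \<Rightarrow> 'v set \<Rightarrow> bool" where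
  "findim s S \<longleftrightarrow> vsub s S \<and> vectorspace.fin_dim class_ring (vmod s S)"

definition sdim :: "('k::field \<Rightarrow> 'v::ab_group_add \<Rightarrow> 'v) \<Rightarrow> 'v set \<Rightarrow> nat" where
  "sdim s S = vectorspace.dim class_ring (vmod s S)"

lemma vmod_simps [simp]:
  "carrier (vmod s S) = S" "\<zero>\<^bsub>vmod s S\<^esub> = 0" "add (vmod s S) = (+)" "module.smult (vmod s S) = s"
  by (simp_all add: vmod_def)

lemma vsubD:
  assumes "vsub s S"
  shows "vector_space s" "0 \<in> S" "u \<in> S \<Longrightarrow> v \<in> S \<Longrightarrow> u + v \<in> S" "u \<in> S \<Longrightarrow> s c u \<in> S"
    "u \<in> S \<Longrightarrow> - u \<in> S"
proof -
  show 1: "vector_space s" "0 \<in> S" "u \<in> S \<Longrightarrow> v \<in> S \<Longrightarrow> u + v \<in> S" "u \<in> S \<Longrightarrow> s c u \<in> S" for c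
    using assms by (auto simp: vsub_def)
  interpret vector_space s by fact
  show "u \<in> S \<Longrightarrow> - u \<in> S" using 1(4)[of "- 1"] by simp
qed

text \<open>Every axiom passes to the image of a linear map. Since M is an arbitrary record, this
  covers the components of cohomology as well as subspaces.\<close>

lemma surj_vectorspace:
  fixes M :: "('k::field, 'w) module"
  assumes S: "vsub s S" and surj: "h ` S = carrier M"
    and h_add: "\<And>u v. u \<in> S \<Longrightarrow> v \<in> S \<Longrightarrow> h (u + v) = h u \<oplus>\<^bsub>M\<^esub> h v"
    and h_smult: "\<And>c u. u \<in> S \<Longrightarrow> h (s c u) = c \<odot>\<^bsub>M\<^esub> h u"
    and h_0: "h 0 = \<zero>\<^bsub>M\<^esub>"
  shows "vectorspace class_ring M"
proof -
  interpret vector_space s using vsubD(1)[OF S] .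
  note S' = vsubD(2-)[OF S]
  show ?thesis
  proof (rule vs_criteria[OF class_field])
    show "\<zero>\<^bsub>M\<^esub> \<in> carrier M" unfolding surj[symmetric] h_0[symmetric] using S'(1) by blast
    show "\<forall>v w. v \<in> carrier M \<and> w \<in> carrier M \<longrightarrow> v \<oplus>\<^bsub>M\<^esub> w \<in> carrier M"
      unfolding surj[symmetric] using S'(2) by (auto simp flip: h_add)
    show "\<forall>v\<in>carrier M. \<exists>neg_v\<in>carrier M. v \<oplus>\<^bsub>M\<^esub> neg_v = \<zero>\<^bsub>M\<^esub>"
    proof
      fix v assume "v \<in> carrier M"
      then obtain u where "u \<in> S" "v = h u" unfolding surj[symmetric] by blast
      then show "\<exists>neg_v\<in>carrier M. v \<oplus>\<^bsub>M\<^esub> neg_v = \<zero>\<^bsub>M\<^esub>"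
        using h_add[of u "- u"] S'(4)[of u] h_0 unfolding surj[symmetric] by (intro bexI[of _ "h (- u)"]) auto
    qed
    show "\<forall>c v. c \<in> carrier class_ring \<and> v \<in> carrier M \<longrightarrow> c \<odot>\<^bsub>M\<^esub> v \<in> carrier M"
      unfolding surj[symmetric] using S'(3) by (auto simp flip: h_smult)
    show "\<forall>v w. v \<in> carrier M \<and> w \<in> carrier M \<longrightarrow> v \<oplus>\<^bsub>M\<^esub> w = w \<oplus>\<^bsub>M\<^esub> v"
      unfolding surj[symmetric] by (auto simp: add.commute simp flip: h_add)
    show "\<forall>v w x. v \<in> carrier M \<and> w \<in> carrier M \<and> x \<in> carrier M \<longrightarrow>
        v \<oplus>\<^bsub>M\<^esub> w \<oplus>\<^bsub>M\<^esub> x = v \<oplus>\<^bsub>M\<^esub> (w \<oplus>\<^bsub>M\<^esub> x)"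
    proof (intro allI impI)
      fix v w x assume "v \<in> carrier M \<and> w \<in> carrier M \<and> x \<in> carrier M"
      then obtain a b c where "a \<in> S" "b \<in> S" "c \<in> S" "v = h a" "w = h b" "x = h c"
        unfolding surj[symmetric] by blast
      then show "v \<oplus>\<^bsub>M\<^esub> w \<oplus>\<^bsub>M\<^esub> x = v \<oplus>\<^bsub>M\<^esub> (w \<oplus>\<^bsub>M\<^esub> x)"
        using S' by (simp flip: h_add add: add.assoc)
    qed
    show "\<forall>v\<in>carrier M. v \<oplus>\<^bsub>M\<^esub> \<zero>\<^bsub>M\<^esub> = v"
      unfolding surj[symmetric] h_0[symmetric] using S'(1) by (auto simp flip: h_add)
    show "\<forall>a b v. a \<in> carrier class_ring \<and> b \<in> carrier class_ring \<and> v \<in> carrier M \<longrightarrow>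
        (a \<otimes>\<^bsub>class_ring\<^esub> b) \<odot>\<^bsub>M\<^esub> v = a \<odot>\<^bsub>M\<^esub> (b \<odot>\<^bsub>M\<^esub> v)"
      unfolding surj[symmetric] using S' by (auto simp flip: h_smult)
    show "\<forall>v\<in>carrier M. \<one>\<^bsub>class_ring\<^esub> \<odot>\<^bsub>M\<^esub> v = v"
      unfolding surj[symmetric] using S' by (auto simp flip: h_smult)
    show "\<forall>a b v. a \<in> carrier class_ring \<and> b \<in> carrier class_ring \<and> v \<in> carrier M \<longrightarrow>
        (a \<oplus>\<^bsub>class_ring\<^esub> b) \<odot>\<^bsub>M\<^esub> v = a \<odot>\<^bsub>M\<^esub> v \<oplus>\<^bsub>M\<^esub> b \<odot>\<^bsub>M\<^esub> v"
      unfolding surj[symmetric] using S' by (auto simp: scale_left_distrib simp flip: h_smult h_add)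
    show "\<forall>a v w. a \<in> carrier class_ring \<and> v \<in> carrier M \<and> w \<in> carrier M \<longrightarrow>
        a \<odot>\<^bsub>M\<^esub> (v \<oplus>\<^bsub>M\<^esub> w) = a \<odot>\<^bsub>M\<^esub> v \<oplus>\<^bsub>M\<^esub> a \<odot>\<^bsub>M\<^esub> w"
      unfolding surj[symmetric] using S' by (auto simp: scale_right_distrib simp flip: h_smult h_add)
  qed
qed

lemma vectorspace_vmod: "vsub s S \<Longrightarrow> vectorspace class_ring (vmod s S)"
  by (rule surj_vectorspace[of s S "\<lambda>u. u"]) auto

lemma surj_rank_nullity:
  fixes M :: "('k::field, 'w) module"
  assumes fin: "findim s S" and surj: "h ` S = carrier M"
    and h_add: "\<And>u v. u \<in> S \<Longrightarrow> v \<in> S \<Longrightarrow> h (u + v) = h u \<oplus>\<^bsub>M\<^esub> h v"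
    and h_smult: "\<And>c u. u \<in> S \<Longrightarrow> h (s c u) = c \<odot>\<^bsub>M\<^esub> h u"
    and h_0: "h 0 = \<zero>\<^bsub>M\<^esub>"
  shows "vectorspace class_ring M" "vectorspace.fin_dim class_ring M"
    "vectorspace.dim class_ring M + sdim s {u \<in> S. h u = \<zero>\<^bsub>M\<^esub>} = sdim s S"
proof -
  have S: "vsub s S" using fin by (simp add: findim_def)
  show M: "vectorspace class_ring M" by (rule surj_vectorspace[OF S surj h_add h_smult h_0])
  have V: "vectorspace class_ring (vmod s S)" by (rule vectorspace_vmod[OF S])
  have "h \<in> LinearCombinations.module_hom class_ring (vmod s S) M"
    unfolding LinearCombinations.module_hom_def using surj h_add h_smult by auto
  then interpret linear_map class_ring "vmod s S" M h
    unfolding linear_map_def mod_hom_def mod_hom_axioms_def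
    using V M by (auto simp: vectorspace_def)
  have fd: "V.fin_dim" using assms(1) by (simp add: findim_def)
  show "vectorspace.fin_dim class_ring M"
    by (rule rank_nullity_main(2)[OF fd]) (simp add: surj)
  have "(vmod s S)\<lparr>carrier := {u \<in> S. h u = \<zero>\<^bsub>M\<^esub>}\<rparr> = vmod s {u \<in> S. h u = \<zero>\<^bsub>M\<^esub>}"
    by (simp add: vmod_def)
  moreover have "M\<lparr>carrier := h ` S\<rparr> = M" by (simp add: surj)
  ultimately show "vectorspace.dim class_ring M + sdim s {u \<in> S. h u = \<zero>\<^bsub>M\<^esub>} = sdim s S"
    using rank_nullity_main(1)[OF fd] by (simp add: mod_hom.im_def mod_hom.ker_def sdim_def)
qed

text \<open>Independent subsets of T stay independent in S, so their size is bounded and a maximal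
  one is a basis.\<close>

lemma findim_subspace:
  assumes fin: "findim s S" and T: "vsub s T" "T \<subseteq> S"
  shows "findim s T"
proof -
  have S: "vsub s S" using fin by (simp add: findim_def)
  interpret V: vectorspace class_ring "vmod s S" by (rule vectorspace_vmod[OF S])
  interpret T: vectorspace class_ring "vmod s T" by (rule vectorspace_vmod[OF T(1)])
  have e: "V.vs T = vmod s T" by (simp add: vmod_def)
  have fd: "V.fin_dim" using fin by (simp add: findim_def)
  have sub: "submodule class_ring T (vmod s S)"
    by (rule submodule.intro) (use T vsubD[OF T(1)] V.module_axioms in auto)
  have small: "finite A \<and> card A \<le> V.dim" if "A \<subseteq> T" "T.lin_indpt A" for A
  proof -
    have "V.lin_indpt A"
      using V.span_li_not_depend(2)[OF that(1) sub] that(2) unfolding e by simp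
    then show ?thesis using V.li_le_dim[OF fd] that(1) T(2) by auto
  qed
  have "\<exists>A. finite A \<and> maximal A (\<lambda>A. A \<subseteq> carrier (vmod s T) \<and> T.lin_indpt A)"
    by (rule maximal_exists[where N = "V.dim" and B = "{}"])
      (use small in \<open>auto simp: T.lin_dep_def\<close>)
  then obtain A where "finite A" "T.basis A"
    using T.max_li_is_basis by blast
  then show ?thesis
    unfolding findim_def T.fin_dim_def T.basis_def using T(1) by blast
qed

lemma rank_nullity_vmod:
  assumes fin: "findim s S" and t: "vector_space t"
    and h_add: "\<And>u v. u \<in> S \<Longrightarrow> v \<in> S \<Longrightarrow> h (u + v) = h u + h v"
    and h_smult: "\<And>c u. u \<in> S \<Longrightarrow> h (s c u) = t c (h u)"
  shows "findim t (h ` S)" "findim s {u \<in> S. h u = 0}" "sdim t (h ` S) + sdim s {u \<in> S. h u = 0} = sdim s S"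
proof -
  have S: "vsub s S" using fin by (simp add: findim_def)
  note S' = vsubD[OF S]
  interpret s: vector_space s using S'(1) .
  interpret t: vector_space t by fact
  have h_0: "h 0 = 0" using h_add[of 0 0] S'(2) by simp
  have im: "vsub t (h ` S)"
    unfolding vsub_def
  proof (intro conjI ballI allI t)
    show "0 \<in> h ` S" using h_0 S'(2) by force
    show "u + v \<in> h ` S" if "u \<in> h ` S" "v \<in> h ` S" for u v
      using that S'(3) by (auto simp flip: h_add)
    show "t c u \<in> h ` S" if "u \<in> h ` S" for c u
      using that S'(4) by (auto simp flip: h_smult)
  qed
  have ker: "vsub s {u \<in> S. h u = 0}"
    unfolding vsub_def using S' h_0 by (auto simp: h_add h_smult)
  show "findim s {u \<in> S. h u = 0}" by (rule findim_subspace[OF fin ker]) auto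
  note * = surj_rank_nullity[OF fin, of h "vmod t (h ` S)", simplified, OF h_add h_smult h_0]
  show "findim t (h ` S)" using *(2) im by (simp add: findim_def)
  show "sdim t (h ` S) + sdim s {u \<in> S. h u = 0} = sdim s S" using *(3) by (simp add: sdim_def)
qed

lemma sdim_zero: "vector_space s \<Longrightarrow> findim s {0}" "vector_space s \<Longrightarrow> sdim s {0} = 0"
proof -
  assume s: "vector_space s"
  interpret vector_space s by fact
  have S: "vsub s {0}" using s by (simp add: vsub_def)
  interpret V: vectorspace class_ring "vmod s {0}" by (rule vectorspace_vmod[OF S])
  have g: "V.gen_set {0}"
    using V.in_own_span[of "{0}"] V.span_is_subset2[of "{0}"] by auto
  then show "findim s {0}" using S by (auto simp: findim_def V.fin_dim_def intro!: exI[of _ "{0}"])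
  show "sdim s {0} = 0" using V.dim0I g by (simp add: sdim_def)
qed

lemma sdim_line:
  assumes s: "vector_space s" and v: "v \<noteq> 0"
  shows "findim s (range (\<lambda>c. s c v))" "sdim s (range (\<lambda>c. s c v)) = 1"
proof -
  let ?L = "range (\<lambda>c. s c v)"
  interpret vector_space s by fact
  have S: "vsub s ?L" unfolding vsub_def
    by (auto simp: s simp flip: scale_left_distrib intro: range_eqI[of _ _ 0])
  interpret V: vectorspace class_ring "vmod s ?L" by (rule vectorspace_vmod[OF S])
  have vL: "v \<in> ?L" by (metis rangeI scale_one)
  have g: "V.gen_set {v}"
  proof
    show "V.span {v} \<subseteq> carrier (vmod s ?L)" by (rule V.span_is_subset2) (use vL in auto)
    show "carrier (vmod s ?L) \<subseteq> V.span {v}"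
    proof
      fix w assume "w \<in> carrier (vmod s ?L)"
      then obtain c where w: "w = s c v" by auto
      have "v \<in> V.span {v}" using V.in_own_span[of "{v}"] vL by auto
      then have "c \<odot>\<^bsub>vmod s ?L\<^esub> v \<in> V.span {v}"
        using submodule.smult_closed[OF V.span_is_submodule[of "{v}"], of c v] vL by simp
      then show "w \<in> V.span {v}" by (simp add: w)
    qed
  qed
  then show "findim s ?L" using S vL by (auto simp: findim_def V.fin_dim_def intro!: exI[of _ "{v}"])
  show "sdim s ?L = 1" using V.dim1I[OF g] v vL by (simp add: sdim_def)
qed

section \<open>Skew-symmetric multiderivations\<close>

type_synonym 'k vec3 = "'k pol3 \<times> 'k pol3 \<times> 'k pol3"

fun app1 :: "'k::idom vec3 \<Rightarrow> 'k pol3 \<Rightarrow> 'k pol3" where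
  "app1 (a, b, c) F = a * partial_x F + b * partial_y F + c * partial_z F"

text \<open>The product of (a, b, c) with the cross product of the gradients of F and G: a bivector
  field written as a vector field.\<close>

fun app2 :: "'k::idom vec3 \<Rightarrow> 'k pol3 \<Rightarrow> 'k pol3 \<Rightarrow> 'k pol3" where
  "app2 (a, b, c) F G =
     a * (partial_y F * partial_z G - partial_z F * partial_y G) +
     b * (partial_z F * partial_x G - partial_x F * partial_z G) +
     c * (partial_x F * partial_y G - partial_y F * partial_x G)"

definition ext0 :: "'k::idom pol3 \<Rightarrow> 'k pol3 list \<Rightarrow> 'k pol3" where
  "ext0 F Fs = (case Fs of [] \<Rightarrow> F | _ \<Rightarrow> 0)"

definition ext1 :: "'k::idom vec3 \<Rightarrow> 'k pol3 list \<Rightarrow> 'k pol3" where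
  "ext1 V Fs = (case Fs of [F] \<Rightarrow> app1 V F | _ \<Rightarrow> 0)"

definition ext2 :: "'k::idom vec3 \<Rightarrow> 'k pol3 list \<Rightarrow> 'k pol3" where
  "ext2 W Fs = (case Fs of [F, G] \<Rightarrow> app2 W F G | _ \<Rightarrow> 0)"

definition ext3 :: "'k::idom pol3 \<Rightarrow> 'k pol3 list \<Rightarrow> 'k pol3" where
  "ext3 H Fs = (case Fs of [F, G, K] \<Rightarrow> H * jacobian_bracket F G K | _ \<Rightarrow> 0)"

lemma ext_simps [simp]:
  "ext0 F [] = F" "ext1 V [F] = app1 V F" "ext2 V [F, G] = app2 V F G"
  "ext3 H [F, G, K] = H * jacobian_bracket F G K"
  by (simp_all add: ext0_def ext1_def ext2_def ext3_def)

lemma ext_length: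
  "length Fs \<noteq> 0 \<Longrightarrow> ext0 F Fs = 0" "length Fs \<noteq> 1 \<Longrightarrow> ext1 V Fs = 0"
  "length Fs \<noteq> 2 \<Longrightarrow> ext2 V Fs = 0" "length Fs \<noteq> 3 \<Longrightarrow> ext3 F Fs = 0"
  by (auto simp: ext0_def ext1_def ext2_def ext3_def split: list.splits)

lemma length_conv:
  "length Fs = 1 \<longleftrightarrow> (\<exists>a. Fs = [a])" "length Fs = 2 \<longleftrightarrow> (\<exists>a b. Fs = [a, b])"
  "length Fs = 3 \<longleftrightarrow> (\<exists>a b c. Fs = [a, b, c])" "length Fs = 4 \<longleftrightarrow> (\<exists>a b c d. Fs = [a, b, c, d])"
  by (auto simp: length_Suc_conv numeral_eq_Suc)

lemma derivationI:
  assumes "\<And>F G. D (F + G) = D F + D G" "\<And>c F. D (const3 c * F) = const3 c * D F"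
    "\<And>F G. D (F * G) = F * D G + G * D F"
  shows "derivation D"
  unfolding derivation_def using assms by blast

lemma derivation_0: "derivation D \<Longrightarrow> D 0 = 0"
  using derivationD(2)[of D 0 0] by simp

lemma derivation_minus: "derivation D \<Longrightarrow> D (- F) = - D F"
  using derivationD(2)[of D "- 1" F] by simp

lemma derivation_app1: "derivation (app1 V)"
  by (cases V) (rule derivationI; simp add: partial_mult algebra_simps)

lemma derivation_app2: "derivation (\<lambda>F. app2 V F G)"
  by (cases V) (rule derivationI; simp add: partial_mult algebra_simps)

lemma app2_skew: "app2 V G F = - app2 V F G"
  by (cases V) (simp add: algebra_simps)

lemma jacobian_bracket_app2:
  "jacobian_bracket \<Omega> F G = app2 (partial_x \<Omega>, partial_y \<Omega>, partial_z \<Omega>) F G"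
  by (simp add: jacobian_bracket_def)

lemma eq_neg_self: "a = - a \<longleftrightarrow> a = (0 :: 'k::field_char_0 pol3)"
proof
  assume "a = - a"
  then have "2 * a = 0" by (metis add.right_inverse mult_2)
  then show "a = 0" by simp
qed simp

text \<open>Skewness carries the derivation property to the second argument and, in characteristic
  zero, makes repeated arguments vanish. Thus q is determined by its values on pairs of distinct
  variables.\<close>

lemma alternating2:
  fixes q :: "'k::field_char_0 pol3 \<Rightarrow> 'k pol3 \<Rightarrow> 'k pol3"
  assumes d: "\<And>G. derivation (\<lambda>F. q F G)" and s: "\<And>F G. q G F = - q F G"
  shows "q F G = app2 (q var_y var_z, q var_z var_x, q var_x var_y) F G"
proof -
  have d': "derivation (q F)" for F
    unfolding s[of _ F, symmetric] s[of F] using derivation_uminus[OF d[of F]] by (simp add: s[of F])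
  have z: "q F F = 0" for F using s[of F F] eq_neg_self by blast
  have "q F G = q var_x G * partial_x F + q var_y G * partial_y F + q var_z G * partial_z F"
    using derivation_formula[OF d] .
  also have "q var_x G = q var_x var_y * partial_y G - q var_z var_x * partial_z G"
    using derivation_formula[OF d', of var_x G] by (simp add: z s[of var_z var_x])
  also have "q var_y G = - q var_x var_y * partial_x G + q var_y var_z * partial_z G"
    using derivation_formula[OF d', of var_y G] by (simp add: z s[of var_x var_y])
  also have "q var_z G = q var_z var_x * partial_x G - q var_y var_z * partial_y G"
    using derivation_formula[OF d', of var_z G] by (simp add: z s[of var_y var_z])
  finally show ?thesis by (simp add: algebra_simps)
qed

lemma alternating3:
  fixes q :: "'k::field_char_0 pol3 \<Rightarrow> 'k pol3 \<Rightarrow> 'k pol3 \<Rightarrow> 'k pol3"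
  assumes d: "\<And>G K. derivation (\<lambda>F. q F G K)" and s: "\<And>F G K. q G F K = - q F G K"
    and s': "\<And>F G K. q F K G = - q F G K"
  shows "q F G K = q var_x var_y var_z * jacobian_bracket F G K"
proof -
  have c: "q F G K = q K F G" for F G K using s[of K F G] s'[of F K G] by simp
  have d3: "derivation (\<lambda>K. q F G K)" for F G unfolding c[of F G] by (rule d)
  have z: "q F F G = 0" "q F G F = 0" "q G F F = 0" for F G
    using s[of F F G] s'[of G F F] eq_neg_self c by metis+
  have "q F G K = app2 (q var_y var_z K, q var_z var_x K, q var_x var_y K) F G"
    by (rule alternating2[OF d s])
  also have "q var_y var_z K = q var_x var_y var_z * partial_x K"
    using derivation_formula[OF d3, of var_y var_z K] by (simp add: z c[of var_y var_z var_x])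
  also have "q var_z var_x K = q var_x var_y var_z * partial_y K"
    using derivation_formula[OF d3, of var_z var_x K] by (simp add: z c[of var_z var_x var_y] c[of var_y var_z var_x])
  also have "q var_x var_y K = q var_x var_y var_z * partial_z K"
    using derivation_formula[OF d3, of var_x var_y K] by (simp add: z)
  finally show ?thesis by (simp add: jacobian_bracket_def algebra_simps)
qed

text \<open>Among four variables chosen from x, y, z two coincide. Hence every 3-derivation will be
  a cocycle.\<close>

lemma alternating4:
  fixes q :: "'k::field_char_0 pol3 \<Rightarrow> 'k pol3 \<Rightarrow> 'k pol3 \<Rightarrow> 'k pol3 \<Rightarrow> 'k pol3"
  assumes d: "\<And>G K L. derivation (\<lambda>F. q F G K L)" and s: "\<And>F G K L. q G F K L = - q F G K L"
    and s': "\<And>F G K L. q F K G L = - q F G K L" and s'': "\<And>F G K L. q F G L K = - q F G K L"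
  shows "q F G K L = 0"
proof -
  have c: "q F G K L = - q L F G K" for F G K L using s[of L F G K] s'[of F L G K] s''[of F G L K] by simp
  have d4: "derivation (\<lambda>L. q F G K L)" for F G K
    unfolding c[of F G K] by (rule derivation_uminus[OF d])
  have z: "q F G K K = 0" "q F G G K = 0" "q F F G K = 0" for F G K
    using s''[of F G K K] s'[of F G G K] s[of F F G K] eq_neg_self by blast+
  have z': "q var_x var_y var_z var_y = 0" "q var_x var_y var_z var_x = 0"
    using s''[of var_x var_y var_y var_z] s''[of var_x var_y var_x var_z] s'[of var_x var_y var_x var_z]
    by (simp_all add: z)
  have "q F G K L = q var_x var_y var_z L * jacobian_bracket F G K"
    by (rule alternating3[OF d s s'])
  also have "q var_x var_y var_z L = 0"
    using derivation_formula[OF d4, of var_x var_y var_z L] by (simp add: z z')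
  finally show ?thesis by simp
qed

lemma unimodular_poisson_unique:
  fixes \<Omega> :: "'k::field_char_0 pol3"
  assumes "unimodular_poisson \<Omega> br"
  shows "br = jacobian_bracket \<Omega>"
proof (intro ext)
  fix F G
  have d: "derivation (\<lambda>F. br F G)" and s: "br G F = - br F G" for F G
    using assms unfolding unimodular_poisson_def poisson_bracket_def by blast+
  have "br F G = app2 (br var_y var_z, br var_z var_x, br var_x var_y) F G"
    by (rule alternating2[OF d s])
  then show "br F G = jacobian_bracket \<Omega> F G"
    using assms by (simp add: unimodular_poisson_def jacobian_bracket_app2)
qed

lemma multiderivationsD:
  assumes "Q \<in> multiderivations q"
  shows "length Fs \<noteq> q \<Longrightarrow> Q Fs = 0"
    "length Fs = q \<Longrightarrow> i < q \<Longrightarrow> derivation (\<lambda>F. Q (Fs[i := F]))"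
    "length Fs = q \<Longrightarrow> i < j \<Longrightarrow> j < q \<Longrightarrow> Q (Fs[i := Fs ! j, j := Fs ! i]) = - Q Fs"
  using assms unfolding multiderivations_def by blast+

lemma multiderivations_0: "multiderivations 0 = range (ext0 :: 'k::field_char_0 pol3 \<Rightarrow> _)"
proof
  show "multiderivations 0 \<subseteq> range (ext0 :: 'k pol3 \<Rightarrow> _)"
  proof
    fix Q :: "'k pol3 list \<Rightarrow> 'k pol3" assume "Q \<in> multiderivations 0"
    then have "Q = ext0 (Q [])"
      by (intro ext) (auto simp: multiderivations_def ext0_def split: list.splits)
    then show "Q \<in> range ext0" by (metis rangeI)
  qed
qed (auto simp: multiderivations_def ext_length)

lemma multiderivations_1: "multiderivations 1 = range (ext1 :: 'k::field_char_0 vec3 \<Rightarrow> _)"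
proof
  show "multiderivations 1 \<subseteq> range (ext1 :: 'k vec3 \<Rightarrow> _)"
  proof
    fix Q :: "'k pol3 list \<Rightarrow> 'k pol3" assume Q: "Q \<in> multiderivations 1"
    have "derivation (\<lambda>F. Q ([0][0 := F]))" by (rule multiderivationsD[OF Q]) simp_all
    then have d: "derivation (\<lambda>F. Q [F])" by simp
    have "Q Fs = ext1 (Q [var_x], Q [var_y], Q [var_z]) Fs" for Fs
    proof (cases "length Fs = 1")
      case True
      then obtain F where "Fs = [F]" unfolding length_conv by blast
      then show ?thesis using derivation_formula[OF d, of F] by simp
    next
      case False
      then show ?thesis using multiderivationsD(1)[OF Q] by (simp add: ext_length)
    qed
    then show "Q \<in> range ext1" by blast
  qed
  show "range (ext1 :: 'k vec3 \<Rightarrow> _) \<subseteq> multiderivations 1"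
  proof safe
    fix V :: "'k vec3"
    show "ext1 V \<in> multiderivations 1"
      unfolding multiderivations_def
    proof (intro CollectI conjI allI impI)
      fix Fs :: "'k pol3 list" and i j :: nat
      show "ext1 V Fs = 0" if "length Fs \<noteq> 1" using that by (rule ext_length)
      show "derivation (\<lambda>F. ext1 V (Fs[i := F]))" if "length Fs = 1 \<and> i < 1"
        using that derivation_app1[of V] by (auto simp: length_conv[unfolded One_nat_def])
      show "ext1 V (Fs[i := Fs ! j, j := Fs ! i]) = - ext1 V Fs" if "length Fs = 1 \<and> i < j \<and> j < 1"
        using that by auto
    qed
  qed
qed

lemma multiderivations_2D:
  assumes "Q \<in> multiderivations 2"
  shows "derivation (\<lambda>F. Q [F, G])" "Q [G, F] = - Q [F, G]"
proof -
  have "derivation (\<lambda>F. Q ([0, G][0 := F]))"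
    by (rule multiderivationsD[OF assms]) simp_all
  then show "derivation (\<lambda>F. Q [F, G])" by simp
  have "Q ([F, G][0 := [F, G] ! 1, 1 := [F, G] ! 0]) = - Q [F, G]"
    by (rule multiderivationsD[OF assms]) simp_all
  then show "Q [G, F] = - Q [F, G]" by simp
qed

lemma multiderivations_2: "multiderivations 2 = range (ext2 :: 'k::field_char_0 vec3 \<Rightarrow> _)"
proof
  show "multiderivations 2 \<subseteq> range (ext2 :: 'k vec3 \<Rightarrow> _)"
  proof
    fix Q :: "'k pol3 list \<Rightarrow> 'k pol3" assume Q: "Q \<in> multiderivations 2"
    have "Q Fs = ext2 (Q [var_y, var_z], Q [var_z, var_x], Q [var_x, var_y]) Fs" for Fs
    proof (cases "length Fs = 2")
      case True
      then obtain F G where "Fs = [F, G]" unfolding length_conv by blast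
      then show ?thesis
        using alternating2[of "\<lambda>F G. Q [F, G]" F G, OF multiderivations_2D[OF Q]] by (simp only: ext_simps)
    next
      case False
      then show ?thesis using multiderivationsD(1)[OF Q] by (simp add: ext_length)
    qed
    then show "Q \<in> range ext2" by blast
  qed
  show "range (ext2 :: 'k vec3 \<Rightarrow> _) \<subseteq> multiderivations 2"
  proof safe
    fix W :: "'k vec3"
    have d: "derivation (\<lambda>F. app2 W F G)" "derivation (\<lambda>F. app2 W G F)" for G
      using derivation_app2[of W G] derivation_uminus[OF derivation_app2[of W G]]
      by (simp_all add: app2_skew[of W _ G])
    show "ext2 W \<in> multiderivations 2"
      unfolding multiderivations_def
    proof (intro CollectI conjI allI impI)
      fix Fs :: "'k pol3 list" and i j :: nat
      show "ext2 W Fs = 0" if "length Fs \<noteq> 2" using that by (rule ext_length)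
      show "derivation (\<lambda>F. ext2 W (Fs[i := F]))" if "length Fs = 2 \<and> i < 2"
        using that d by (auto simp: length_conv less_2_cases_iff)
      show "ext2 W (Fs[i := Fs ! j, j := Fs ! i]) = - ext2 W Fs" if "length Fs = 2 \<and> i < j \<and> j < 2"
      proof -
        obtain a b where "Fs = [a, b]" using \<open>length Fs = 2 \<and> _\<close> by (auto simp: length_conv)
        moreover have "i = 0" "j = 1" using that by auto
        ultimately show ?thesis using app2_skew[of W b a] by (simp only: ext_simps) simp
      qed
    qed
  qed
qed

lemma multiderivations_3D:
  assumes "Q \<in> multiderivations 3"
  shows "derivation (\<lambda>F. Q [F, G, K])" "Q [G, F, K] = - Q [F, G, K]" "Q [F, K, G] = - Q [F, G, K]"
proof -
  have "derivation (\<lambda>F. Q ([0, G, K][0 := F]))"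
    by (rule multiderivationsD[OF assms]) simp_all
  then show "derivation (\<lambda>F. Q [F, G, K])" by simp
  have "Q ([F, G, K][0 := [F, G, K] ! 1, 1 := [F, G, K] ! 0]) = - Q [F, G, K]"
    by (rule multiderivationsD[OF assms]) simp_all
  then show "Q [G, F, K] = - Q [F, G, K]" by simp
  have "Q ([F, G, K][1 := [F, G, K] ! 2, 2 := [F, G, K] ! 1]) = - Q [F, G, K]"
    by (rule multiderivationsD[OF assms]) simp_all
  then show "Q [F, K, G] = - Q [F, G, K]" by (simp add: numeral_2_eq_2)
qed

lemma multiderivations_3: "multiderivations 3 = range (ext3 :: 'k::field_char_0 pol3 \<Rightarrow> _)"
proof
  show "multiderivations 3 \<subseteq> range (ext3 :: 'k pol3 \<Rightarrow> _)"
  proof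
    fix Q :: "'k pol3 list \<Rightarrow> 'k pol3" assume Q: "Q \<in> multiderivations 3"
    have "Q Fs = ext3 (Q [var_x, var_y, var_z]) Fs" for Fs
    proof (cases "length Fs = 3")
      case True
      then obtain F G K where "Fs = [F, G, K]" unfolding length_conv by blast
      then show ?thesis
        using alternating3[of "\<lambda>F G K. Q [F, G, K]" F G K, OF multiderivations_3D[OF Q]] by (simp only: ext_simps)
    next
      case False
      then show ?thesis using multiderivationsD(1)[OF Q] by (simp add: ext_length)
    qed
    then show "Q \<in> range ext3" by blast
  qed
  show "range (ext3 :: 'k pol3 \<Rightarrow> _) \<subseteq> multiderivations 3"
  proof safe
    fix H :: "'k pol3"
    have d: "derivation (\<lambda>F. H * jacobian_bracket F G K)" "derivation (\<lambda>F. H * jacobian_bracket G F K)"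
      "derivation (\<lambda>F. H * jacobian_bracket G K F)" for G K
      by (rule derivationI; simp add: jacobian_bracket_def partial_mult algebra_simps)+
    have s: "H * jacobian_bracket G F K = - (H * jacobian_bracket F G K)"
      "H * jacobian_bracket F K G = - (H * jacobian_bracket F G K)"
      "H * jacobian_bracket K G F = - (H * jacobian_bracket F G K)" for F G K
      by (simp_all add: jacobian_bracket_def algebra_simps)
    have lt: "i < 3 \<longleftrightarrow> i = 0 \<or> i = 1 \<or> i = 2" for i :: nat by auto
    show "ext3 H \<in> multiderivations 3"
      unfolding multiderivations_def
    proof (intro CollectI conjI allI impI)
      fix Fs :: "'k pol3 list" and i j :: nat
      show "ext3 H Fs = 0" if "length Fs \<noteq> 3" using that by (rule ext_length)
      show "derivation (\<lambda>F. ext3 H (Fs[i := F]))" if "length Fs = 3 \<and> i < 3"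
        using that d by (auto simp: length_conv lt numeral_2_eq_2)
      show "ext3 H (Fs[i := Fs ! j, j := Fs ! i]) = - ext3 H Fs" if "length Fs = 3 \<and> i < j \<and> j < 3"
      proof -
        obtain a b c where Fs: "Fs = [a, b, c]" using \<open>length Fs = 3 \<and> _\<close> by (auto simp: length_conv)
        have "i = 0 \<and> j = 1 \<or> i = 0 \<and> j = 2 \<or> i = 1 \<and> j = 2" using that by auto
        then show ?thesis by (auto simp: Fs numeral_2_eq_2 intro: s)
      qed
    qed
  qed
qed

section \<open>The Poisson differential on polynomial vectors\<close>

fun grad :: "'k::idom pol3 \<Rightarrow> 'k vec3" where
  "grad F = (partial_x F, partial_y F, partial_z F)"

fun dvg :: "'k::idom vec3 \<Rightarrow> 'k pol3" where
  "dvg (a, b, c) = partial_x a + partial_y b + partial_z c"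

fun curl :: "'k::idom vec3 \<Rightarrow> 'k vec3" where
  "curl (a, b, c) = (partial_y c - partial_z b, partial_z a - partial_x c, partial_x b - partial_y a)"

fun dot :: "'k::idom vec3 \<Rightarrow> 'k vec3 \<Rightarrow> 'k pol3" where
  "dot (a, b, c) (a', b', c') = a * a' + b * b' + c * c'"

fun cross :: "'k::idom vec3 \<Rightarrow> 'k vec3 \<Rightarrow> 'k vec3" where
  "cross (a, b, c) (a', b', c') = (b * c' - c * b', c * a' - a * c', a * b' - b * a')"

fun scal :: "'k::idom pol3 \<Rightarrow> 'k vec3 \<Rightarrow> 'k vec3" where
  "scal F (a, b, c) = (F * a, F * b, F * c)"

definition diff0 :: "'k::idom pol3 \<Rightarrow> 'k pol3 \<Rightarrow> 'k vec3" where
  "diff0 \<Omega> F = cross (grad F) (grad \<Omega>)"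

definition diff1 :: "'k::idom pol3 \<Rightarrow> 'k vec3 \<Rightarrow> 'k vec3" where
  "diff1 \<Omega> V = scal (dvg V) (grad \<Omega>) - grad (dot V (grad \<Omega>))"

definition diff2 :: "'k::idom pol3 \<Rightarrow> 'k vec3 \<Rightarrow> 'k pol3" where
  "diff2 \<Omega> W = - dot (curl W) (grad \<Omega>)"

lemma poisson_diff_0: "poisson_diff br 0 Q [F] = br F (Q [])"
  by (simp add: poisson_diff_def nths_Cons)

lemma poisson_diff_1: "poisson_diff br 1 Q [F, G] = br F (Q [G]) - br G (Q [F]) - Q [br F G]"
  by (simp add: poisson_diff_def nths_Cons atMost_Suc lessThan_Suc)

lemma nths_omit:
  "nths [F, G, H] (- {0}) = [G, H]"
  "nths [F, G, H] (- {Suc 0}) = [F, H]"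
  "nths [F, G, H] (- {Suc (Suc 0)}) = [F, G]"
  "nths [F, G, H] (- {0, Suc 0}) = [H]"
  "nths [F, G, H] (- {0, Suc (Suc 0)}) = [G]"
  "nths [F, G, H] (- {Suc 0, Suc (Suc 0)}) = [F]"
  "nths [F, G, H, K] (- {0}) = [G, H, K]"
  "nths [F, G, H, K] (- {Suc 0}) = [F, H, K]"
  "nths [F, G, H, K] (- {Suc (Suc 0)}) = [F, G, K]"
  "nths [F, G, H, K] (- {Suc (Suc (Suc 0))}) = [F, G, H]"
  "nths [F, G, H, K] (- {0, Suc 0}) = [H, K]"
  "nths [F, G, H, K] (- {0, Suc (Suc 0)}) = [G, K]"
  "nths [F, G, H, K] (- {0, Suc (Suc (Suc 0))}) = [G, H]"
  "nths [F, G, H, K] (- {Suc 0, Suc (Suc 0)}) = [F, K]"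
  "nths [F, G, H, K] (- {Suc 0, Suc (Suc (Suc 0))}) = [F, H]"
  "nths [F, G, H, K] (- {Suc (Suc 0), Suc (Suc (Suc 0))}) = [F, G]"
  by (simp_all add: nths_Cons)

lemma poisson_diff_2:
  "poisson_diff br 2 Q [F, G, H] = br F (Q [G, H]) - br G (Q [F, H]) + br H (Q [F, G])
     - Q [br F G, H] + Q [br F H, G] - Q [br G H, F]"
  by (simp add: poisson_diff_def nths_omit atMost_Suc lessThan_Suc numeral_2_eq_2)

lemma poisson_diff_3:
  "poisson_diff br 3 Q [F, G, H, K] =
     br F (Q [G, H, K]) - br G (Q [F, H, K]) + br H (Q [F, G, K]) - br K (Q [F, G, H])
     - Q [br F G, H, K] + Q [br F H, G, K] - Q [br F K, G, H]
     - Q [br G H, F, K] + Q [br G K, F, H] - Q [br H K, F, G]"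
  by (simp add: poisson_diff_def nths_omit atMost_Suc lessThan_Suc numeral_2_eq_2 numeral_3_eq_3)

lemma poisson_diff_length: "length Fs \<noteq> q + 1 \<Longrightarrow> poisson_diff br q Q Fs = 0"
  by (simp add: poisson_diff_def)

lemma derivation_const: "derivation D \<Longrightarrow> D (const3 k) = 0"
  for D :: "'k::idom pol3 \<Rightarrow> 'k pol3"
  using derivation_formula[of D "const3 k"] by simp

text \<open>
  In the next three lemmas antisymmetry has been used to move the varying argument of the
  differential to the first place of both the bracket and the multiderivation.
\<close>

lemma derivation_diff1:
  fixes b :: "'k::idom pol3 \<Rightarrow> 'k pol3 \<Rightarrow> 'k pol3"
  assumes b: "\<And>G. derivation (\<lambda>F. b F G)" and q: "derivation q"
  shows "derivation (\<lambda>F. b F (q G) + b (q F) G - q (b F G))"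
proof -
  note r = derivationD(1,3)[OF b] derivation_const[OF b] derivationD(1,3)[OF q] derivation_const[OF q] derivation_0[OF b] derivation_0[OF q]
  show ?thesis by (rule derivationI) (simp_all add: r algebra_simps)
qed

lemma derivation_diff2:
  fixes b :: "'k::idom pol3 \<Rightarrow> 'k pol3 \<Rightarrow> 'k pol3"
  assumes b: "\<And>G. derivation (\<lambda>F. b F G)" and q: "\<And>G. derivation (\<lambda>F. q F G)"
  shows "derivation (\<lambda>F. b F (q G H) + b (q F H) G - b (q F G) H - q (b F G) H + q (b F H) G + q F (b G H))"
proof -
  note r = derivationD(1,3)[OF b] derivation_const[OF b] derivationD(1,3)[OF q] derivation_const[OF q] derivation_0[OF b] derivation_0[OF q]
  show ?thesis by (rule derivationI) (simp_all add: r algebra_simps)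
qed

lemma derivation_diff3:
  fixes b :: "'k::idom pol3 \<Rightarrow> 'k pol3 \<Rightarrow> 'k pol3"
  assumes b: "\<And>G. derivation (\<lambda>F. b F G)" and q: "\<And>G H. derivation (\<lambda>F. q F G H)"
  shows "derivation (\<lambda>F. b F (q G H K) + b (q F H K) G - b (q F G K) H + b (q F G H) K
    - q (b F G) H K + q (b F H) G K - q (b F K) G H + q F (b G H) K - q F (b G K) H + q F (b H K) G)"
proof -
  note r = derivationD(1,3)[OF b] derivation_const[OF b] derivationD(1,3)[OF q] derivation_const[OF q] derivation_0[OF b] derivation_0[OF q]
  show ?thesis by (rule derivationI) (simp_all add: r algebra_simps)
qed

lemma derivation_jacobian_bracket_2: "derivation (\<lambda>F. jacobian_bracket \<Omega> F G)"
  unfolding jacobian_bracket_app2 by (rule derivation_app2)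

lemma poisson_diff_ext0:
  fixes \<Omega> :: "'k::field_char_0 pol3"
  shows "poisson_diff (jacobian_bracket \<Omega>) 0 (ext0 F) = ext1 (diff0 \<Omega> F)"
proof
  fix Fs
  show "poisson_diff (jacobian_bracket \<Omega>) 0 (ext0 F) Fs = ext1 (diff0 \<Omega> F) Fs"
  proof (cases "length Fs = 1")
    case True
    then obtain G where "Fs = [G]" unfolding length_conv by blast
    then show ?thesis
      by (simp add: poisson_diff_0 diff0_def jacobian_bracket_app2 algebra_simps)
  next
    case False
    then show ?thesis by (simp add: ext_length poisson_diff_length)
  qed
qed

text \<open>Both sides are skew biderivations, so they are compared on pairs of variables only,
  where the formula is a computation with partial derivatives.\<close>

lemma poisson_diff_ext1:
  fixes \<Omega> :: "'k::field_char_0 pol3"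
  shows "poisson_diff (jacobian_bracket \<Omega>) 1 (ext1 V) = ext2 (diff1 \<Omega> V)"
proof
  fix Fs
  let ?b = "jacobian_bracket \<Omega>"
  show "poisson_diff ?b 1 (ext1 V) Fs = ext2 (diff1 \<Omega> V) Fs"
  proof (cases "length Fs = 2")
    case True
    then obtain F G where Fs: "Fs = [F, G]" unfolding length_conv by blast
    define P where "P F G = poisson_diff ?b 1 (ext1 V) [F, G]" for F G
    have P: "P F G = ?b F (app1 V G) + ?b (app1 V F) G - app1 V (?b F G)" for F G
      unfolding P_def poisson_diff_1 ext_simps jacobian_bracket_skew[of \<Omega> "app1 V F" G] by simp
    have "derivation (\<lambda>F. P F G)" for G
      unfolding P by (rule derivation_diff1[OF derivation_jacobian_bracket_2 derivation_app1])
    moreover have "P G F = - P F G" for F G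
      unfolding P_def poisson_diff_1 jacobian_bracket_skew[of \<Omega> F G]
      by (simp add: derivation_minus[OF derivation_app1])
    ultimately have "P F G = app2 (P var_y var_z, P var_z var_x, P var_x var_y) F G"
      by (rule alternating2)
    also have "(P var_y var_z, P var_z var_x, P var_x var_y) = diff1 \<Omega> V"
      unfolding P
      by (cases V) (simp add: jacobian_bracket_def diff1_def partial_mult partial_commute algebra_simps)
    finally show ?thesis by (simp add: Fs P_def)
  next
    case False
    then show ?thesis by (simp add: ext_length poisson_diff_length)
  qed
qed

lemma poisson_diff_ext2:
  fixes \<Omega> :: "'k::field_char_0 pol3"
  shows "poisson_diff (jacobian_bracket \<Omega>) 2 (ext2 W) = ext3 (diff2 \<Omega> W)"
proof
  fix Fs
  let ?b = "jacobian_bracket \<Omega>"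
  show "poisson_diff ?b 2 (ext2 W) Fs = ext3 (diff2 \<Omega> W) Fs"
  proof (cases "length Fs = 3")
    case True
    then obtain F G H where Fs: "Fs = [F, G, H]" unfolding length_conv by blast
    define P where "P F G H = poisson_diff ?b 2 (ext2 W) [F, G, H]" for F G H
    have P: "P F G H = ?b F (app2 W G H) + ?b (app2 W F H) G - ?b (app2 W F G) H
        - app2 W (?b F G) H + app2 W (?b F H) G + app2 W F (?b G H)" for F G H
      unfolding P_def poisson_diff_2 ext_simps
        jacobian_bracket_skew[of \<Omega> "app2 W F H" G] jacobian_bracket_skew[of \<Omega> "app2 W F G" H]
        app2_skew[of W F "?b G H"] by simp
    have "derivation (\<lambda>F. P F G H)" for G H
      unfolding P by (rule derivation_diff2[OF derivation_jacobian_bracket_2 derivation_app2])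
    moreover have "P G F H = - P F G H" for F G H
      unfolding P_def poisson_diff_2 ext_simps jacobian_bracket_skew[of \<Omega> F G] app2_skew[of W F G]
      by (simp add: derivation_minus[OF derivation_app2] derivation_minus[OF derivation_jacobian_bracket])
    moreover have "P F H G = - P F G H" for F G H
      unfolding P_def poisson_diff_2 ext_simps jacobian_bracket_skew[of \<Omega> G H] app2_skew[of W G H]
      by (simp add: derivation_minus[OF derivation_app2] derivation_minus[OF derivation_jacobian_bracket])
    ultimately have "P F G H = P var_x var_y var_z * jacobian_bracket F G H"
      by (rule alternating3)
    also have "P var_x var_y var_z = diff2 \<Omega> W"
      unfolding P
      by (cases W) (simp add: jacobian_bracket_def diff2_def partial_mult partial_commute algebra_simps)
    finally show ?thesis by (simp add: Fs P_def)
  next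
    case False
    then show ?thesis by (simp add: ext_length poisson_diff_length)
  qed
qed

lemma poisson_diff_ext3:
  fixes \<Omega> :: "'k::field_char_0 pol3"
  shows "poisson_diff (jacobian_bracket \<Omega>) 3 (ext3 C) = (\<lambda>_. 0)"
proof
  fix Fs
  let ?b = "jacobian_bracket \<Omega>"
  define q where "q F G H = C * jacobian_bracket F G H" for F G H
  have q: "ext3 C [F, G, H] = q F G H" for F G H by (simp add: q_def)
  have dq: "derivation (\<lambda>F. q F G H)" for G H
    unfolding q_def by (rule derivationI; simp add: jacobian_bracket_def partial_mult algebra_simps)
  have s: "q G F H = - q F G H" and s': "q F H G = - q F G H" for F G H
    by (simp_all add: q_def jacobian_bracket_def algebra_simps)
  show "poisson_diff ?b 3 (ext3 C) Fs = 0"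
  proof (cases "length Fs = 4")
    case True
    then obtain F G H K where Fs: "Fs = [F, G, H, K]" unfolding length_conv by blast
    define P where "P F G H K = poisson_diff ?b 3 (ext3 C) [F, G, H, K]" for F G H K
    note unf = P_def poisson_diff_3 q
    have P: "P F G H K = ?b F (q G H K) + ?b (q F H K) G - ?b (q F G K) H + ?b (q F G H) K
      - q (?b F G) H K + q (?b F H) G K - q (?b F K) G H + q F (?b G H) K - q F (?b G K) H + q F (?b H K) G"
      for F G H K
      unfolding unf jacobian_bracket_skew[of \<Omega> "q F H K" G] jacobian_bracket_skew[of \<Omega> "q F G K" H]
        jacobian_bracket_skew[of \<Omega> "q F G H" K] s[of F "?b G H"] s[of F "?b G K"] s[of F "?b H K"] by simp
    have dm: "?b F (- G) = - ?b F G" "q (- F) G H = - q F G H" for F G H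
      by (rule derivation_minus[OF derivation_jacobian_bracket] derivation_minus[OF dq])+
    have "derivation (\<lambda>F. P F G H K)" for G H K
      unfolding P by (rule derivation_diff3[OF derivation_jacobian_bracket_2 dq])
    moreover have "P G F H K = - P F G H K" for F G H K
      unfolding unf jacobian_bracket_skew[of \<Omega> F G] s[of F G] s'[of _ F G] by (simp add: dm)
    moreover have "P F H G K = - P F G H K" for F G H K
      unfolding unf jacobian_bracket_skew[of \<Omega> G H] s[of G H] s'[of F G H] s'[of _ G H] by (simp add: dm)
    moreover have "P F G K H = - P F G H K" for F G H K
      unfolding unf jacobian_bracket_skew[of \<Omega> H K] s'[of _ H K] by (simp add: dm)
    ultimately have "P F G H K = 0" by (rule alternating4)
    then show ?thesis by (simp add: Fs P_def)
  next
    case False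
    then show ?thesis by (simp add: poisson_diff_length)
  qed
qed

section \<open>Homogeneous polynomials\<close>

definition sc1 :: "'k::field \<Rightarrow> 'k pol3 \<Rightarrow> 'k pol3" where
  "sc1 c F = const3 c * F"

definition sc3 :: "'k::field \<Rightarrow> 'k vec3 \<Rightarrow> 'k vec3" where
  "sc3 c V = scal (const3 c) V"

lemma sc3_simps [simp]: "sc3 c (F, G, H) = (const3 c * F, const3 c * G, const3 c * H)"
  by (simp add: sc3_def)

lemma vector_space_sc1: "vector_space (sc1 :: 'k::field \<Rightarrow> _)"
  by unfold_locales (simp_all add: sc1_def const3_hom algebra_simps)

lemma vector_space_sc3: "vector_space (sc3 :: 'k::field \<Rightarrow> _)"
  by unfold_locales (auto simp: const3_hom algebra_simps)

interpretation sc1: vector_space "sc1 :: 'k::field \<Rightarrow> _" by (rule vector_space_sc1)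
interpretation sc3: vector_space "sc3 :: 'k::field \<Rightarrow> _" by (rule vector_space_sc3)

definition hpol :: "int \<Rightarrow> 'k::idom pol3 set" where
  "hpol n = {F. homogeneous n F}"

definition hvec :: "int \<Rightarrow> 'k::idom vec3 set" where
  "hvec n = hpol n \<times> hpol n \<times> hpol n"

lemma in_hvec [simp]: "(a, b, c) \<in> hvec n \<longleftrightarrow> homogeneous n a \<and> homogeneous n b \<and> homogeneous n c"
  by (simp add: hvec_def hpol_def)

lemma vsub_hpol: "vsub sc1 (hpol n :: 'k::field pol3 set)"
  unfolding vsub_def by (auto simp: vector_space_sc1 hpol_def sc1_def)

lemma vsub_hvec: "vsub sc3 (hvec n :: 'k::field vec3 set)"
  unfolding vsub_def zero_prod_def by (auto simp: vector_space_sc3)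

text \<open>Passage from type-based spans to spans in the module record: the latter is a subspace
  containing A, hence contains the former.\<close>

lemma findimI:
  assumes S: "vsub s S" and A: "finite A" "A \<subseteq> S" "S \<subseteq> Modules.module.span s A"
  shows "findim s S"
proof -
  interpret vector_space s using S by (simp add: vsub_def)
  interpret V: vectorspace class_ring "vmod s S" by (rule vectorspace_vmod[OF S])
  have sub: "submodule class_ring (V.span A) (vmod s S)" by (rule V.span_is_submodule) (use A in simp)
  have "subspace (V.span A)"
    unfolding subspace_def
    using submodule.zero_closed[OF sub] submodule.m_closed[OF sub] submodule.smult_closed[OF sub] by simp
  then have "span A \<subseteq> V.span A"
    using V.in_own_span[of A] A(2) by (intro span_minimal) auto
  then have "V.gen_set A" using A V.span_is_subset2[of A] by auto
  then show ?thesis using S A by (auto simp: findim_def V.fin_dim_def)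
qed

text \<open>These finite spanning sets give finite dimensionality; the dimension itself is found by
  restricting to z = 0 and to y = 0.\<close>

fun monomials :: "nat \<Rightarrow> 'k::comm_ring_1 pol3 set" where
  "monomials 0 = {1}"
| "monomials (Suc n) = (\<lambda>F. var_x * F) ` monomials n \<union> (\<lambda>F. var_y * F) ` monomials n \<union> (\<lambda>F. var_z * F) ` monomials n"

lemma finite_monomials: "finite (monomials n)"
  by (induction n) auto

lemma monomials_homogeneous: "F \<in> monomials n \<Longrightarrow> homogeneous (int n) (F :: 'k::comm_ring_1 pol3)"
proof (induction n arbitrary: F)
  case 0
  then show ?case using homogeneous_const3[of "1 :: 'k"] by simp
next
  case (Suc n)
  then show ?case by (auto intro: homogeneous_mult[OF homogeneous_var(1)]
        homogeneous_mult[OF homogeneous_var(2)] homogeneous_mult[OF homogeneous_var(3)])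
qed

lemma span_linear_image:
  assumes s: "vector_space s" and t: "vector_space t" and h_add: "\<And>u v. h (u + v) = h u + h v"
    and h_smult: "\<And>c u. h (s c u) = t c (h u)" and u: "u \<in> Modules.module.span s A"
    and A: "h ` A \<subseteq> B"
  shows "h u \<in> Modules.module.span t B"
proof -
  interpret s: vector_space s by fact
  interpret t: vector_space t by fact
  have h_0: "h 0 = 0" using h_add[of 0 0] by simp
  show ?thesis
    using u
  proof (induction rule: s.span_induct_alt)
    case base
    show ?case by (simp add: h_0 t.span_zero)
  next
    case (step c x y)
    then have "h x \<in> t.span B" using A by (intro t.span_base) auto
    then show ?case using step by (simp add: h_add h_smult t.span_add t.span_scale)
  qed
qed

lemma span_monomials:
  fixes F :: "'k::field_char_0 pol3"
  assumes "homogeneous (int n) F"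
  shows "F \<in> sc1.span (monomials n)"
  using assms
proof (induction n arbitrary: F)
  case 0
  then obtain k where "F = sc1 k 1" by (auto simp: homogeneous_zero_iff sc1_def)
  then show ?case by (simp add: sc1.span_base sc1.span_scale)
next
  case (Suc n)
  obtain A B C where *: "homogeneous (int n) A" "homogeneous (int n) B" "homogeneous (int n) C"
    "F = var_x * A + var_y * B + var_z * C" using homogeneous_Suc_decomp[OF Suc.prems] by blast
  have m: "v * u \<in> sc1.span (monomials (Suc n))"
    if "u \<in> sc1.span (monomials n)" "v = var_x \<or> v = var_y \<or> v = var_z" for u v :: "'k pol3"
    by (rule span_linear_image[OF vector_space_sc1 vector_space_sc1 _ _ that(1)])
      (use that(2) in \<open>auto simp: sc1_def algebra_simps\<close>)
  show ?case unfolding *(4) using Suc.IH[OF *(1)] Suc.IH[OF *(2)] Suc.IH[OF *(3)]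
    by (intro sc1.span_add m) auto
qed

lemma hpol_neg: "n < 0 \<Longrightarrow> hpol n = {0 :: 'k::idom pol3}"
  by (auto simp: hpol_def homogeneous_neg)

lemma findim_hpol: "findim sc1 (hpol n :: 'k::field_char_0 pol3 set)"
proof (cases "n < 0")
  case True
  then show ?thesis by (simp add: hpol_neg sdim_zero vector_space_sc1)
next
  case False
  then have n: "n = int (nat n)" by simp
  have "monomials (nat n) \<subseteq> (hpol n :: 'k pol3 set)"
    using monomials_homogeneous[of _ "nat n"] n by (auto simp: hpol_def)
  moreover have "hpol n \<subseteq> sc1.span (monomials (nat n) :: 'k pol3 set)"
    using span_monomials[of "nat n"] n by (auto simp: hpol_def)
  ultimately show ?thesis by (intro findimI[OF vsub_hpol finite_monomials])
qed

lemma findim_hvec: "findim sc3 (hvec n :: 'k::field_char_0 vec3 set)"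
proof (cases "n < 0")
  case True
  then have "hvec n = {0 :: 'k vec3}" by (auto simp: hvec_def hpol_neg zero_prod_def)
  then show ?thesis by (simp add: sdim_zero vector_space_sc3)
next
  case False
  then have n: "n = int (nat n)" by simp
  let ?m = "monomials (nat n) :: 'k pol3 set"
  let ?M = "(\<lambda>F. (F, 0, 0)) ` ?m \<union> (\<lambda>F. (0, F, 0)) ` ?m \<union> (\<lambda>F. (0, 0, F)) ` ?m"
  have "?M \<subseteq> hvec n" using monomials_homogeneous[of _ "nat n"] n by auto
  moreover have "hvec n \<subseteq> sc3.span ?M"
  proof
    fix V :: "'k vec3" assume "V \<in> hvec n"
    then obtain F G H where V: "V = (F, G, H)" "homogeneous n F" "homogeneous n G" "homogeneous n H"
      by (cases V) auto
    then have s: "F \<in> sc1.span ?m" "G \<in> sc1.span ?m" "H \<in> sc1.span ?m"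
      using span_monomials[of "nat n"] n by auto
    have "(F, 0, 0) \<in> sc3.span ?M"
      by (rule span_linear_image[OF vector_space_sc1 vector_space_sc3 _ _ s(1)]) (auto simp: sc1_def)
    moreover have "(0, G, 0) \<in> sc3.span ?M"
      by (rule span_linear_image[OF vector_space_sc1 vector_space_sc3 _ _ s(2)]) (auto simp: sc1_def)
    moreover have "(0, 0, H) \<in> sc3.span ?M"
      by (rule span_linear_image[OF vector_space_sc1 vector_space_sc3 _ _ s(3)]) (auto simp: sc1_def)
    ultimately have "(F, 0, 0) + (0, G, 0) + (0, 0, H) \<in> sc3.span ?M"
      by (intro sc3.span_add)
    then show "V \<in> sc3.span ?M" by (simp add: V)
  qed
  ultimately show ?thesis by (intro findimI[OF vsub_hvec]) (auto simp: finite_monomials)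
qed

lemma sdim_inj_image:
  assumes "findim s S" "vector_space t" "\<And>u v. u \<in> S \<Longrightarrow> v \<in> S \<Longrightarrow> h (u + v) = h u + h v"
    "\<And>c u. u \<in> S \<Longrightarrow> h (s c u) = t c (h u)" "\<And>u. u \<in> S \<Longrightarrow> h u = 0 \<Longrightarrow> u = 0"
  shows "sdim t (h ` S) = sdim s S"
proof -
  have S: "vsub s S" using assms(1) by (simp add: findim_def)
  note S' = vsubD[OF S]
  have "h 0 = 0" using assms(3)[of 0 0] S'(2) by simp
  then have k: "{u \<in> S. h u = 0} = {0}" using assms(5) S'(2) by auto
  have "sdim t (h ` S) + sdim s {u \<in> S. h u = 0} = sdim s S"
    by (rule rank_nullity_vmod(3)[where h = h and s = s and t = t, OF assms(1,2)]) (rule assms(3,4); assumption)+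
  then show ?thesis unfolding k sdim_zero(2)[OF S'(1)] by simp
qed

lemma sdim_hvec: "sdim sc3 (hvec n :: 'k::field_char_0 vec3 set) = 3 * sdim sc1 (hpol n :: 'k pol3 set)"
proof -
  let ?A = "hpol n :: 'k pol3 set"
  have 1: "sdim sc1 (fst ` hvec n :: 'k pol3 set) + sdim sc3 {V \<in> hvec n. fst V = (0 :: 'k pol3)} =
      sdim sc3 (hvec n :: 'k vec3 set)" "findim sc3 {V \<in> hvec n. fst V = (0 :: 'k pol3)}"
    by (rule rank_nullity_vmod[where h = fst, OF findim_hvec vector_space_sc1]; auto simp: sc1_def sc3_def hvec_def)+
  have 2: "sdim sc1 ((\<lambda>V. fst (snd V)) ` {V \<in> hvec n. fst V = 0} :: 'k pol3 set) +
      sdim sc3 {V \<in> {V \<in> hvec n. fst V = 0}. fst (snd V) = (0 :: 'k pol3)} =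
      sdim sc3 {V \<in> hvec n. fst V = (0 :: 'k pol3)}"
    by (rule rank_nullity_vmod(3)[where S = "{V \<in> hvec n. fst V = 0}" and h = "\<lambda>V. fst (snd V)", OF 1(2) vector_space_sc1])
      (auto simp: sc1_def sc3_def hvec_def)
  have 3: "sdim sc3 ((\<lambda>F. (0, 0, F)) ` ?A) = sdim sc1 ?A"
    by (rule sdim_inj_image[OF findim_hpol vector_space_sc3]) (auto simp: sc1_def zero_prod_def)
  have "fst ` hvec n = ?A" 
    by (auto simp: hpol_def hvec_def image_iff intro!: bexI[of _ "(_, 0, 0)"])
  moreover have "(\<lambda>V. fst (snd V)) ` {V \<in> hvec n. fst V = 0} = ?A"
    by (auto simp: hpol_def hvec_def image_iff intro!: bexI[of _ "(0, _, 0)"])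
  moreover have "{V \<in> {V \<in> hvec n. fst V = 0}. fst (snd V) = (0 :: 'k pol3)} = (\<lambda>F. (0, 0, F)) ` ?A"
    by (auto simp: hpol_def hvec_def)
  ultimately show ?thesis using 1(1) 2 3 by simp
qed

lemma homogeneous_factor:
  fixes G :: "'k::idom pol3"
  assumes "homogeneous m D" "D \<noteq> 0" "homogeneous n (D * G)"
  shows "homogeneous (n - m) G"
proof -
  have "G * D = hom_comp (n - m) G * D"
    using hom_comp_mult[OF assms(1), of n G] hom_comp_homogeneous[OF assms(3), of n]
    by (simp add: mult.commute)
  then have "G = hom_comp (n - m) G" using assms(2) by simp
  then show ?thesis by (metis homogeneous_hom_comp)
qed

lemma homogeneous_subst3_0:
  fixes F :: "'k::field_char_0 pol3"
  assumes "homogeneous n F"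
  shows "homogeneous n (subst3 var_x var_y 0 F)" "homogeneous n (subst3 var_x 0 0 F)"
proof -
  have "homogeneous n (subst3 var_x var_y 0 F) \<and> homogeneous n (subst3 var_x 0 0 F)"
  proof (cases "n < 0")
    case True
    then show ?thesis using assms homogeneous_neg by fastforce
  next
    case False
    then have "n = int (nat n)" by simp
    then show ?thesis using homogeneous_subst3[of "nat n" F] assms homogeneous_var by (metis homogeneous_0)
  qed
  then show "homogeneous n (subst3 var_x var_y 0 F)" "homogeneous n (subst3 var_x 0 0 F)" by auto
qed

text \<open>Binary forms in x and y, as the fixed points of the restriction to z = 0.\<close>

definition hpol2 :: "int \<Rightarrow> 'k::idom pol3 set" where
  "hpol2 n = {F \<in> hpol n. subst3 var_x var_y 0 F = F}"

text \<open>Rank-nullity for the restriction to z = 0: the image is the space of binary forms, the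
  kernel is z times the forms of degree n - 1.\<close>

lemma sdim_hpol_rec:
  "sdim sc1 (hpol n :: 'k::field_char_0 pol3 set) = sdim sc1 (hpol2 n :: 'k pol3 set) + sdim sc1 (hpol (n - 1) :: 'k pol3 set)"
  "findim sc1 (hpol2 n :: 'k::field_char_0 pol3 set)"
proof -
  let ?h = "subst3 var_x var_y (0 :: 'k pol3)"
  note rn = rank_nullity_vmod[OF findim_hpol vector_space_sc1, of n ?h]
  have im: "?h ` hpol n = hpol2 n"
    using homogeneous_subst3_0(1) unfolding hpol2_def hpol_def
    by (auto simp: subst3_subst3 image_iff) metis
  have ker: "{F \<in> hpol n. ?h F = 0} = (\<lambda>G. var_z * G) ` hpol (n - 1)"
    unfolding hpol_def
    by (auto simp flip: var_dvd_iff elim!: dvdE intro: homogeneous_mult[OF homogeneous_var(3)]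
        dest: homogeneous_factor[OF homogeneous_var(3) var_neq_0(3)])
  have "sdim sc1 ((\<lambda>G. var_z * G) ` hpol (n - 1) :: 'k pol3 set) = sdim sc1 (hpol (n - 1) :: 'k pol3 set)"
    by (rule sdim_inj_image[OF findim_hpol vector_space_sc1]) (auto simp: sc1_def algebra_simps)
  then show "sdim sc1 (hpol n :: 'k pol3 set) = sdim sc1 (hpol2 n :: 'k pol3 set) + sdim sc1 (hpol (n - 1) :: 'k pol3 set)"
    using rn(3) unfolding im ker by (simp add: sc1_def)
  show "findim sc1 (hpol2 n :: 'k pol3 set)"
    using rn(1) unfolding im by (simp add: sc1_def)
qed

lemma hpol1: "{F \<in> hpol (int n). subst3 var_x 0 0 F = F} = range (\<lambda>c. sc1 c (var_x ^ n :: 'k::field_char_0 pol3))"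
proof -
  have 1: "\<exists>c. subst3 var_x 0 0 F = const3 c * var_x ^ n" if "homogeneous (int n) F" for F :: "'k pol3"
    using that
  proof (induction n arbitrary: F)
    case 0
    then show ?case by (auto simp: homogeneous_zero_iff)
  next
    case (Suc n)
    obtain A B C where *: "homogeneous (int n) A" "F = var_x * A + var_y * B + var_z * C"
      using homogeneous_Suc_decomp[OF Suc.prems] by blast
    obtain c where "subst3 var_x 0 0 A = const3 c * var_x ^ n" using Suc.IH[OF *(1)] by blast
    then have "subst3 var_x 0 0 F = const3 c * var_x ^ Suc n" by (simp add: *(2))
    then show ?case by blast
  qed
  have 2: "homogeneous (int n) (var_x ^ n :: 'k pol3)" using homogeneous_power[OF homogeneous_var(1), of n] by simp
  show ?thesis
  proof
    show "{F \<in> hpol (int n). subst3 var_x 0 0 F = F} \<subseteq> range (\<lambda>c. sc1 c (var_x ^ n :: 'k pol3))"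
      using 1 unfolding hpol_def sc1_def by (auto simp: image_iff) metis
    show "range (\<lambda>c. sc1 c (var_x ^ n :: 'k pol3)) \<subseteq> {F \<in> hpol (int n). subst3 var_x 0 0 F = F}"
      using 2 by (auto simp: hpol_def sc1_def)
  qed
qed

lemma sdim_hpol2_rec:
  assumes "n \<ge> 0"
  shows "sdim sc1 (hpol2 n :: 'k::field_char_0 pol3 set) = 1 + sdim sc1 (hpol2 (n - 1) :: 'k pol3 set)"
proof -
  let ?h = "subst3 var_x 0 (0 :: 'k pol3)"
  note rn = rank_nullity_vmod[OF sdim_hpol_rec(2) vector_space_sc1, of n ?h]
  have n: "n = int (nat n)" using assms by simp
  have "?h ` hpol2 n = {F \<in> hpol n. ?h F = F}"
  proof
    show "?h ` hpol2 n \<subseteq> {F \<in> hpol n. ?h F = F}"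
      using homogeneous_subst3_0(2) unfolding hpol2_def hpol_def by (auto simp: subst3_subst3)
    show "{F \<in> hpol n. ?h F = F} \<subseteq> ?h ` hpol2 n"
    proof
      fix F assume F: "F \<in> {F \<in> hpol n. ?h F = F}"
      then have "subst3 var_x var_y 0 F = subst3 var_x var_y 0 (?h F)" by simp
      also have "\<dots> = ?h F" by (simp add: subst3_subst3)
      also have "\<dots> = F" using F by simp
      finally have "F \<in> hpol2 n" using F by (simp add: hpol2_def)
      then show "F \<in> ?h ` hpol2 n" using F by force
    qed
  qed
  then have im: "?h ` hpol2 n = range (\<lambda>c. sc1 c (var_x ^ nat n))" using hpol1[of "nat n"] n by simp
  have ker: "{F \<in> hpol2 n. ?h F = 0} = (\<lambda>G. var_y * G) ` hpol2 (n - 1)"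
  proof
    show "(\<lambda>G. var_y * G) ` hpol2 (n - 1) \<subseteq> {F \<in> hpol2 n. ?h F = 0}"
      unfolding hpol2_def hpol_def by (auto intro: homogeneous_mult[OF homogeneous_var(2)])
    show "{F \<in> hpol2 n. ?h F = 0} \<subseteq> (\<lambda>G. var_y * G) ` hpol2 (n - 1)"
    proof
      fix F assume F: "F \<in> {F \<in> hpol2 n. ?h F = 0}"
      then have f: "homogeneous n F" "subst3 var_x var_y 0 F = F" "?h F = 0"
        by (auto simp: hpol2_def hpol_def)
      have "subst3 var_x 0 var_z F = subst3 var_x 0 var_z (subst3 var_x var_y 0 F)" by (simp only: f(2))
      also have "\<dots> = 0" using f(3) by (simp add: subst3_subst3)
      finally obtain G where G: "F = var_y * G" by (auto simp flip: var_dvd_iff elim!: dvdE)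
      have "var_y * subst3 var_x var_y 0 G = var_y * G" using f(2) unfolding G by simp
      then have "subst3 var_x var_y 0 G = G" by simp
      moreover have "homogeneous (n - 1) G"
        using homogeneous_factor[OF homogeneous_var(2) var_neq_0(2)] f(1) unfolding G by blast
      ultimately show "F \<in> (\<lambda>G. var_y * G) ` hpol2 (n - 1)" unfolding G hpol2_def hpol_def by blast
    qed
  qed
  have "sdim sc1 ((\<lambda>G. var_y * G) ` hpol2 (n - 1) :: 'k pol3 set) = sdim sc1 (hpol2 (n - 1) :: 'k pol3 set)"
    by (rule sdim_inj_image[OF sdim_hpol_rec(2) vector_space_sc1]) (auto simp: sc1_def algebra_simps)
  moreover have "sdim sc1 (range (\<lambda>c. sc1 c (var_x ^ nat n :: 'k pol3))) = 1"
    by (rule sdim_line[OF vector_space_sc1]) simp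
  ultimately show ?thesis
    using rn(3) unfolding im ker by (simp add: sc1_def)
qed

lemma sdim_hpol:
  "sdim sc1 (hpol n :: 'k::field_char_0 pol3 set) = (if n < 0 then 0 else nat ((n + 1) * (n + 2) div 2))"
proof -
  have neg: "n < 0 \<Longrightarrow> sdim sc1 (hpol n :: 'k pol3 set) = 0" for n
    by (simp add: hpol_neg sdim_zero vector_space_sc1)
  have neg2: "sdim sc1 (hpol2 (- 1) :: 'k pol3 set) = 0"
    using sdim_hpol_rec(1)[of "- 1", where 'k='k] neg[of "- 1"] by simp
  have b: "sdim sc1 (hpol2 (int n) :: 'k pol3 set) = n + 1" for n
  proof (induction n)
    case 0
    then show ?case using sdim_hpol2_rec[of 0, where 'k='k] neg2 by simp
  next
    case (Suc n)
    then show ?case using sdim_hpol2_rec[of "int (Suc n)", where 'k='k] by simp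
  qed
  have a: "2 * sdim sc1 (hpol (int n) :: 'k pol3 set) = (n + 1) * (n + 2)" for n
  proof (induction n)
    case 0
    then show ?case using sdim_hpol_rec(1)[of 0, where 'k='k] neg[of "- 1"] b[of 0] by simp
  next
    case (Suc n)
    then show ?case using sdim_hpol_rec(1)[of "int (Suc n)", where 'k='k] b[of "Suc n"] by simp
  qed
  show ?thesis
  proof (cases "n < 0")
    case False
    then obtain m where m: "n = int m" by (metis nonneg_int_cases not_less)
    have "int (2 * sdim sc1 (hpol n :: 'k pol3 set)) = (n + 1) * (n + 2)"
      unfolding m a[of m] by (simp add: algebra_simps)
    then have "int (sdim sc1 (hpol n :: 'k pol3 set)) = (n + 1) * (n + 2) div 2" by simp
    then show ?thesis using False by (metis nat_int)
  qed (simp add: neg)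
qed

section \<open>Closed and Hamiltonian vector fields\<close>

lemma grad_hvec: "homogeneous n F \<Longrightarrow> grad F \<in> hvec (n - 1)"
  by (simp add: homogeneous_partial)

lemma curl_hvec: "V \<in> hvec n \<Longrightarrow> curl V \<in> hvec (n - 1)"
  by (cases V) (auto simp: homogeneous_partial homogeneous_diff)

lemma dvg_hpol: "V \<in> hvec n \<Longrightarrow> homogeneous (n - 1) (dvg V)"
  by (cases V) (auto simp: homogeneous_partial homogeneous_add)

lemma dot_hpol: "V \<in> hvec m \<Longrightarrow> W \<in> hvec n \<Longrightarrow> l = m + n \<Longrightarrow> homogeneous l (dot V W)"
  by (cases V; cases W) (auto intro!: homogeneous_add homogeneous_mult')

lemma cross_hvec: "V \<in> hvec m \<Longrightarrow> W \<in> hvec n \<Longrightarrow> l = m + n \<Longrightarrow> cross V W \<in> hvec l"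
  by (cases V; cases W) (auto intro!: homogeneous_diff homogeneous_mult')

lemma scal_hvec: "homogeneous m F \<Longrightarrow> V \<in> hvec n \<Longrightarrow> l = m + n \<Longrightarrow> scal F V \<in> hvec l"
  by (cases V) (auto intro!: homogeneous_mult')

lemma hvec_diff: "V \<in> hvec n \<Longrightarrow> W \<in> hvec n \<Longrightarrow> V - W \<in> hvec n"
  by (cases V; cases W) auto

lemma hvec_neg: "V \<in> hvec n \<Longrightarrow> n < 0 \<Longrightarrow> V = 0"
  by (cases V) (auto simp: zero_prod_def homogeneous_neg)

lemma curl_grad: "curl (grad F) = 0"
  by (simp add: partial_commute zero_prod_def)

lemma dvg_curl: "dvg (curl V) = 0"
  by (cases V) (simp add: partial_commute)

lemma dvg_cross_grad: "dvg (cross V (grad F)) = dot (curl V) (grad F)"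
  by (cases V) (simp add: partial_mult partial_commute algebra_simps)

lemma curl_scal_grad: "curl (scal F (grad G)) = cross (grad F) (grad G)"
  by (simp add: partial_mult partial_commute algebra_simps)

lemma dot_cross: "dot (cross V W) W = 0"
  by (cases V; cases W) (simp add: algebra_simps)

lemma cross_add: "cross (U + V) W = cross U W + cross V W"
  by (cases U; cases V; cases W) (simp add: algebra_simps)

lemma cross_scal_self: "cross (scal F W) W = 0"
  by (cases W) (simp add: zero_prod_def algebra_simps)

lemma curl_diff: "curl (V - W) = curl V - curl W"
  by (cases V; cases W) (simp add: algebra_simps)

lemma const3_cancel: "n \<noteq> 0 \<Longrightarrow> const3 (inverse (of_nat n)) * (of_nat n * F) = (F :: 'k::field_char_0 pol3)"
  by (simp flip: const3_of_nat const3_hom mult.assoc)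

text \<open>The potential is V \<cdot> (x, y, z) / (m + 1). Its partial derivatives are evaluated by
  exchanging indices through curl V = 0 and using Euler's identity.\<close>

lemma poincare_grad:
  fixes V :: "'k::field_char_0 vec3"
  assumes V: "V \<in> hvec (int m)" and c: "curl V = 0"
  shows "\<exists>G. homogeneous (int m + 1) G \<and> V = grad G"
proof -
  obtain a b d where Vd: "V = (a, b, d)" by (cases V)
  have h: "homogeneous (int m) a" "homogeneous (int m) b" "homogeneous (int m) d" using V Vd by auto
  have c: "partial_y d = partial_z b" "partial_z a = partial_x d" "partial_x b = partial_y a"
    using c by (simp_all add: Vd zero_prod_def)
  define r :: "'k pol3" where "r = const3 (inverse (of_nat (Suc m)))"
  have [simp]: "partial_x r = 0" "partial_y r = 0" "partial_z r = 0" by (simp_all add: r_def)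
  have r: "r * (of_nat (Suc m) * F) = F" for F
    unfolding r_def by (rule const3_cancel) simp
  define G where "G = r * (var_x * a + var_y * b + var_z * d)"
  have "homogeneous (int m + 1) G"
    unfolding G_def r_def using h
    by (intro homogeneous_const_mult homogeneous_add homogeneous_mult[OF homogeneous_var(1)]
        homogeneous_mult[OF homogeneous_var(2)] homogeneous_mult[OF homogeneous_var(3)]) auto
  moreover have "partial_x G = r * (of_nat (Suc m) * a)"
  proof -
    have "partial_x G = r * (a + (var_x * partial_x a + var_y * partial_y a + var_z * partial_z a))"
      by (simp add: G_def partial_mult c)
    then show ?thesis unfolding euler[OF h(1)] by (simp add: algebra_simps)
  qed
  moreover have "partial_y G = r * (of_nat (Suc m) * b)"
  proof -
    have "partial_y G = r * (b + (var_x * partial_x b + var_y * partial_y b + var_z * partial_z b))"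
      by (simp add: G_def partial_mult c)
    then show ?thesis unfolding euler[OF h(2)] by (simp add: algebra_simps)
  qed
  moreover have "partial_z G = r * (of_nat (Suc m) * d)"
  proof -
    have "partial_z G = r * (d + (var_x * partial_x d + var_y * partial_y d + var_z * partial_z d))"
      by (simp add: G_def partial_mult c)
    then show ?thesis unfolding euler[OF h(3)] by (simp add: algebra_simps)
  qed
  ultimately show ?thesis unfolding r Vd by (metis grad.simps)
qed

text \<open>W is the cross product of V with r = (x, y, z), divided by m + 2: its curl before
  division is 2 V + (r \<cdot> \<nabla>) V - (div V) r, and Euler's identity turns the second term
  into m V.\<close>

lemma poincare_curl:
  fixes V :: "'k::field_char_0 vec3"
  assumes V: "V \<in> hvec n" and c: "dvg V = 0"
  shows "\<exists>W\<in>hvec (n + 1). V = curl W"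
proof (cases "n < 0")
  case True
  then have "V = curl 0" using hvec_neg[OF V] by (simp add: zero_prod_def)
  moreover have "0 \<in> hvec (n + 1)" by (simp add: zero_prod_def)
  ultimately show ?thesis by blast
next
  case False
  then obtain m where n: "n = int m" by (metis nonneg_int_cases not_less)
  obtain a b d where Vd: "V = (a, b, d)" by (cases V)
  have h: "homogeneous (int m) a" "homogeneous (int m) b" "homogeneous (int m) d" using V Vd n by auto
  have c: "partial_x a + partial_y b + partial_z d = 0"
    using c by (simp add: Vd)
  define r :: "'k pol3" where "r = const3 (inverse (of_nat (Suc (Suc m))))"
  have [simp]: "partial_x r = 0" "partial_y r = 0" "partial_z r = 0" by (simp_all add: r_def)
  have r: "r * (of_nat (Suc (Suc m)) * F) = F" for F
    unfolding r_def by (rule const3_cancel) simp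
  define W where "W = (r * (var_z * b - var_y * d), r * (var_x * d - var_z * a), r * (var_y * a - var_x * b))"
  have "W \<in> hvec (n + 1)"
    unfolding W_def r_def n in_hvec using h
    by (intro conjI homogeneous_const_mult homogeneous_diff homogeneous_mult[OF homogeneous_var(1)]
        homogeneous_mult[OF homogeneous_var(2)] homogeneous_mult[OF homogeneous_var(3)]) auto
  moreover have "curl W = (r * (of_nat (Suc (Suc m)) * a), r * (of_nat (Suc (Suc m)) * b), r * (of_nat (Suc (Suc m)) * d))"
  proof -
    have "curl W = (r * (2 * a + (var_x * partial_x a + var_y * partial_y a + var_z * partial_z a)
          - var_x * (partial_x a + partial_y b + partial_z d)),
        r * (2 * b + (var_x * partial_x b + var_y * partial_y b + var_z * partial_z b)
          - var_y * (partial_x a + partial_y b + partial_z d)),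
        r * (2 * d + (var_x * partial_x d + var_y * partial_y d + var_z * partial_z d)
          - var_z * (partial_x a + partial_y b + partial_z d)))"
      by (simp add: W_def partial_mult algebra_simps)
    then show ?thesis
      unfolding euler[OF h(1)] euler[OF h(2)] euler[OF h(3)] c by (simp add: algebra_simps)
  qed
  ultimately show ?thesis unfolding r Vd by metis
qed

lemma diff0_0: "diff0 \<Omega> 0 = 0"
  by (simp add: diff0_def zero_prod_def)

lemma cross_0: "cross 0 W = 0"
  by (cases W) (simp add: zero_prod_def)

declare grad.simps [simp del]

text \<open>Irreducibility and the algebraically closed field enter the cohomology computation
  through \<open>tame_irreducible_cubic\<close>, which supplies these assumptions.\<close>

locale tame_cubic =
  fixes \<Omega> :: "'k::field_char_0 pol3"
  assumes hom: "homogeneous 3 \<Omega>" and tame: "tame \<Omega>" and nz: "\<Omega> \<noteq> 0"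
begin

lemma grad_\<Omega>: "grad \<Omega> \<in> hvec 2"
  using grad_hvec[OF hom] by simp

text \<open>\<open>tame\<close> gives a W without control of degrees; as the gradient has degree 2,
  the component of W in degree n - 2 is again a solution.\<close>

lemma koszul_homogeneous:
  assumes V: "V \<in> hvec n" "dot V (grad \<Omega>) = 0" "dvg V = 0"
  shows "\<exists>W\<in>hvec (n - 2). V = cross W (grad \<Omega>)"
proof -
  obtain a b c where Vd: "V = (a, b, c)" by (cases V)
  obtain W1 W2 W3 where W: "a = W2 * partial_z \<Omega> - W3 * partial_y \<Omega>"
    "b = W3 * partial_x \<Omega> - W1 * partial_z \<Omega>" "c = W1 * partial_y \<Omega> - W2 * partial_x \<Omega>"
    using tame V(2,3) unfolding tame_def Vd grad.simps dot.simps dvg.simps by blast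
  have h: "homogeneous n a" "homogeneous n b" "homogeneous n c" using V(1) by (auto simp: Vd)
  have h2: "homogeneous 2 (partial_x \<Omega>)" "homogeneous 2 (partial_y \<Omega>)" "homogeneous 2 (partial_z \<Omega>)"
    using grad_\<Omega> by (auto simp: grad.simps)
  define W where "W = (hom_comp (n - 2) W1, hom_comp (n - 2) W2, hom_comp (n - 2) W3)"
  have "hom_comp n a = a" "hom_comp n b = b" "hom_comp n c = c"
    using h by (simp_all add: hom_comp_homogeneous)
  then have "V = cross W (grad \<Omega>)"
    unfolding Vd W_def using h2 by (simp add: grad.simps W hom_comp_diff hom_comp_mult)
  moreover have "W \<in> hvec (n - 2)" by (simp add: W_def)
  ultimately show ?thesis by blast
qed

text \<open>If V is the cross product of W with f, div V = 0 says curl W \<cdot> f = 0. So curl W,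
  of degree n - 3, is by induction the cross product of some grad F with f, which is curl (F f).
  Then W - F f is a gradient, and subtracting F f does not change V.\<close>

lemma hamiltonian:
  assumes "V \<in> hvec n" "dot V (grad \<Omega>) = 0" "dvg V = 0"
  shows "\<exists>F. homogeneous (n - 1) F \<and> V = diff0 \<Omega> F"
proof (cases "n < 0")
  case True
  then have "V = diff0 \<Omega> 0" using hvec_neg[OF assms(1)] by (simp add: diff0_0)
  then show ?thesis by (metis homogeneous_0)
next
  case False
  then obtain m where "n = int m" by (metis nonneg_int_cases not_less)
  then show ?thesis
    using assms
  proof (induction m arbitrary: n V rule: less_induct)
    case (less m)
    obtain W where W: "W \<in> hvec (n - 2)" "V = cross W (grad \<Omega>)"
      using koszul_homogeneous[OF less.prems(2-)] by blast
    show ?case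
    proof (cases "n < 2")
      case True
      then have "V = diff0 \<Omega> 0" using hvec_neg[OF W(1)] W(2)
        by (simp add: diff0_0 cross_0 del: grad.simps)
      then show ?thesis by (metis homogeneous_0)
    next
      case False
      have U: "curl W \<in> hvec (n - 3)" "dvg (curl W) = 0" "dot (curl W) (grad \<Omega>) = 0"
        using curl_hvec[OF W(1)] dvg_curl[of W] less.prems(4) unfolding W(2) dvg_cross_grad by simp_all
      have "\<exists>F. homogeneous (n - 3 - 1) F \<and> curl W = diff0 \<Omega> F"
      proof (cases "n < 3")
        case True
        then have "curl W = diff0 \<Omega> 0" using hvec_neg[OF U(1)] by (simp add: diff0_0)
        then show ?thesis by (metis homogeneous_0)
      next
        case False
        then show ?thesis using less.IH[of "nat (n - 3)" "n - 3" "curl W"] less.prems(1) U by auto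
      qed
      then obtain F where F: "homogeneous (n - 4) F" "curl W = diff0 \<Omega> F" by auto
      have "curl (W - scal F (grad \<Omega>)) = 0"
        unfolding curl_diff curl_scal_grad F(2) diff0_def by simp
      moreover have "W - scal F (grad \<Omega>) \<in> hvec (n - 2)"
        by (intro hvec_diff W(1) scal_hvec[OF F(1) grad_\<Omega>]) simp
      ultimately obtain G where G: "homogeneous (n - 1) G" "W - scal F (grad \<Omega>) = grad G"
        using poincare_grad[of "W - scal F (grad \<Omega>)" "nat (n - 2)"] False by auto
      then have W': "W = grad G + scal F (grad \<Omega>)" by (metis diff_add_cancel)
      have "V = diff0 \<Omega> G"
        unfolding W(2) W' cross_add cross_scal_self diff0_def by simp
      then show ?thesis using G(1) by blast
    qed
  qed
qed

lemma diff0_dot_dvg: "dot (diff0 \<Omega> F) (grad \<Omega>) = 0" "dvg (diff0 \<Omega> F) = 0"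
  unfolding diff0_def dvg_cross_grad curl_grad
  by (simp_all add: dot_cross) (simp add: zero_prod_def grad.simps)

text \<open>The gradients of F and \<Omega> are parallel, so Euler's identity for both gives n F
  grad \<Omega> = 3 \<Omega> grad F. Hence \<Omega> divides F times every partial derivative of
  \<Omega>, and \<open>tame\<close> gives that \<Omega> divides F.\<close>

lemma diff0_factor:
  assumes F: "homogeneous n F" "n > 0" and d: "diff0 \<Omega> F = 0"
  shows "\<exists>G. homogeneous (n - 3) G \<and> diff0 \<Omega> G = 0 \<and> F = \<Omega> * G"
proof -
  have e: "partial_y F * partial_z \<Omega> = partial_z F * partial_y \<Omega>" "partial_z F * partial_x \<Omega> = partial_x F * partial_z \<Omega>"
    "partial_x F * partial_y \<Omega> = partial_y F * partial_x \<Omega>"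
    using d by (simp_all add: diff0_def zero_prod_def grad.simps)
  obtain m where m: "n = int m" "m > 0" using F(2) by (metis zero_less_imp_eq_int)
  have eF: "of_nat m * F = var_x * partial_x F + var_y * partial_y F + var_z * partial_z F"
    using euler[OF F(1)] m by simp
  have e\<Omega>: "3 * \<Omega> = var_x * partial_x \<Omega> + var_y * partial_y \<Omega> + var_z * partial_z \<Omega>"
    using euler[OF hom] by simp
  have "of_nat m * F * partial_x \<Omega> = 3 * \<Omega> * partial_x F"
    unfolding eF e\<Omega> using e by (simp add: algebra_simps; metis mult.left_commute)
  moreover have "of_nat m * F * partial_y \<Omega> = 3 * \<Omega> * partial_y F"
    unfolding eF e\<Omega> using e by (simp add: algebra_simps; metis mult.left_commute)
  moreover have "of_nat m * F * partial_z \<Omega> = 3 * \<Omega> * partial_z F"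
    unfolding eF e\<Omega> using e by (simp add: algebra_simps; metis mult.left_commute)
  ultimately have "\<Omega> dvd of_nat m * F * partial_x \<Omega>" "\<Omega> dvd of_nat m * F * partial_y \<Omega>"
    "\<Omega> dvd of_nat m * F * partial_z \<Omega>" by (simp_all add: mult.commute[of 3] mult.assoc)
  then have "\<Omega> dvd of_nat m * F" using tame unfolding tame_def by blast
  then have "\<Omega> dvd const3 (inverse (of_nat m)) * (of_nat m * F)" by (rule dvd_mult)
  then have "\<Omega> dvd F" using const3_cancel[of m F] m(2) by simp
  then obtain G where G: "F = \<Omega> * G" by blast
  have "scal \<Omega> (diff0 \<Omega> G) = diff0 \<Omega> F"
    by (simp add: diff0_def G partial_mult grad.simps algebra_simps)
  then have "diff0 \<Omega> G = 0" using d nz by (cases "diff0 \<Omega> G") (simp add: zero_prod_def)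
  moreover have "homogeneous (n - 3) G" using homogeneous_factor[OF hom nz] F(1) G by blast
  ultimately show ?thesis using G by blast
qed

lemma diff0_power: "diff0 \<Omega> (const3 c * \<Omega> ^ m) = 0"
  by (simp add: diff0_def partial_mult partial_power zero_prod_def grad.simps algebra_simps)

lemma ker_diff0:
  "{F \<in> hpol n. diff0 \<Omega> F = 0} =
    (if n \<ge> 0 \<and> 3 dvd n then range (\<lambda>c. sc1 c (\<Omega> ^ nat (n div 3))) else {0})"
proof (cases "n < 0")
  case True
  then show ?thesis by (auto simp: hpol_neg diff0_0)
next
  case False
  have 1: "(if 3 dvd n then \<exists>c. F = const3 c * \<Omega> ^ nat (n div 3) else F = 0)"
    if "n = int m" "homogeneous n F" "diff0 \<Omega> F = 0" for m n F
    using that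
  proof (induction m arbitrary: n F rule: less_induct)
    case (less m)
    show ?case
    proof (cases "n = 0")
      case True
      then show ?thesis using less.prems(2) by (simp add: homogeneous_zero_iff)
    next
      case False
      then obtain G where G: "homogeneous (n - 3) G" "diff0 \<Omega> G = 0" "F = \<Omega> * G"
        using diff0_factor[OF less.prems(2) _ less.prems(3)] less.prems(1) by auto
      show ?thesis
      proof (cases "n < 3")
        case True
        then have "G = 0" using homogeneous_neg[OF G(1)] by simp
        moreover have "\<not> 3 dvd n" using True False less.prems(1) by presburger
        ultimately show ?thesis using G(3) by simp
      next
        case False
        have IH: "if 3 dvd n - 3 then \<exists>c. G = const3 c * \<Omega> ^ nat ((n - 3) div 3) else G = 0"
          by (rule less.IH[of "nat (n - 3)"]) (use False less.prems(1) G in auto)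
        have dv: "3 dvd n - 3 \<longleftrightarrow> 3 dvd n" by presburger
        have "nat (n div 3) = Suc (nat ((n - 3) div 3))" using False by linarith
        then show ?thesis using IH unfolding dv G(3) by (auto simp: algebra_simps)
      qed
    qed
  qed
  have 2: "homogeneous n (\<Omega> ^ nat (n div 3))" if "3 dvd n"
  proof -
    have "int (nat (n div 3)) * 3 = n" using that False by auto
    then show ?thesis using homogeneous_power[OF hom, of "nat (n div 3)"] by metis
  qed
  show ?thesis
  proof (cases "3 dvd n")
    case True
    then show ?thesis
      using 1[of n "nat n"] 2 False diff0_power by (auto simp: hpol_def sc1_def)
  next
    case F: False
    then show ?thesis
      using 1[of n "nat n"] False by (auto simp: hpol_def diff0_0)
  qed
qed

end

section \<open>Ranks of the differentials\<close>

lemma grad_add: "grad (F + G) = grad F + grad G"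
  by (simp add: grad.simps)

lemma grad_const: "grad (const3 c * F) = scal (const3 c) (grad F)"
  by (simp add: grad.simps partial_mult)

lemma vec_linear:
  "dvg (U + V) = dvg U + dvg V" "dot (U + V) W = dot U W + dot V W" "curl (U + V) = curl U + curl V"
  "scal (F + G) W = scal F W + scal G W" "scal H (U + V) = scal H U + scal H V"
  by (cases U; cases V; cases W; simp add: algebra_simps)+

lemma vec_linear_const:
  "dvg (scal (const3 c) V) = const3 c * dvg V" "dot (scal H V) W = H * dot V W"
  "curl (scal (const3 c) V) = scal (const3 c) (curl V)" "scal (H * F) W = scal H (scal F W)"
  "cross (scal H V) W = scal H (cross V W)"
  by (cases V; cases W; simp add: partial_mult algebra_simps)+

lemma scal_diff: "scal H (U - V) = scal H U - scal H V"
  by (cases U; cases V; simp add: algebra_simps)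

lemma diff0_add: "diff0 \<Omega> (F + G) = diff0 \<Omega> F + diff0 \<Omega> G"
  by (simp add: diff0_def grad_add cross_add)

lemma diff0_const: "diff0 \<Omega> (const3 c * F) = scal (const3 c) (diff0 \<Omega> F)"
  by (simp add: diff0_def grad_const vec_linear_const)

lemma diff1_add: "diff1 \<Omega> (U + V) = diff1 \<Omega> U + diff1 \<Omega> V"
  by (simp add: diff1_def vec_linear grad_add)

lemma diff1_const: "diff1 \<Omega> (scal (const3 c) V) = scal (const3 c) (diff1 \<Omega> V)"
  by (simp add: diff1_def vec_linear_const grad_const scal_diff)

lemma diff2_add: "diff2 \<Omega> (U + V) = diff2 \<Omega> U + diff2 \<Omega> V"
  by (simp add: diff2_def vec_linear)

lemma diff2_const: "diff2 \<Omega> (scal (const3 c) V) = const3 c * diff2 \<Omega> V"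
  by (simp add: diff2_def vec_linear_const)

definition poly_dim :: "int \<Rightarrow> nat" where
  "poly_dim n = (if n < 0 then 0 else nat ((n + 1) * (n + 2) div 2))"

lemma sdim_hpol_poly_dim: "sdim sc1 (hpol n :: 'k::field_char_0 pol3 set) = poly_dim n"
  and sdim_hvec_poly_dim: "sdim sc3 (hvec n :: 'k::field_char_0 vec3 set) = 3 * poly_dim n"
  by (simp_all add: sdim_hvec sdim_hpol poly_dim_def)

text \<open>The dimension of k[\<Omega>] in degree d.\<close>

definition casimir_dim :: "int \<Rightarrow> nat" where
  "casimir_dim d = (if d \<ge> 0 \<and> 3 dvd d then 1 else 0)"

context tame_cubic
begin

abbreviation "Z0 d \<equiv> {F \<in> hpol d. diff0 \<Omega> F = 0}"
abbreviation "Z1 d \<equiv> {V \<in> hvec (d + 1). diff1 \<Omega> V = 0}"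
abbreviation "Z2 d \<equiv> {V \<in> hvec (d + 2). diff2 \<Omega> V = 0}"
abbreviation "B1 d \<equiv> diff0 \<Omega> ` hpol d"
abbreviation "B2 d \<equiv> diff1 \<Omega> ` hvec (d + 1)"
abbreviation "B3 d \<equiv> diff2 \<Omega> ` hvec (d + 2)"

text \<open>The exponent m is not tied to n: the same count serves for the Casimirs of degree n and,
  in \<open>sdim_Z1\<close>, for their multiples by \<Omega>.\<close>

lemma sdim_powers:
  "sdim sc1 (if n \<ge> 0 \<and> 3 dvd n then range (\<lambda>c. sc1 c (\<Omega> ^ m)) else {0}) = casimir_dim n"
  using sdim_line[OF vector_space_sc1, of "\<Omega> ^ m"] nz sdim_zero[OF vector_space_sc1]
  by (auto simp: casimir_dim_def)

lemma sdim_Z0: "sdim sc1 (Z0 d) = casimir_dim d"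
  unfolding ker_diff0 by (rule sdim_powers)

lemma rank_diff0: "sdim sc3 (B1 d) + casimir_dim d = poly_dim d"
proof -
  have "sdim sc3 (B1 d) + sdim sc1 (Z0 d) = sdim sc1 (hpol d :: 'k pol3 set)"
    by (rule rank_nullity_vmod(3)[where h = "diff0 \<Omega>", OF findim_hpol vector_space_sc3])
      (simp_all add: diff0_add sc1_def sc3_def diff0_const)
  then show ?thesis by (simp only: sdim_Z0 sdim_hpol_poly_dim)
qed

lemma findim_Z0: "findim sc1 (Z0 d)"
  by (rule rank_nullity_vmod(2)[where h = "diff0 \<Omega>", OF findim_hpol vector_space_sc3])
    (simp_all add: diff0_add sc1_def sc3_def diff0_const)

lemma rank_diff1: "sdim sc3 (B2 d) + sdim sc3 (Z1 d) = 3 * poly_dim (d + 1)" and findim_Z1: "findim sc3 (Z1 d)"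
proof -
  note rn = rank_nullity_vmod[where S = "hvec (d + 1) :: 'k vec3 set" and h = "diff1 \<Omega>",
      OF findim_hvec vector_space_sc3]
  have "sdim sc3 (B2 d) + sdim sc3 (Z1 d) = sdim sc3 (hvec (d + 1) :: 'k vec3 set)"
    by (rule rn) (simp_all add: diff1_add sc3_def diff1_const)
  then show "sdim sc3 (B2 d) + sdim sc3 (Z1 d) = 3 * poly_dim (d + 1)" by (simp only: sdim_hvec_poly_dim)
  show "findim sc3 (Z1 d)" by (rule rn) (simp_all add: diff1_add sc3_def diff1_const)
qed

lemma rank_diff2: "sdim sc1 (B3 d) + sdim sc3 (Z2 d) = 3 * poly_dim (d + 2)" and findim_Z2: "findim sc3 (Z2 d)"
proof -
  note rn = rank_nullity_vmod[where S = "hvec (d + 2) :: 'k vec3 set" and h = "diff2 \<Omega>",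
      OF findim_hvec vector_space_sc1]
  have "sdim sc1 (B3 d) + sdim sc3 (Z2 d) = sdim sc3 (hvec (d + 2) :: 'k vec3 set)"
    by (rule rn) (simp_all add: diff2_add sc3_def sc1_def diff2_const)
  then show "sdim sc1 (B3 d) + sdim sc3 (Z2 d) = 3 * poly_dim (d + 2)" by (simp only: sdim_hvec_poly_dim)
  show "findim sc3 (Z2 d)" by (rule rn) (simp_all add: diff2_add sc3_def sc1_def diff2_const)
qed

lemma dvg_surj: "dvg ` hvec (d + 1) = (hpol d :: 'k pol3 set)"
proof
  show "dvg ` hvec (d + 1) \<subseteq> (hpol d :: 'k pol3 set)" using dvg_hpol by (fastforce simp: hpol_def)
  show "hpol d \<subseteq> dvg ` (hvec (d + 1) :: 'k vec3 set)"
  proof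
    fix F :: "'k pol3" assume "F \<in> hpol d"
    then have F: "homogeneous d F" by (simp add: hpol_def)
    show "F \<in> dvg ` hvec (d + 1)"
    proof (cases "d < 0")
      case True
      then have "F = dvg 0" using homogeneous_neg[OF F] by (simp add: zero_prod_def)
      moreover have "0 \<in> hvec (d + 1)" by (simp add: zero_prod_def)
      ultimately show ?thesis by blast
    next
      case False
      then obtain m where d: "d = int m" by (metis nonneg_int_cases not_less)
      \<comment> \<open>By Euler's identity the divergence of F (x, y, z) is (m + 3) F.\<close>
      define r :: "'k pol3" where "r = const3 (inverse (of_nat (m + 3)))"
      define V where "V = scal r (scal F (var_x, var_y, var_z))"
      have "dvg V = r * (3 * F + (var_x * partial_x F + var_y * partial_y F + var_z * partial_z F))"
        by (simp add: V_def r_def partial_mult algebra_simps)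
      also have "\<dots> = r * (of_nat (m + 3) * F)"
        unfolding euler[OF F] by (simp add: d algebra_simps)
      also have "\<dots> = F" unfolding r_def by (rule const3_cancel) simp
      finally have "F = dvg V" ..
      moreover have "V \<in> hvec (d + 1)"
        unfolding V_def r_def
        by (rule scal_hvec[OF homogeneous_const3 scal_hvec[OF F]]) (auto simp: homogeneous_var)
      ultimately show ?thesis by blast
    qed
  qed
qed

lemma rank_dvg: "poly_dim d + sdim sc3 {V \<in> hvec (d + 1). dvg V = (0 :: 'k pol3)} = 3 * poly_dim (d + 1)"
  and findim_dvg: "findim sc3 {V \<in> hvec (d + 1). dvg V = (0 :: 'k pol3)}"
proof -
  note rn = rank_nullity_vmod[where S = "hvec (d + 1) :: 'k vec3 set" and h = dvg,
      OF findim_hvec vector_space_sc1]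
  have "sdim sc1 (dvg ` hvec (d + 1) :: 'k pol3 set) + sdim sc3 {V \<in> hvec (d + 1). dvg V = (0 :: 'k pol3)} =
      sdim sc3 (hvec (d + 1) :: 'k vec3 set)"
    by (rule rn) (simp_all add: vec_linear sc3_def sc1_def vec_linear_const)
  then show "poly_dim d + sdim sc3 {V \<in> hvec (d + 1). dvg V = (0 :: 'k pol3)} = 3 * poly_dim (d + 1)"
    by (simp only: sdim_hvec_poly_dim sdim_hpol_poly_dim dvg_surj)
  show "findim sc3 {V \<in> hvec (d + 1). dvg V = (0 :: 'k pol3)}"
    by (rule rn) (simp_all add: vec_linear sc3_def sc1_def vec_linear_const)
qed

text \<open>Divergence-free fields are exactly the curls, so \<open>B3 d\<close> is the image of V
  -> - V \<cdot> grad \<Omega> on them; by \<open>hamiltonian\<close> the kernel is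
  \<open>B1 d\<close>. This finds the rank of the last differential without its kernel.\<close>

lemma rank_dot: "sdim sc1 (B3 d) + sdim sc3 (B1 d) = sdim sc3 {V \<in> hvec (d + 1). dvg V = (0 :: 'k pol3)}"
proof -
  let ?D = "{V \<in> hvec (d + 1). dvg V = (0 :: 'k pol3)}"
  let ?h = "\<lambda>V. - dot V (grad \<Omega>)"
  have D: "?D = curl ` hvec (d + 2)"
  proof
    show "?D \<subseteq> curl ` hvec (d + 2)"
    proof
      fix V assume "V \<in> ?D"
      then obtain W where "W \<in> hvec (d + 1 + 1)" "V = curl W" using poincare_curl[of V "d + 1"] by auto
      moreover have "d + 1 + 1 = d + 2" by simp
      ultimately show "V \<in> curl ` hvec (d + 2)" by (metis image_eqI)
    qed
    show "curl ` hvec (d + 2) \<subseteq> ?D"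
    proof (rule image_subsetI)
      fix V :: "'k vec3" assume "V \<in> hvec (d + 2)"
      then show "curl V \<in> ?D" using curl_hvec[of V "d + 2"] dvg_curl[of V] by (simp add: add.commute)
    qed
  qed
  have im: "?h ` ?D = B3 d"
    unfolding D image_image by (simp add: diff2_def)
  have ker: "{V \<in> ?D. ?h V = 0} = B1 d"
  proof
    show "{V \<in> ?D. ?h V = 0} \<subseteq> B1 d"
      using hamiltonian[of _ "d + 1"] by (fastforce simp: hpol_def)
    show "B1 d \<subseteq> {V \<in> ?D. ?h V = 0}"
    proof
      fix V assume "V \<in> B1 d"
      then obtain F where F: "homogeneous d F" "V = diff0 \<Omega> F" by (auto simp: hpol_def)
      have "V \<in> hvec (d + 1)"
        unfolding F(2) diff0_def by (rule cross_hvec[OF grad_hvec[OF F(1)] grad_\<Omega>]) simp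
      then show "V \<in> {V \<in> ?D. ?h V = 0}" using diff0_dot_dvg[of F] F(2) by simp
    qed
  qed
  have "sdim sc1 (?h ` ?D) + sdim sc3 {V \<in> ?D. ?h V = 0} = sdim sc3 ?D"
    by (rule rank_nullity_vmod(3)[where h = ?h, OF findim_dvg vector_space_sc1])
      (simp_all add: vec_linear vec_linear_const sc3_def sc1_def)
  then show ?thesis unfolding im ker .
qed

lemma diff1_diff0: "diff1 \<Omega> (diff0 \<Omega> F) = 0"
  by (simp add: diff1_def diff0_dot_dvg) (simp add: zero_prod_def grad.simps)

lemma diff2_diff1: "diff2 \<Omega> (diff1 \<Omega> V) = 0"
proof -
  have "curl (diff1 \<Omega> V) = cross (grad (dvg V)) (grad \<Omega>)"
    by (simp add: diff1_def curl_diff curl_scal_grad curl_grad)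
  then show ?thesis by (simp add: diff2_def dot_cross)
qed

text \<open>Casimir multiples of the Euler field: the divergence 3 (m + 1) c \<Omega>^m times grad
  \<Omega> equals the gradient of 3 c \<Omega>^(m+1). They represent the classes of PH^1.\<close>

lemma diff1_euler_field:
  fixes c :: 'k and m :: nat
  defines "P \<equiv> const3 c * \<Omega> ^ m"
  defines "V \<equiv> scal P (var_x, var_y, var_z)"
  shows "diff1 \<Omega> V = 0" "dot V (grad \<Omega>) = const3 (3 * c) * \<Omega> ^ Suc m" "V \<in> hvec (3 * int m + 1)"
proof -
  have P: "homogeneous (3 * int m) P"
    unfolding P_def using homogeneous_power[OF hom, of m] by (auto simp: mult.commute)
  show "V \<in> hvec (3 * int m + 1)"
    unfolding V_def by (rule scal_hvec[OF P]) (auto simp: homogeneous_var)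
  have e\<Omega>: "var_x * partial_x \<Omega> + var_y * partial_y \<Omega> + var_z * partial_z \<Omega> = 3 * \<Omega>"
    using euler[OF hom] by simp
  have "dot V (grad \<Omega>) = P * (var_x * partial_x \<Omega> + var_y * partial_y \<Omega> + var_z * partial_z \<Omega>)"
    by (simp add: V_def grad.simps algebra_simps)
  then have dot: "dot V (grad \<Omega>) = P * (3 * \<Omega>)" unfolding e\<Omega> .
  then show d: "dot V (grad \<Omega>) = const3 (3 * c) * \<Omega> ^ Suc m"
    by (simp add: P_def const3_hom const3_numeral algebra_simps)
  have "dvg V = 3 * P + (var_x * partial_x P + var_y * partial_y P + var_z * partial_z P)"
    by (simp add: V_def partial_mult algebra_simps)
  then have dvg: "dvg V = (3 * of_nat m + 3) * P" unfolding euler[OF P] by (simp add: algebra_simps)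
  have "grad (const3 (3 * c) * \<Omega> ^ Suc m) = scal (const3 (3 * c) * (of_nat (Suc m) * \<Omega> ^ m)) (grad \<Omega>)"
    unfolding grad_const vec_linear_const(4)[of "const3 (3 * c)"]
    unfolding grad.simps partial_power scal.simps diff_Suc_1 ..
  then show "diff1 \<Omega> V = 0"
    unfolding diff1_def dvg d by (simp add: P_def const3_hom const3_numeral algebra_simps)
qed

text \<open>For a cocycle V, H = V \<cdot> grad \<Omega> satisfies grad H = (div V) grad \<Omega>,
  so H is a Casimir. If H = 0 then div V = 0 and V is Hamiltonian; multiples of the Euler field
  attain the values in \<Omega> k[\<Omega>].\<close>

lemma sdim_Z1: "sdim sc3 (Z1 d) = sdim sc3 (B1 d) + casimir_dim d"
proof -
  let ?h = "\<lambda>V. dot V (grad \<Omega>)"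
  have ker: "{V \<in> Z1 d. ?h V = 0} = B1 d"
  proof
    show "{V \<in> Z1 d. ?h V = 0} \<subseteq> B1 d"
    proof
      fix V assume V: "V \<in> {V \<in> Z1 d. ?h V = 0}"
      then have "scal (dvg V) (grad \<Omega>) = 0"
        by (simp add: diff1_def) (simp add: grad.simps zero_prod_def)
      moreover have "grad \<Omega> \<noteq> 0"
        using euler[OF hom] nz by (auto simp: grad.simps zero_prod_def)
      ultimately have "dvg V = 0" by (cases "grad \<Omega>") (auto simp: zero_prod_def)
      then obtain F where "homogeneous d F" "V = diff0 \<Omega> F"
        using hamiltonian[of V "d + 1"] V by auto
      then show "V \<in> B1 d" by (auto simp: hpol_def)
    qed
    show "B1 d \<subseteq> {V \<in> Z1 d. ?h V = 0}"
    proof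
      fix V assume "V \<in> B1 d"
      then obtain F where F: "homogeneous d F" "V = diff0 \<Omega> F" by (auto simp: hpol_def)
      have "V \<in> hvec (d + 1)"
        unfolding F(2) diff0_def by (rule cross_hvec[OF grad_hvec[OF F(1)] grad_\<Omega>]) simp
      then show "V \<in> {V \<in> Z1 d. ?h V = 0}" using diff0_dot_dvg[of F] diff1_diff0[of F] F(2) by simp
    qed
  qed
  let ?P = "if d \<ge> 0 \<and> 3 dvd d then range (\<lambda>c. sc1 c (\<Omega> ^ Suc (nat (d div 3)))) else {0}"
  have im: "?h ` Z1 d = ?P"
  proof
    show "?h ` Z1 d \<subseteq> ?P"
    proof
      fix H assume "H \<in> ?h ` Z1 d"
      then obtain V where V: "V \<in> hvec (d + 1)" "diff1 \<Omega> V = 0" "H = dot V (grad \<Omega>)" by auto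
      have "grad H = scal (dvg V) (grad \<Omega>)" using V(2,3) by (simp add: diff1_def)
      then have "diff0 \<Omega> H = 0" by (simp add: diff0_def cross_scal_self)
      moreover have "homogeneous (d + 3) H"
        unfolding V(3) by (rule dot_hpol[OF V(1) grad_\<Omega>]) simp
      ultimately have H: "H \<in> (if d + 3 \<ge> 0 \<and> 3 dvd d + 3 then range (\<lambda>c. sc1 c (\<Omega> ^ nat ((d + 3) div 3))) else {0})"
        using ker_diff0[of "d + 3"] by (auto simp: hpol_def)
      show "H \<in> ?P"
      proof (cases "d < 0")
        case True
        \<comment> \<open>In degree d = -3 the constants are Casimirs of degree d + 3, but no
          nonzero field of degree -2 exists; this is why the image is \<Omega> k[\<Omega>].\<close>
        have "d = - 3 \<Longrightarrow> H = 0" using V(3) hvec_neg[OF V(1)] by (simp add: zero_prod_def grad.simps)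
        then have "H = 0" using H True by (auto split: if_splits)
        then show ?thesis using True by simp
      next
        case False
        then have e: "nat ((d + 3) div 3) = Suc (nat (d div 3))" by linarith
        have "3 dvd d + 3 \<longleftrightarrow> 3 dvd d" "0 \<le> d + 3 \<longleftrightarrow> 0 \<le> d" using False by presburger+
        then show ?thesis using H unfolding e by (simp only:)
      qed
    qed
    show "?P \<subseteq> ?h ` Z1 d"
    proof (cases "d \<ge> 0 \<and> 3 dvd d")
      case True
      have "sc1 c (\<Omega> ^ Suc (nat (d div 3))) \<in> ?h ` Z1 d" for c
      proof -
        let ?V = "scal (const3 (c / 3) * \<Omega> ^ nat (d div 3)) (var_x, var_y, var_z)"
        have "3 * int (nat (d div 3)) + 1 = d + 1" using True by auto
        then have V: "?V \<in> Z1 d" using diff1_euler_field(1,3)[of "c / 3" "nat (d div 3)"] by simp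
        have "sc1 c (\<Omega> ^ Suc (nat (d div 3))) = ?h ?V"
          using diff1_euler_field(2)[of "c / 3" "nat (d div 3)"] by (simp add: sc1_def)
        then show ?thesis by (rule image_eqI[OF _ V])
      qed
      then have "range (\<lambda>c. sc1 c (\<Omega> ^ Suc (nat (d div 3)))) \<subseteq> ?h ` Z1 d" by blast
      then show ?thesis unfolding if_P[OF True] .
    next
      case False
      have "0 \<in> Z1 d" by (simp add: zero_prod_def diff1_def grad.simps)
      then have "?h 0 \<in> ?h ` Z1 d" by blast
      moreover have "?h 0 = 0" by (simp add: zero_prod_def grad.simps)
      ultimately show ?thesis unfolding if_not_P[OF False] by simp
    qed
  qed
  have "sdim sc1 (?h ` Z1 d) + sdim sc3 {V \<in> Z1 d. ?h V = 0} = sdim sc3 (Z1 d)"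
    by (rule rank_nullity_vmod(3)[where h = ?h, OF findim_Z1 vector_space_sc1])
      (simp_all add: vec_linear vec_linear_const sc3_def sc1_def)
  then show ?thesis unfolding im ker sdim_powers by simp
qed

end

section \<open>The graded components of Poisson cohomology\<close>

lemma cocycle_module_coset: "N +>\<^bsub>cocycle_module br q\<^esub> Q = (\<lambda>P Fs. P Fs + Q Fs) ` N"
  by (auto simp: a_r_coset_def' cocycle_module_def)

lemma PH_component_simps [simp]:
  "carrier (PH_component br q d) =
     {coboundaries br q +>\<^bsub>cocycle_module br q\<^esub> Q |Q. Q \<in> cocycles br q \<and> has_degree q d Q}"
  "\<zero>\<^bsub>PH_component br q d\<^esub> = coboundaries br q"
  "X \<oplus>\<^bsub>PH_component br q d\<^esub> Y = {(\<lambda>Fs. P Fs + Q Fs) |P Q. P \<in> X \<and> Q \<in> Y}"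
  "c \<odot>\<^bsub>PH_component br q d\<^esub> X =
     (\<Union>P\<in>X. coboundaries br q +>\<^bsub>cocycle_module br q\<^esub> (\<lambda>Fs. const3 c * P Fs))"
  by (auto simp: PH_component_def PH_def quotient_module_def set_add_def' cocycle_module_def)

text \<open>\<Phi> parametrises the cocycles of degree d by polynomial data. Sending u to the coset
  of \<Phi> u is a linear map of S onto the component with kernel K, so the component inherits its
  vector space structure and its dimension by rank-nullity.\<close>

lemma PH_component_dim:
  fixes \<Phi> :: "'v::ab_group_add \<Rightarrow> 'k::field_char_0 pol3 list \<Rightarrow> 'k pol3"
  assumes S: "findim s S" and im: "\<Phi> ` S = {Q \<in> cocycles br q. has_degree q d Q}"
    and \<Phi>_add: "\<And>u v. \<Phi> (u + v) = (\<lambda>Fs. \<Phi> u Fs + \<Phi> v Fs)"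
    and \<Phi>_smult: "\<And>c u. \<Phi> (s c u) = (\<lambda>Fs. const3 c * \<Phi> u Fs)"
    and B_0: "(\<lambda>_. 0) \<in> coboundaries br q"
    and B_add: "\<And>P Q. P \<in> coboundaries br q \<Longrightarrow> Q \<in> coboundaries br q \<Longrightarrow> (\<lambda>Fs. P Fs + Q Fs) \<in> coboundaries br q"
    and B_smult: "\<And>c P. P \<in> coboundaries br q \<Longrightarrow> (\<lambda>Fs. const3 c * P Fs) \<in> coboundaries br q"
    and ker: "{u \<in> S. \<Phi> u \<in> coboundaries br q} = K"
  shows "vectorspace class_ring (PH_component br q d)"
    "vectorspace.fin_dim class_ring (PH_component br q d)"
    "vectorspace.dim class_ring (PH_component br q d) + sdim s K = sdim s S"
proof -
  define B where "B = coboundaries br q"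
  note B_0 = B_0[folded B_def] and B_add = B_add[folded B_def] and B_smult = B_smult[folded B_def]
  define h where "h u = (\<lambda>P Fs. P Fs + \<Phi> u Fs) ` B" for u
  have B_minus: "(\<lambda>Fs. P Fs - Q Fs) \<in> B" if "P \<in> B" "Q \<in> B" for P Q
    using B_add[OF that(1) B_smult[OF that(2), of "- 1"]] by simp
  have \<Phi>_0: "\<Phi> 0 = (\<lambda>_. 0)"
    using fun_cong[OF \<Phi>_add[of 0 0]] by (intro ext) simp
  have surj: "h ` S = carrier (PH_component br q d)"
  proof -
    have "carrier (PH_component br q d) = (\<lambda>Q. (\<lambda>P Fs. P Fs + Q Fs) ` B) ` (\<Phi> ` S)"
      unfolding im by (auto simp: cocycle_module_coset B_def)
    then show ?thesis by (simp add: image_image h_def)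
  qed
  have add: "h (u + v) = h u \<oplus>\<^bsub>PH_component br q d\<^esub> h v" for u v
  proof (intro equalityI subsetI)
    fix Q assume "Q \<in> h (u + v)"
    then obtain P where P: "P \<in> B" "Q = (\<lambda>Fs. P Fs + (\<Phi> u Fs + \<Phi> v Fs))" by (auto simp: h_def \<Phi>_add)
    have 1: "(\<lambda>Fs. P Fs + \<Phi> u Fs) \<in> h u" using P(1) by (simp add: h_def)
    have 2: "(\<lambda>Fs. 0 + \<Phi> v Fs) \<in> h v" unfolding h_def using B_0 by (rule rev_image_eqI) simp
    have "Q = (\<lambda>Fs. (P Fs + \<Phi> u Fs) + (0 + \<Phi> v Fs))" by (simp add: P(2) add.assoc)
    then show "Q \<in> h u \<oplus>\<^bsub>PH_component br q d\<^esub> h v"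
      unfolding PH_component_simps
      by (intro CollectI exI[of _ "\<lambda>Fs. P Fs + \<Phi> u Fs"] exI[of _ "\<lambda>Fs. 0 + \<Phi> v Fs"] conjI 1 2)
  next
    fix Q assume "Q \<in> h u \<oplus>\<^bsub>PH_component br q d\<^esub> h v"
    then obtain P P' where P: "P \<in> B" "P' \<in> B" "Q = (\<lambda>Fs. (P Fs + \<Phi> u Fs) + (P' Fs + \<Phi> v Fs))"
      by (auto simp: h_def)
    then have "Q = (\<lambda>Fs. (P Fs + P' Fs) + \<Phi> (u + v) Fs)" by (simp add: \<Phi>_add algebra_simps)
    then show "Q \<in> h (u + v)" unfolding h_def using B_add[OF P(1,2)] by (rule image_eqI)
  qed
  have smult: "h (s c u) = c \<odot>\<^bsub>PH_component br q d\<^esub> h u" for c u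
  proof (intro equalityI subsetI)
    fix Q assume "Q \<in> h (s c u)"
    then obtain P where P: "P \<in> B" "Q = (\<lambda>Fs. P Fs + const3 c * \<Phi> u Fs)" by (auto simp: h_def \<Phi>_smult)
    have "\<Phi> u \<in> h u" unfolding h_def using B_0 by (rule rev_image_eqI) simp
    then show "Q \<in> c \<odot>\<^bsub>PH_component br q d\<^esub> h u"
      unfolding PH_component_simps cocycle_module_coset B_def[symmetric] using P by blast
  next
    fix Q assume "Q \<in> c \<odot>\<^bsub>PH_component br q d\<^esub> h u"
    then obtain P P' where P: "P \<in> B" "P' \<in> B" "Q = (\<lambda>Fs. P Fs + const3 c * (P' Fs + \<Phi> u Fs))"
      by (auto simp: h_def cocycle_module_coset B_def)
    then have "Q = (\<lambda>Fs. (P Fs + const3 c * P' Fs) + \<Phi> (s c u) Fs)" by (simp add: \<Phi>_smult algebra_simps)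
    then show "Q \<in> h (s c u)" unfolding h_def using B_add[OF P(1) B_smult[OF P(2)]] by (rule image_eqI)
  qed
  have zero: "h 0 = \<zero>\<^bsub>PH_component br q d\<^esub>" by (simp add: h_def \<Phi>_0 B_def)
  have "h u = \<zero>\<^bsub>PH_component br q d\<^esub> \<longleftrightarrow> \<Phi> u \<in> B" for u
  proof
    assume "h u = \<zero>\<^bsub>PH_component br q d\<^esub>"
    moreover have "\<Phi> u \<in> h u" unfolding h_def using B_0 by (rule rev_image_eqI) simp
    ultimately show "\<Phi> u \<in> B" by (simp add: B_def)
  next
    assume u: "\<Phi> u \<in> B"
    have "h u = B"
    proof (intro equalityI subsetI)
      show "Q \<in> B" if "Q \<in> h u" for Q using that B_add[OF _ u] by (auto simp: h_def)
      show "Q \<in> h u" if "Q \<in> B" for Q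
        unfolding h_def using B_minus[OF that u] by (rule rev_image_eqI) simp
    qed
    then show "h u = \<zero>\<^bsub>PH_component br q d\<^esub>" by (simp add: B_def)
  qed
  then have K: "{u \<in> S. h u = \<zero>\<^bsub>PH_component br q d\<^esub>} = K" using ker unfolding B_def by blast
  note * = surj_rank_nullity[where h = h and M = "PH_component br q d", OF S surj add smult zero]
  show "vectorspace class_ring (PH_component br q d)" by (rule *(1))
  show "vectorspace.fin_dim class_ring (PH_component br q d)" by (rule *(2))
  show "vectorspace.dim class_ring (PH_component br q d) + sdim s K = sdim s S" using *(3) unfolding K .
qed

lemma ext_add:
  "ext0 (F + G) = (\<lambda>Fs. ext0 F Fs + ext0 G Fs)" "ext1 (U + V) = (\<lambda>Fs. ext1 U Fs + ext1 V Fs)"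
  "ext2 (U + V) = (\<lambda>Fs. ext2 U Fs + ext2 V Fs)" "ext3 (F + G) = (\<lambda>Fs. ext3 F Fs + ext3 G Fs)"
  by (cases U; cases V; auto simp: ext0_def ext1_def ext2_def ext3_def algebra_simps fun_eq_iff split: list.split)+

lemma ext_smult:
  "ext0 (sc1 c F) = (\<lambda>Fs. const3 c * ext0 F Fs)" "ext1 (sc3 c V) = (\<lambda>Fs. const3 c * ext1 V Fs)"
  "ext2 (sc3 c V) = (\<lambda>Fs. const3 c * ext2 V Fs)" "ext3 (sc1 c F) = (\<lambda>Fs. const3 c * ext3 F Fs)"
  by (cases V; auto simp: sc1_def ext0_def ext1_def ext2_def ext3_def algebra_simps fun_eq_iff split: list.split)+

lemma app1_inj: "(\<And>F. app1 U F = app1 V F) \<Longrightarrow> U = V"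
  apply (cases U; cases V)
  subgoal premises p for a b c a' b' c'
    using p(1)[of var_x] p(1)[of var_y] p(1)[of var_z] by (simp add: p)
  done

lemma app2_inj: "(\<And>F G. app2 U F G = app2 V F G) \<Longrightarrow> U = V"
  apply (cases U; cases V)
  subgoal premises p for a b c a' b' c'
    using p(1)[of var_y var_z] p(1)[of var_z var_x] p(1)[of var_x var_y] by (simp add: p)
  done

lemma ext_inj:
  "inj (ext0 :: 'k::idom pol3 \<Rightarrow> _)" "inj (ext1 :: 'k vec3 \<Rightarrow> _)"
  "inj (ext2 :: 'k vec3 \<Rightarrow> _)" "inj (ext3 :: 'k pol3 \<Rightarrow> _)"
proof -
  show "inj (ext0 :: 'k pol3 \<Rightarrow> _)" by (rule injI) (metis ext_simps(1))
  show "inj (ext1 :: 'k vec3 \<Rightarrow> _)" by (rule injI, rule app1_inj) (metis ext_simps(2))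
  show "inj (ext2 :: 'k vec3 \<Rightarrow> _)" by (rule injI, rule app2_inj) (metis ext_simps(3))
  have "jacobian_bracket var_x var_y var_z = (1 :: 'k pol3)" by (simp add: jacobian_bracket_def)
  then show "inj (ext3 :: 'k pol3 \<Rightarrow> _)" by (intro injI) (metis ext_simps(4) mult.right_neutral)
qed

lemma ext_0: "ext0 0 = (\<lambda>_. 0)" "ext1 0 = (\<lambda>_. 0)" "ext2 0 = (\<lambda>_. 0)" "ext3 0 = (\<lambda>_. 0)"
  by (auto simp: zero_prod_def ext0_def ext1_def ext2_def ext3_def fun_eq_iff split: list.split)

lemma ext_eq_0_iff:
  "ext0 F = (\<lambda>_. 0) \<longleftrightarrow> F = 0" "ext1 V = (\<lambda>_. 0) \<longleftrightarrow> V = 0" "ext2 V = (\<lambda>_. 0) \<longleftrightarrow> V = 0"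
  "ext3 F = (\<lambda>_. 0) \<longleftrightarrow> F = 0"
  using inj_eq[OF ext_inj(1), of F 0] inj_eq[OF ext_inj(2), of V 0] inj_eq[OF ext_inj(3), of V 0]
    inj_eq[OF ext_inj(4), of F 0]
  unfolding ext_0 .

lemma list_all2_conv:
  "list_all2 P ns [] \<longleftrightarrow> ns = []"
  "list_all2 P ns (F # Fs) \<longleftrightarrow> (\<exists>n ms. ns = n # ms \<and> P n F \<and> list_all2 P ms Fs)"
  by (auto simp: list_all2_Cons2)

lemma has_degree_ext0: "has_degree 0 d (ext0 F) \<longleftrightarrow> homogeneous d F"
  by (auto simp: has_degree_def)

text \<open>The coefficients are the values on the variables, which have degree 1; each argument
  therefore shifts the degree by one, here and in the analogues for \<open>ext2\<close> and
  \<open>ext3\<close>.\<close>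

lemma has_degree_ext1: "has_degree 1 d (ext1 V) \<longleftrightarrow> V \<in> hvec (d + 1)"
proof
  assume *: "has_degree 1 d (ext1 V)"
  have "homogeneous (1 + d) (app1 V v)" if "homogeneous 1 v" for v
    using *[unfolded has_degree_def, rule_format, of "[v]" "[1]"] that by simp
  from this[OF homogeneous_var(1)] this[OF homogeneous_var(2)] this[OF homogeneous_var(3)]
  show "V \<in> hvec (d + 1)" by (cases V) (simp add: add.commute)
next
  assume V: "V \<in> hvec (d + 1)"
  have "homogeneous (n + d) (app1 V F)" if "homogeneous n F" for n F
    using V homogeneous_partial[OF that]
    by (cases V) (auto intro!: homogeneous_add intro: homogeneous_mult)
  then show "has_degree 1 d (ext1 V)"
    by (auto simp: has_degree_def length_conv list_all2_conv length_Suc_conv)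
qed

lemma has_degree_ext2: "has_degree 2 d (ext2 V) \<longleftrightarrow> V \<in> hvec (d + 2)"
proof
  assume *: "has_degree 2 d (ext2 V)"
  have "homogeneous (d + 2) (app2 V v w)" if "homogeneous 1 v" "homogeneous 1 w" for v w
    using *[unfolded has_degree_def, rule_format, of "[v, w]" "[1, 1]"] that by (simp add: add.commute)
  from this[OF homogeneous_var(2,3)] this[OF homogeneous_var(3,1)] this[OF homogeneous_var(1,2)]
  show "V \<in> hvec (d + 2)" by (cases V) simp
next
  assume V: "V \<in> hvec (d + 2)"
  have "homogeneous (n + m + d) (app2 V F G)" if F: "homogeneous n F" and G: "homogeneous m G" for n m F G
  proof -
    have "app2 V F G = dot V (cross (grad F) (grad G))" by (cases V) (simp add: grad.simps)
    moreover have "cross (grad F) (grad G) \<in> hvec (n + m - 2)"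
      by (rule cross_hvec[OF grad_hvec[OF F] grad_hvec[OF G]]) simp
    then have "homogeneous (n + m + d) (dot V (cross (grad F) (grad G)))"
      by (rule dot_hpol[OF V]) simp
    ultimately show ?thesis by simp
  qed
  then show "has_degree 2 d (ext2 V)"
    by (auto simp: has_degree_def length_conv list_all2_conv add.assoc)
qed

lemma has_degree_ext3:
  fixes H :: "'k::idom pol3"
  shows "has_degree 3 d (ext3 H) \<longleftrightarrow> homogeneous (d + 3) H"
proof
  assume *: "has_degree 3 d (ext3 H)"
  have "homogeneous (d + 3) (H * jacobian_bracket var_x var_y var_z)"
    using *[unfolded has_degree_def, rule_format, of "[var_x, var_y, var_z]" "[1, 1, 1]"]
      homogeneous_var[where 'k = 'k] by (simp add: add.commute)
  then show "homogeneous (d + 3) H" by (simp add: jacobian_bracket_def)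
next
  assume H: "homogeneous (d + 3) H"
  have "homogeneous (n + m + l + d) (H * jacobian_bracket F G K)"
    if F: "homogeneous n F" and G: "homogeneous m G" and K: "homogeneous l K" for n m l F G K
  proof -
    have "jacobian_bracket F G K = dot (grad F) (cross (grad G) (grad K))"
      by (simp add: grad.simps jacobian_bracket_def)
    moreover have "cross (grad G) (grad K) \<in> hvec (m + l - 2)"
      by (rule cross_hvec[OF grad_hvec[OF G] grad_hvec[OF K]]) simp
    then have "homogeneous (n + m + l - 3) (dot (grad F) (cross (grad G) (grad K)))"
      by (rule dot_hpol[OF grad_hvec[OF F]]) simp
    ultimately have "homogeneous (n + m + l - 3) (jacobian_bracket F G K)" by simp
    then show ?thesis by (rule homogeneous_mult[OF H]) simp
  qed
  then show "has_degree 3 d (ext3 H)"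
    by (auto simp: has_degree_def length_conv list_all2_conv add.assoc)
qed

section \<open>Hilbert series\<close>

text \<open>Coboundaries are images of arbitrary multiderivations. Projecting a primitive to the
  right degree shows that a homogeneous coboundary has a homogeneous primitive.\<close>

fun hvec_comp :: "int \<Rightarrow> 'k::idom vec3 \<Rightarrow> 'k vec3" where
  "hvec_comp n (a, b, c) = (hom_comp n a, hom_comp n b, hom_comp n c)"

lemma hvec_comp_hvec: "hvec_comp n V \<in> hvec n"
  by (cases V) simp

lemma hvec_comp_id: "V \<in> hvec n \<Longrightarrow> hvec_comp n V = V"
  by (cases V) (auto simp: hom_comp_homogeneous)

lemma hvec_comp_grad: "hvec_comp n (grad F) = grad (hom_comp (n + 1) F)"
  by (simp add: grad.simps hom_comp_partial)

lemma hvec_comp_cross: "W \<in> hvec m \<Longrightarrow> hvec_comp n (cross V W) = cross (hvec_comp (n - m) V) W"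
  by (cases V; cases W) (auto simp: hom_comp_diff hom_comp_mult)

lemma hom_comp_dot: "W \<in> hvec m \<Longrightarrow> hom_comp n (dot V W) = dot (hvec_comp (n - m) V) W"
  by (cases V; cases W) (auto simp: hom_comp_add hom_comp_mult)

lemma hom_comp_dvg: "hom_comp n (dvg V) = dvg (hvec_comp (n + 1) V)"
  by (cases V) (simp add: hom_comp_partial hom_comp_add)

lemma hvec_comp_curl: "hvec_comp n (curl V) = curl (hvec_comp (n + 1) V)"
  by (cases V) (simp add: hom_comp_partial hom_comp_diff)

lemma hvec_comp_scal: "W \<in> hvec m \<Longrightarrow> hvec_comp n (scal F W) = scal (hom_comp (n - m) F) W"
  by (cases W) (auto simp: hom_comp_mult)

lemma hvec_comp_diff: "hvec_comp n (V - W) = hvec_comp n V - hvec_comp n W"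
  by (cases V; cases W) (simp add: hom_comp_diff)

lemma linear_range:
  fixes \<Psi> :: "'v::ab_group_add \<Rightarrow> 'k::field pol3 list \<Rightarrow> 'k pol3"
  assumes add: "\<And>u v. \<Psi> (u + v) = (\<lambda>Fs. \<Psi> u Fs + \<Psi> v Fs)"
    and smult: "\<And>c u. \<Psi> (s c u) = (\<lambda>Fs. const3 c * \<Psi> u Fs)"
  shows "(\<lambda>_. 0) \<in> range \<Psi>"
    "P \<in> range \<Psi> \<Longrightarrow> Q \<in> range \<Psi> \<Longrightarrow> (\<lambda>Fs. P Fs + Q Fs) \<in> range \<Psi>"
    "P \<in> range \<Psi> \<Longrightarrow> (\<lambda>Fs. const3 c * P Fs) \<in> range \<Psi>"
proof -
  show "(\<lambda>_. 0) \<in> range \<Psi>" using smult[of 0 0] by (intro range_eqI[of _ _ "s 0 0"]) simp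
  show "(\<lambda>Fs. P Fs + Q Fs) \<in> range \<Psi>" if PQ: "P \<in> range \<Psi>" "Q \<in> range \<Psi>"
  proof -
    obtain u v where "P = \<Psi> u" "Q = \<Psi> v" using PQ by blast
    then show ?thesis using add[of u v] by (intro range_eqI[of _ _ "u + v"]) simp
  qed
  show "(\<lambda>Fs. const3 c * P Fs) \<in> range \<Psi>" if P: "P \<in> range \<Psi>"
  proof -
    obtain u where "P = \<Psi> u" using P by blast
    then show ?thesis using smult[of c u] by (intro range_eqI[of _ _ "s c u"]) simp
  qed
qed

context tame_cubic
begin

lemma hvec_comp_diff0: "hvec_comp (n + 1) (diff0 \<Omega> F) = diff0 \<Omega> (hom_comp n F)"
  unfolding diff0_def hvec_comp_cross[OF grad_\<Omega>] hvec_comp_grad by simp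

lemma hvec_comp_diff1: "hvec_comp (n + 1) (diff1 \<Omega> V) = diff1 \<Omega> (hvec_comp n V)"
  unfolding diff1_def hvec_comp_diff hvec_comp_scal[OF grad_\<Omega>] hvec_comp_grad hom_comp_dot[OF grad_\<Omega>] hom_comp_dvg
  by simp

lemma hom_comp_diff2: "hom_comp (n + 1) (diff2 \<Omega> V) = diff2 \<Omega> (hvec_comp n V)"
  unfolding diff2_def hom_comp_uminus hom_comp_dot[OF grad_\<Omega>] hvec_comp_curl by simp

lemma coboundaries_0: "coboundaries (jacobian_bracket \<Omega>) 0 = {\<lambda>_. 0}"
  by (simp add: coboundaries_def)

lemma coboundaries_1: "coboundaries (jacobian_bracket \<Omega>) 1 = range (\<lambda>F. ext1 (diff0 \<Omega> F))"
  by (simp add: coboundaries_def multiderivations_0 image_image poisson_diff_ext0)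

lemma coboundaries_2: "coboundaries (jacobian_bracket \<Omega>) 2 = range (\<lambda>V. ext2 (diff1 \<Omega> V))"
  by (simp add: coboundaries_def numeral_2_eq_2 image_image multiderivations_1[unfolded One_nat_def]
      poisson_diff_ext1[unfolded One_nat_def])

lemma coboundaries_3: "coboundaries (jacobian_bracket \<Omega>) 3 = range (\<lambda>V. ext3 (diff2 \<Omega> V))"
  by (simp add: coboundaries_def numeral_3_eq_3 image_image multiderivations_2[unfolded numeral_2_eq_2]
      poisson_diff_ext2[unfolded numeral_2_eq_2])

lemma cocycles_0:
  "ext0 ` Z0 d = {Q \<in> cocycles (jacobian_bracket \<Omega>) 0. has_degree 0 d Q}"
  unfolding cocycles_def multiderivations_0
  by (auto simp: poisson_diff_ext0 ext_eq_0_iff has_degree_ext0 hpol_def)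

lemma cocycles_1:
  "ext1 ` Z1 d = {Q \<in> cocycles (jacobian_bracket \<Omega>) 1. has_degree 1 d Q}"
  unfolding cocycles_def multiderivations_1
  by (auto simp: poisson_diff_ext1[unfolded One_nat_def] ext_eq_0_iff has_degree_ext1[unfolded One_nat_def])

lemma cocycles_2:
  "ext2 ` Z2 d = {Q \<in> cocycles (jacobian_bracket \<Omega>) 2. has_degree 2 d Q}"
  unfolding cocycles_def multiderivations_2
  by (auto simp: poisson_diff_ext2 ext_eq_0_iff has_degree_ext2)

lemma cocycles_3:
  "ext3 ` hpol (d + 3) = {Q \<in> cocycles (jacobian_bracket \<Omega>) 3. has_degree 3 d Q}"
  unfolding cocycles_def multiderivations_3
  by (auto simp: poisson_diff_ext3 has_degree_ext3 hpol_def)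

lemma PH_0:
  fixes d :: int
  defines "M \<equiv> PH_component (jacobian_bracket \<Omega>) 0 d"
  shows "vectorspace class_ring M" "vectorspace.fin_dim class_ring M" "vectorspace.dim class_ring M = casimir_dim d"
proof -
  have K: "{u \<in> Z0 d. ext0 u \<in> coboundaries (jacobian_bracket \<Omega>) 0} = {0}"
    unfolding coboundaries_0 by (auto simp: ext_eq_0_iff hpol_def diff0_0)
  note * = PH_component_dim[where \<Phi> = ext0, OF findim_Z0 cocycles_0 ext_add(1) ext_smult(1) _ _ _ K]
  show "vectorspace class_ring M" "vectorspace.fin_dim class_ring M"
    unfolding M_def by (rule *; simp add: coboundaries_0)+
  have "vectorspace.dim class_ring M + sdim sc1 ({0} :: 'k pol3 set) = sdim sc1 (Z0 d)"
    unfolding M_def by (rule *) (simp_all add: coboundaries_0)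
  then show "vectorspace.dim class_ring M = casimir_dim d"
    by (simp only: sdim_zero(2)[OF vector_space_sc1] sdim_Z0 add_0_right)
qed

lemma PH_1:
  fixes d :: int
  defines "M \<equiv> PH_component (jacobian_bracket \<Omega>) 1 d"
  shows "vectorspace class_ring M" "vectorspace.fin_dim class_ring M" "vectorspace.dim class_ring M = casimir_dim d"
proof -
  let ?B = "coboundaries (jacobian_bracket \<Omega>) 1"
  have K: "{u \<in> Z1 d. ext1 u \<in> ?B} = B1 d"
  proof
    show "{u \<in> Z1 d. ext1 u \<in> ?B} \<subseteq> B1 d"
    proof
      fix V assume V: "V \<in> {u \<in> Z1 d. ext1 u \<in> ?B}"
      \<comment> \<open>F may be inhomogeneous; since V has degree d + 1, the component of F in
        degree d is also a primitive.\<close>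
      then obtain F where F: "V = diff0 \<Omega> F" unfolding coboundaries_1 by (auto dest: injD[OF ext_inj(2)])
      have "V = hvec_comp (d + 1) V" using V by (simp add: hvec_comp_id)
      then have "V = diff0 \<Omega> (hom_comp d F)" unfolding F hvec_comp_diff0 .
      then show "V \<in> B1 d" by (auto simp: hpol_def)
    qed
    show "B1 d \<subseteq> {u \<in> Z1 d. ext1 u \<in> ?B}"
    proof
      fix V assume "V \<in> B1 d"
      then obtain F where F: "homogeneous d F" "V = diff0 \<Omega> F" by (auto simp: hpol_def)
      have "V \<in> hvec (d + 1)"
        unfolding F(2) diff0_def by (rule cross_hvec[OF grad_hvec[OF F(1)] grad_\<Omega>]) simp
      then show "V \<in> {u \<in> Z1 d. ext1 u \<in> ?B}"
        unfolding coboundaries_1 F(2) by (auto simp: diff1_diff0)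
    qed
  qed
  have B: "(\<lambda>_. 0) \<in> ?B" "\<And>P Q. P \<in> ?B \<Longrightarrow> Q \<in> ?B \<Longrightarrow> (\<lambda>Fs. P Fs + Q Fs) \<in> ?B"
    "\<And>c P. P \<in> ?B \<Longrightarrow> (\<lambda>Fs. const3 c * P Fs) \<in> ?B"
    unfolding coboundaries_1
    by (rule linear_range[where s = sc1];
        simp add: diff0_add ext_add sc1_def diff0_const ext_smult(2)[unfolded sc3_def])+
  note * = PH_component_dim[where \<Phi> = ext1, OF findim_Z1 cocycles_1 ext_add(2) ext_smult(2) B K]
  show "vectorspace class_ring M" unfolding M_def by (rule *(1)) assumption+
  show "vectorspace.fin_dim class_ring M" unfolding M_def by (rule *(2)) assumption+
  have "vectorspace.dim class_ring M + sdim sc3 (B1 d) = sdim sc3 (Z1 d)"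
    unfolding M_def by (rule *(3)) assumption+
  then show "vectorspace.dim class_ring M = casimir_dim d" by (simp only: sdim_Z1)
qed

lemma PH_2:
  fixes d :: int
  defines "M \<equiv> PH_component (jacobian_bracket \<Omega>) 2 d"
  shows "vectorspace class_ring M" "vectorspace.fin_dim class_ring M"
    "vectorspace.dim class_ring M + sdim sc3 (B2 d) = sdim sc3 (Z2 d)"
proof -
  let ?B = "coboundaries (jacobian_bracket \<Omega>) 2"
  have K: "{u \<in> Z2 d. ext2 u \<in> ?B} = B2 d"
  proof
    show "{u \<in> Z2 d. ext2 u \<in> ?B} \<subseteq> B2 d"
    proof
      fix V assume V: "V \<in> {u \<in> Z2 d. ext2 u \<in> ?B}"
      then obtain U where U: "V = diff1 \<Omega> U" unfolding coboundaries_2 by (auto dest: injD[OF ext_inj(3)])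
      have "V = hvec_comp (d + 1 + 1) V" using V hvec_comp_id[of V "d + 2"] by (simp add: add.commute)
      then have "V = diff1 \<Omega> (hvec_comp (d + 1) U)" unfolding U hvec_comp_diff1 .
      then show "V \<in> B2 d" using hvec_comp_hvec by blast
    qed
    show "B2 d \<subseteq> {u \<in> Z2 d. ext2 u \<in> ?B}"
    proof
      fix V assume "V \<in> B2 d"
      then obtain U where U: "U \<in> hvec (d + 1)" "V = diff1 \<Omega> U" by auto
      have "V = hvec_comp (d + 1 + 1) V" unfolding U(2) hvec_comp_diff1 by (simp add: hvec_comp_id[OF U(1)])
      then have "V \<in> hvec (d + 1 + 1)" by (metis hvec_comp_hvec)
      then have "V \<in> hvec (d + 2)" by (simp add: add.commute)
      then show "V \<in> {u \<in> Z2 d. ext2 u \<in> ?B}"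
        unfolding coboundaries_2 U(2) by (auto simp: diff2_diff1)
    qed
  qed
  have B: "(\<lambda>_. 0) \<in> ?B" "\<And>P Q. P \<in> ?B \<Longrightarrow> Q \<in> ?B \<Longrightarrow> (\<lambda>Fs. P Fs + Q Fs) \<in> ?B"
    "\<And>c P. P \<in> ?B \<Longrightarrow> (\<lambda>Fs. const3 c * P Fs) \<in> ?B"
    unfolding coboundaries_2
    by (rule linear_range[where s = sc3];
        simp add: diff1_add ext_add sc3_def diff1_const ext_smult(3)[unfolded sc3_def])+
  note * = PH_component_dim[where \<Phi> = ext2, OF findim_Z2 cocycles_2 ext_add(3) ext_smult(3) B K]
  show "vectorspace class_ring M" unfolding M_def by (rule *(1)) assumption+
  show "vectorspace.fin_dim class_ring M" unfolding M_def by (rule *(2)) assumption+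
  show "vectorspace.dim class_ring M + sdim sc3 (B2 d) = sdim sc3 (Z2 d)"
    unfolding M_def by (rule *(3)) assumption+
qed

lemma PH_3:
  fixes d :: int
  defines "M \<equiv> PH_component (jacobian_bracket \<Omega>) 3 d"
  shows "vectorspace class_ring M" "vectorspace.fin_dim class_ring M"
    "vectorspace.dim class_ring M + sdim sc1 (B3 d) = poly_dim (d + 3)"
proof -
  let ?B = "coboundaries (jacobian_bracket \<Omega>) 3"
  have K: "{u \<in> hpol (d + 3). ext3 u \<in> ?B} = B3 d"
  proof
    show "{u \<in> hpol (d + 3). ext3 u \<in> ?B} \<subseteq> B3 d"
    proof
      fix H assume H: "H \<in> {u \<in> hpol (d + 3). ext3 u \<in> ?B}"
      then obtain U where U: "H = diff2 \<Omega> U" unfolding coboundaries_3 by (auto dest: injD[OF ext_inj(4)])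
      have "H = hom_comp (d + 2 + 1) H" using H hom_comp_homogeneous[of "d + 3" H] by (simp add: hpol_def add.commute)
      then have "H = diff2 \<Omega> (hvec_comp (d + 2) U)" unfolding U hom_comp_diff2 .
      then show "H \<in> B3 d" using hvec_comp_hvec by blast
    qed
    show "B3 d \<subseteq> {u \<in> hpol (d + 3). ext3 u \<in> ?B}"
    proof
      fix H assume "H \<in> B3 d"
      then obtain U where U: "U \<in> hvec (d + 2)" "H = diff2 \<Omega> U" by auto
      have "H = hom_comp (d + 2 + 1) H" unfolding U(2) hom_comp_diff2 by (simp add: hvec_comp_id[OF U(1)])
      then have "homogeneous (d + 2 + 1) H" by (metis homogeneous_hom_comp)
      then have "H \<in> hpol (d + 3)" by (simp add: hpol_def add.commute)
      then show "H \<in> {u \<in> hpol (d + 3). ext3 u \<in> ?B}"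
        unfolding coboundaries_3 U(2) by auto
    qed
  qed
  have B: "(\<lambda>_. 0) \<in> ?B" "\<And>P Q. P \<in> ?B \<Longrightarrow> Q \<in> ?B \<Longrightarrow> (\<lambda>Fs. P Fs + Q Fs) \<in> ?B"
    "\<And>c P. P \<in> ?B \<Longrightarrow> (\<lambda>Fs. const3 c * P Fs) \<in> ?B"
    unfolding coboundaries_3
    by (rule linear_range[where s = sc3];
        simp add: diff2_add ext_add sc3_def diff2_const ext_smult(4)[unfolded sc1_def])+
  note * = PH_component_dim[where \<Phi> = ext3, OF findim_hpol cocycles_3 ext_add(4) ext_smult(4) B K]
  show "vectorspace class_ring M" unfolding M_def by (rule *(1)) assumption+
  show "vectorspace.fin_dim class_ring M" unfolding M_def by (rule *(2)) assumption+
  have "vectorspace.dim class_ring M + sdim sc1 (B3 d) = sdim sc1 (hpol (d + 3) :: 'k pol3 set)"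
    unfolding M_def by (rule *(3)) assumption+
  then show "vectorspace.dim class_ring M + sdim sc1 (B3 d) = poly_dim (d + 3)"
    by (simp only: sdim_hpol_poly_dim)
qed

text \<open>The first identity evaluates the dimension of PH^3. The second is, up to sign, the Euler
  characteristic of the complex in degree d: the series of \<open>poly_dim\<close> is 1 / (1 - t)^3,
  so its third difference is concentrated in degree -3.\<close>

lemma casimir_dim_poly_dim:
  "int (poly_dim (d + 3)) + 2 * int (poly_dim d) - 3 * int (poly_dim (d + 1)) - int (casimir_dim d) =
     int (casimir_dim (d + 3) + 3 * casimir_dim (d + 2) + 3 * casimir_dim (d + 1) + casimir_dim d)"
  and poly_dim_third_difference:
  "int (poly_dim (d + 3)) - 3 * int (poly_dim (d + 2)) + 3 * int (poly_dim (d + 1)) - int (poly_dim d) = (if d = - 3 then 1 else 0)"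
proof -
  \<comment> \<open>The product also vanishes at n = -1 and n = -2, so the quadratic formula extends
    two places below zero.\<close>
  have *: "2 * int (poly_dim n) = (n + 1) * (n + 2)" if "n \<ge> - 2" for n
  proof (cases "n < 0")
    case True
    then have "n = - 1 \<or> n = - 2" using that by auto
    then show ?thesis by (auto simp: poly_dim_def)
  next
    case False
    have "even ((n + 1) * (n + 2))" by auto
    moreover have "(n + 1) * (n + 2) div 2 \<ge> 0" using False by simp
    ultimately show ?thesis using False by (simp add: poly_dim_def)
  qed
  have neg: "poly_dim n = 0" if "n < 0" for n using that by (simp add: poly_dim_def)
  consider "d < - 3" | "d = - 3" | "d \<ge> - 2" by linarith
  then show "int (poly_dim (d + 3)) - 3 * int (poly_dim (d + 2)) + 3 * int (poly_dim (d + 1)) - int (poly_dim d) = (if d = - 3 then 1 else 0)"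
  proof cases
    case 3
    then show ?thesis using *[of "d + 3"] *[of "d + 2"] *[of "d + 1"] *[of d] by (simp add: algebra_simps)
  qed (simp_all add: neg, simp add: poly_dim_def)
  consider "d < - 3" | "d = - 3" | "d = - 2" | "d = - 1" | "d \<ge> 0" by linarith
  then show "int (poly_dim (d + 3)) + 2 * int (poly_dim d) - 3 * int (poly_dim (d + 1)) - int (casimir_dim d) =
     int (casimir_dim (d + 3) + 3 * casimir_dim (d + 2) + 3 * casimir_dim (d + 1) + casimir_dim d)"
  proof cases
    case 5
    have "int (poly_dim (d + 3)) + 2 * int (poly_dim d) - 3 * int (poly_dim (d + 1)) = 3"
      using *[of "d + 3"] *[of "d + 1"] *[of d] 5 by (simp add: algebra_simps)
    \<comment> \<open>Exactly one of d, d + 1, d + 2 is a multiple of 3; weight 3 results in each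
      case, from d as 1 + 1 + 1 with d + 3.\<close>
    moreover have "casimir_dim (d + 3) + 3 * casimir_dim (d + 2) + 3 * casimir_dim (d + 1) + casimir_dim d + casimir_dim d = 3"
    proof -
      have "3 dvd d \<or> 3 dvd d + 1 \<or> 3 dvd d + 2" by presburger
      then consider "3 dvd d" | "3 dvd d + 1" | "3 dvd d + 2" by blast
      then show ?thesis
      proof cases
        case 1
        then have "\<not> 3 dvd d + 1" "\<not> 3 dvd d + 2" "3 dvd d + 3" by presburger+
        then show ?thesis using 1 5 by (simp add: casimir_dim_def)
      next
        case 2
        then have "\<not> 3 dvd d" "\<not> 3 dvd d + 2" "\<not> 3 dvd d + 3" by presburger+
        then show ?thesis using 2 5 by (simp add: casimir_dim_def)
      next
        case 3
        then have "\<not> 3 dvd d" "\<not> 3 dvd d + 1" "\<not> 3 dvd d + 3" by presburger+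
        then show ?thesis using 3 5 by (simp add: casimir_dim_def)
      qed
    qed
    ultimately show ?thesis by linarith
  qed (simp_all add: poly_dim_def casimir_dim_def)
qed

lemma dim_PH_3:
  "vectorspace.dim class_ring (PH_component (jacobian_bracket \<Omega>) 3 d) =
     casimir_dim (d + 3) + 3 * casimir_dim (d + 2) + 3 * casimir_dim (d + 1) + casimir_dim d"
  using PH_3(3)[of d] rank_dot[of d] rank_dvg[of d] rank_diff0[of d] casimir_dim_poly_dim[of d] by linarith

text \<open>PH^0 and PH^1 have equal dimensions and cancel in the Euler characteristic, so PH^2 and
  PH^3 differ only by its value in degree -3.\<close>

lemma dim_PH_2:
  "int (vectorspace.dim class_ring (PH_component (jacobian_bracket \<Omega>) 2 d)) =
     int (casimir_dim (d + 3) + 3 * casimir_dim (d + 2) + 3 * casimir_dim (d + 1) + casimir_dim d) - (if d = - 3 then 1 else 0)"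
  using PH_2(3)[of d] rank_diff2[of d] rank_diff1[of d] sdim_Z1[of d] rank_diff0[of d]
    rank_dot[of d] rank_dvg[of d] casimir_dim_poly_dim[of d] poly_dim_third_difference[of d]
  by linarith

end

definition casimir_series :: "rat fls" where
  "casimir_series = fps_to_fls (Abs_fps (\<lambda>n. of_nat (casimir_dim (int n))))"

lemma casimir_series_nth: "fls_nth casimir_series d = of_nat (casimir_dim d)"
  by (simp add: casimir_series_def casimir_dim_def)

lemma X_power_times_nth: "fls_nth (fls_X ^ n * f) d = fls_nth f (d - int n)"
  for f :: "'a::comm_ring_1 fls"
  by (simp add: fls_X_power_times_conv_shift)

lemma casimir_series: "casimir_series = 1 / (1 - fls_X ^ 3)"
proof -
  \<comment> \<open>The coefficient form of (1 - t^3) h = 1.\<close>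
  have e: "casimir_dim d = (if d = 0 then 1 else casimir_dim (d - 3))" for d
  proof -
    have "d \<ge> 0 \<and> 3 dvd d \<longleftrightarrow> d = 0 \<or> (d - 3 \<ge> 0 \<and> 3 dvd d - 3)" by presburger
    then show ?thesis by (auto simp: casimir_dim_def)
  qed
  have "casimir_dim (- 3) = 0" by (simp add: casimir_dim_def)
  have "(1 - fls_X ^ 3) * casimir_series = 1"
  proof (rule fls_eqI)
    fix d
    have "fls_nth ((1 - fls_X ^ 3) * casimir_series) d = of_nat (casimir_dim d) - of_nat (casimir_dim (d - 3))"
      by (simp add: left_diff_distrib X_power_times_nth casimir_series_nth)
    also have "\<dots> = (if d = 0 then 1 else 0)"
      using e[of d] \<open>casimir_dim (- 3) = 0\<close> by (cases "d = 0") simp_all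
    finally show "fls_nth ((1 - fls_X ^ 3) * casimir_series) d = fls_nth 1 d" by simp
  qed
  moreover have "(1 - fls_X ^ 3 :: rat fls) \<noteq> 0"
    using calculation by auto
  ultimately show ?thesis by (simp add: eq_divide_eq mult.commute)
qed

text \<open>Multiplication by t^3 clears the denominator and moves the coefficient of degree d to
  degree d + 3; there (1 + t)^3 contributes the weights 1, 3, 3, 1, and the constant -1 is visible
  only for d + 3 = 0.\<close>

lemma shifted_series_nth:
  "fls_nth ((1 + fls_X) ^ 3 / (fls_X ^ 3 * (1 - fls_X ^ 3)) :: rat fls) d =
     of_nat (casimir_dim (d + 3) + 3 * casimir_dim (d + 2) + 3 * casimir_dim (d + 1) + casimir_dim d)" (is "fls_nth ?h d = _")
  and shifted_series_minus_nth:
  "fls_nth (1 / fls_X ^ 3 * ((1 + fls_X) ^ 3 / (1 - fls_X ^ 3) - 1) :: rat fls) d =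
     of_nat (casimir_dim (d + 3) + 3 * casimir_dim (d + 2) + 3 * casimir_dim (d + 1) + casimir_dim d) - (if d = - 3 then 1 else 0)"
  (is "fls_nth ?g d = _")
proof -
  have X: "fls_X ^ 3 \<noteq> (0 :: rat fls)" by simp
  have 1: "fls_nth f d = fls_nth (fls_X ^ 3 * f) (d + 3)" for f :: "rat fls"
    by (simp add: X_power_times_nth)
  have e: "(1 + fls_X) ^ 3 * casimir_series =
      casimir_series + (fls_X ^ 1 * casimir_series + fls_X ^ 1 * casimir_series + fls_X ^ 1 * casimir_series)
      + (fls_X ^ 2 * casimir_series + fls_X ^ 2 * casimir_series + fls_X ^ 2 * casimir_series) + fls_X ^ 3 * casimir_series"
    by (simp add: power3_eq_cube power2_eq_square algebra_simps)
  have c: "fls_nth ((1 + fls_X) ^ 3 * casimir_series) (d + 3) =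
     of_nat (casimir_dim (d + 3) + 3 * casimir_dim (d + 2) + 3 * casimir_dim (d + 1) + casimir_dim d)"
    unfolding e fls_plus_nth X_power_times_nth casimir_series_nth by (simp add: add.commute)
  have "fls_X ^ 3 * ?h = (1 + fls_X) ^ 3 * casimir_series"
    using X by (simp add: casimir_series)
  then show "fls_nth ?h d = of_nat (casimir_dim (d + 3) + 3 * casimir_dim (d + 2) + 3 * casimir_dim (d + 1) + casimir_dim d)"
    using 1[of ?h] c by simp
  have t: "(1 + fls_X) ^ 3 / (1 - fls_X ^ 3) = (1 + fls_X) ^ 3 * casimir_series"
    by (simp add: casimir_series)
  have "x * (1 / x * y) = y" if "x \<noteq> 0" for x y :: "rat fls" using that by simp
  then have "fls_X ^ 3 * ?g = (1 + fls_X) ^ 3 * casimir_series - 1"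
    unfolding t using X by blast
  then show "fls_nth ?g d =
     of_nat (casimir_dim (d + 3) + 3 * casimir_dim (d + 2) + 3 * casimir_dim (d + 1) + casimir_dim d) - (if d = - 3 then 1 else 0)"
    using 1[of ?g] c by (simp add: eq_neg_iff_add_eq_0)
qed

theorem corollary0p7:
  fixes \<Omega> :: "'k::{alg_closed_field, field_char_0} pol3"
    and br :: "'k pol3 \<Rightarrow> 'k pol3 \<Rightarrow> 'k pol3"
  assumes "homogeneous 3 \<Omega>"
    and "Factorial_Ring.irreducible \<Omega>"
    and "unimodular_poisson \<Omega> br"
  shows "has_hilbert_series (PH_component br 0) (1 / (1 - fls_X ^ 3)) \<and>
         has_hilbert_series (PH_component br 1) (1 / (1 - fls_X ^ 3)) \<and>
         has_hilbert_series (PH_component br 2)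
           (1 / fls_X ^ 3 * ((1 + fls_X) ^ 3 / (1 - fls_X ^ 3) - 1)) \<and>
         has_hilbert_series (PH_component br 3)
           ((1 + fls_X) ^ 3 / (fls_X ^ 3 * (1 - fls_X ^ 3)))"
proof -
  interpret tame_cubic \<Omega>
    using assms(1,2) tame_irreducible_cubic by unfold_locales (auto simp: Factorial_Ring.irreducible_def)
  have br: "br = jacobian_bracket \<Omega>" by (rule unimodular_poisson_unique[OF assms(3)])
  have "has_hilbert_series (PH_component br 0) (1 / (1 - fls_X ^ 3))"
    unfolding has_hilbert_series_def br casimir_series[symmetric] casimir_series_nth using PH_0 by simp
  moreover have "has_hilbert_series (PH_component br 1) (1 / (1 - fls_X ^ 3))"
    unfolding has_hilbert_series_def br casimir_series[symmetric] casimir_series_nth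
    using PH_1[unfolded One_nat_def] by simp
  moreover have "has_hilbert_series (PH_component br 2)
      (1 / fls_X ^ 3 * ((1 + fls_X) ^ 3 / (1 - fls_X ^ 3) - 1))"
    unfolding has_hilbert_series_def br shifted_series_minus_nth
  proof (intro allI conjI PH_2)
    fix d
    show "rat_of_nat (casimir_dim (d + 3) + 3 * casimir_dim (d + 2) + 3 * casimir_dim (d + 1) + casimir_dim d) - (if d = - 3 then 1 else 0)
        = of_nat (vectorspace.dim class_ring (PH_component (jacobian_bracket \<Omega>) 2 d))"
      using arg_cong[OF dim_PH_2[of d], of rat_of_int] by simp
  qed
  moreover have "has_hilbert_series (PH_component br 3) ((1 + fls_X) ^ 3 / (fls_X ^ 3 * (1 - fls_X ^ 3)))"
    unfolding has_hilbert_series_def br shifted_series_nth using PH_3 dim_PH_3 by simp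
  ultimately show ?thesis by blast
qed

end
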